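(* Let $\mu\ge 0$, let $n\ge 0$ and $0\le l\le n$ be integers, and let $\xi_\nu=\frac{\nu\pi}{n+1}$ for $0\le\nu\le 2n+1$. Then for every $f\in L^2(W_\mu;B^3)$ and $\mathbf x\in B^3$, $$\operatorname{proj}_{l,3}^\mu f(\mathbf x)=\frac{1}{n+1}\sum_{\nu=0}^{n}\int_{-1}^1\int_{-1}^1\mathcal R_{\xi_\nu}^\mu(f;t,w)\,G_l(\xi_\nu,t,w;\mathbf x)\,dt\,\sqrt{1-w^2}\,dw$$ $$\phantom{\operatorname{proj}_{l,3}^\mu f(\mathbf x)}=\frac{1}{2n+2}\sum_{\nu=0}^{2n+1}\int_{-1}^1\int_{-1}^1\mathcal R_{\xi_\nu}^\mu(f;t,w)\,G_l(\xi_\nu,t,w;\mathbf x)\,dt\,\sqrt{1-w^2}\,dw,$$ where $$G_l(\xi,t,w;\mathbf x)=a_{\mu,3}\sum_{k=0}^l h_k^2\,D_k^{\mu+1/2}\Bigl(\xi,t;\tfrac{x_1}{\sqrt{1-x_3^2}},\tfrac{x_2}{\sqrt{1-x_3^2}}\Bigr)(1-w^2)^{k/2}(1-x_3^2)^{k/2}\,\widetilde C_{l-k}^{k+\mu+1}(w)\,\widetilde C_{l-k}^{k+\mu+1}(x_3).$$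
   Context: Ball: $B^3$ is the closed unit ball in $\mathbb R^3$; $W_\mu(\mathbf x)=(1-\|\mathbf x\|^2)^{\mu-1/2}$ on $B^3$; $a_{\mu,3}=\frac{\Gamma(\mu+2)}{\pi^{3/2}\Gamma(\mu+1/2)}=1/\int_{B^3}W_\mu$. $\mathcal V_l^3(W_\mu)$ is the space of polynomials in three variables of degree $l$ (together with $0$) orthogonal to all polynomials of degree $<l$ under $\langle P,Q\rangle=a_{\mu,3}\int_{B^3}PQW_\mu\,d\mathbf x$, and $\operatorname{proj}_{l,3}^\mu$ is the orthogonal projection of $L^2(W_\mu;B^3)$ onto $\mathcal V_l^3(W_\mu)$ (polynomial representative). For $t,w\in(-1,1)$, $\mathcal R_\theta^\mu(f;t,w)$ is the integral of $fW_\mu$ with respect to arc length over the segment $\{\mathbf x\in B^3: x_3=w,\ x_1\cos\theta+x_2\sin\theta=t\sqrt{1-w^2}\}$ (defined for a.e. $(t,w)$ when $f\in L^2(W_\mu;B^3)$). $h_k^2=(\mu+2)_k/(\mu+3/2)_k$ with $(a)_k=a(a+1)\cdots(a+k-1)$. $C_k^\lambda$ is the Gegenbauer polynomial of degree $k$, orthogonal for $(1-s^2)^{\lambda-1/2}$ on $[-1,1]$, with $C_k^\lambda(1)=(2\lambda)_k/k!$; $\widetilde C_k^\lambda=C_k^\lambda\big/\sqrt{\lambda(2\lambda)_k/((k+\lambda)k!)}$ is orthonormal for that weight normalized to integral $1$. Disk: on the closed unit disk $B^2$, $W_\mu(x,y)=(1-x^2-y^2)^{\mu-1/2}$, $a_\mu=(\mu+1/2)/\pi=1/\int_{B^2}W_\mu$,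 and $\mathcal V_k^2(W_\mu)$ is the space of polynomials in two variables of degree $k$ (with $0$) orthogonal to all polynomials of degree $<k$ under $a_\mu\int_{B^2}PQW_\mu$. $p_l^{(\alpha,\beta)}$ is the Jacobi polynomial of degree $l$ with positive leading coefficient, orthonormal for $(1-t)^\alpha(1+t)^\beta$ normalized to integral $1$ on $[-1,1]$. Orthonormal basis of $\mathcal V_k^2(W_\mu)$: with $x=r\cos\phi$, $y=r\sin\phi$, $$P_{i,\varepsilon}^k(x,y)=h_{i,k}\,p_i^{(\mu-1/2,\,k-2i)}(2r^2-1)\,r^{k-2i}S_{k-2i,\varepsilon}(\phi),$$ $S_{j,0}(\phi)=\cos j\phi$, $S_{j,1}(\phi)=\sin j\phi$, $0\le2i\le k$ if $\varepsilon=0$, $0\le2i\le k-1$ if $\varepsilon=1$, $$h_{i,k}^2=\frac1{d_{i,k}}\frac{\Gamma(k-2i+\mu+3/2)}{\Gamma(\mu+3/2)\Gamma(k-2i+1)},\quad h_{i,k}>0,\qquad d_{i,k}=\tfrac12\ (2i<k),\ d_{i,k}=1\ (2i=k).$$ $$\lambda_{i,k}^\mu=\frac{i!\,(k-i)!\,(k-i+\mu+\frac12)}{(\mu+\frac12)_i(\mu+\frac32)_{k-i}(k+\mu+\frac12)},\qquad D_k^{\mu+1/2}(\xi;x,y)=\sum_{i,\varepsilon}\lambda_{i,k}^\mu P_{i,\varepsilon}^k(\cos\xi,\sin\xi)P_{i,\varepsilon}^k(x,y)$$ (all admissible $(i,\varepsilon)$), and $$D_k^{\mu+1/2}(\xi,t;x,y)=\frac{k+\mu+1/2}{\mu+1/2}\,C_k^{\mu+1/2}(t)\,D_k^{\mu+1/2}(\xi;x,y).$$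 The expression $(1-x_3^2)^{k/2}D_k^{\mu+1/2}(\xi,t;x_1/\sqrt{1-x_3^2},x_2/\sqrt{1-x_3^2})$ is a polynomial in $\mathbf x$ and is so interpreted when $|x_3|=1$. *)

theory Defs
  imports "HOL-Analysis.Analysis" "HOL-Computational_Algebra.Polynomial"
begin

section \<open>Univariate orthogonal polynomials\<close>

text \<open>
  All weights below are of the form \<open>base powr exponent\<close>.  HOL's convention \<open>0 powr a = 0\<close> only
  affects them where the base vanishes, which is a null set in every integral.
\<close>

definition jacobi_weight :: "real \<Rightarrow> real \<Rightarrow> real \<Rightarrow> real" where
  "jacobi_weight \<alpha> \<beta> t = (1 - t) powr \<alpha> * (1 + t) powr \<beta>"

text \<open>Inner product for the Jacobi weight normalized to total mass \<open>1\<close>.\<close>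

definition jacobi_inner :: "real \<Rightarrow> real \<Rightarrow> real poly \<Rightarrow> real poly \<Rightarrow> real" where
  "jacobi_inner \<alpha> \<beta> p q =
     (LINT t:{-1..1}|lborel. poly p t * poly q t * jacobi_weight \<alpha> \<beta> t) /
     (LINT t:{-1..1}|lborel. jacobi_weight \<alpha> \<beta> t)"

text \<open>
  \<open>p\<^sub>l\<close> with parameters \<open>(\<alpha>, \<beta>)\<close>: the orthonormal family, indexed by degree, with positive
  leading coefficients.  Such a family exists and is unique for \<open>\<alpha>, \<beta> > -1\<close>.
\<close>

definition jacobi_poly :: "real \<Rightarrow> real \<Rightarrow> nat \<Rightarrow> real poly" where
  "jacobi_poly \<alpha> \<beta> = (THE p.
     (\<forall>l. degree (p l) = l \<and> lead_coeff (p l) > 0) \<and>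
     (\<forall>l m. jacobi_inner \<alpha> \<beta> (p l) (p m) = (if l = m then 1 else 0)))"

text \<open>
  \<open>C\<^sub>k\<close> with parameter \<open>\<lambda>\<close>: the orthogonal family, indexed by degree, normalized by its values
  at \<open>1\<close>.  Such a family exists and is unique for \<open>\<lambda> > 0\<close>.
\<close>

definition gegenbauer_poly :: "real \<Rightarrow> nat \<Rightarrow> real poly" where
  "gegenbauer_poly lam = (THE C.
     (\<forall>k. degree (C k) = k \<and> poly (C k) 1 = pochhammer (2 * lam) k / fact k) \<and>
     (\<forall>k m. k \<noteq> m \<longrightarrow>
        (LINT s:{-1..1}|lborel.
           poly (C k) s * poly (C m) s * (1 - s\<^sup>2) powr (lam - 1/2)) = 0))"

definition gegenbauer :: "nat \<Rightarrow> real \<Rightarrow> real \<Rightarrow> real" where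
  "gegenbauer k lam s = poly (gegenbauer_poly lam k) s"

definition gegenbauer_on :: "nat \<Rightarrow> real \<Rightarrow> real \<Rightarrow> real" where
  "gegenbauer_on k lam s =
     gegenbauer k lam s / sqrt (lam * pochhammer (2 * lam) k / ((real k + lam) * fact k))"


section \<open>The weighted ball\<close>

definition ball_weight :: "real \<Rightarrow> real^3 \<Rightarrow> real" where
  "ball_weight \<mu> x = (1 - (norm x)\<^sup>2) powr (\<mu> - 1/2)"

definition ball_const :: "real \<Rightarrow> real" where
  "ball_const \<mu> = Gamma (\<mu> + 2) / (pi powr (3/2) * Gamma (\<mu> + 1/2))"

definition ball_inner :: "real \<Rightarrow> (real^3 \<Rightarrow> real) \<Rightarrow> (real^3 \<Rightarrow> real) \<Rightarrow> real" where
  "ball_inner \<mu> f g =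
     ball_const \<mu> * (LINT x:cball 0 1|lebesgue. f x * g x * ball_weight \<mu> x)"

text \<open>Elements of \<open>L\<^sup>2\<close> are represented by functions; their values outside the ball are irrelevant.\<close>

definition ball_L2 :: "real \<Rightarrow> (real^3 \<Rightarrow> real) set" where
  "ball_L2 \<mu> = {f. set_borel_measurable lebesgue (cball 0 1) f \<and>
     set_integrable lebesgue (cball 0 1) (\<lambda>x. (f x)\<^sup>2 * ball_weight \<mu> x)}"

text \<open>Polynomial functions of total degree at most \<open>N\<close>; the exponents of a monomial are a function \<open>e\<close>.\<close>

definition polys_le :: "nat \<Rightarrow> (real^'n \<Rightarrow> real) set" where
  "polys_le N = {p. \<exists>c. p = (\<lambda>x. \<Sum>e\<in>{e::'n \<Rightarrow> nat. (\<Sum>i\<in>UNIV. e i) \<le> N}.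
     c e * (\<Prod>i\<in>UNIV. (x $ i) ^ e i))}"

definition polys_deg :: "nat \<Rightarrow> (real^'n \<Rightarrow> real) set" where
  "polys_deg l = {p \<in> polys_le l. \<forall>m<l. p \<notin> polys_le m}"

definition ball_V :: "real \<Rightarrow> nat \<Rightarrow> (real^3 \<Rightarrow> real) set" where
  "ball_V \<mu> l = {p. (p \<in> polys_deg l \<or> p = (\<lambda>x. 0)) \<and>
     (\<forall>m<l. \<forall>q\<in>polys_le m. ball_inner \<mu> p q = 0)}"

definition ball_proj :: "real \<Rightarrow> nat \<Rightarrow> (real^3 \<Rightarrow> real) \<Rightarrow> real^3 \<Rightarrow> real" where
  "ball_proj \<mu> l f =
     (THE p. p \<in> ball_V \<mu> l \<and> (\<forall>q\<in>ball_V \<mu> l. ball_inner \<mu> (\<lambda>x. f x - p x) q = 0))"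


section \<open>The weighted Radon projection on horizontal slices\<close>

definition chord_seg :: "real \<Rightarrow> real \<Rightarrow> real \<Rightarrow> (real^3) set" where
  "chord_seg \<theta> t w =
     {x \<in> cball 0 1. x $ 3 = w \<and> x $ 1 * cos \<theta> + x $ 2 * sin \<theta> = t * sqrt (1 - w\<^sup>2)}"

definition chord_pt :: "real \<Rightarrow> real \<Rightarrow> real \<Rightarrow> real \<Rightarrow> real^3" where
  "chord_pt \<theta> t w s = vector
     [t * sqrt (1 - w\<^sup>2) * cos \<theta> - s * sin \<theta>,
      t * sqrt (1 - w\<^sup>2) * sin \<theta> + s * cos \<theta>,
      w]"

text \<open>
  \<open>chord_pt\<close> is an isometric parametrization of the line containing the segment, so the integral
  over the segment with respect to arc length is the Lebesgue integral in the parameter.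
\<close>

lemma dist_chord_pt: "dist (chord_pt \<theta> t w s) (chord_pt \<theta> t w s') = \<bar>s - s'\<bar>"
proof -
  have "chord_pt \<theta> t w s - chord_pt \<theta> t w s' =
          (s - s') *\<^sub>R (vector [- sin \<theta>, cos \<theta>, 0] :: real^3)"
    by (simp add: chord_pt_def vec_eq_iff forall_3 algebra_simps)
  moreover have "norm (vector [- sin \<theta>, cos \<theta>, 0] :: real^3) = 1"
    by (simp add: norm_vec_def L2_set_def sum_3)
  ultimately show ?thesis
    by (simp add: dist_norm)
qed

lemma chord_pt_image: "chord_pt \<theta> t w ` {s. chord_pt \<theta> t w s \<in> cball 0 1} = chord_seg \<theta> t w"
proof (intro equalityI subsetI)
  fix x assume "x \<in> chord_pt \<theta> t w ` {s. chord_pt \<theta> t w s \<in> cball 0 1}"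
  then obtain s where s: "x = chord_pt \<theta> t w s" "chord_pt \<theta> t w s \<in> cball 0 1"
    by blast
  let ?r = "t * sqrt (1 - w\<^sup>2)"
  have "(?r * cos \<theta> - s * sin \<theta>) * cos \<theta> + (?r * sin \<theta> + s * cos \<theta>) * sin \<theta>
        = ?r * ((sin \<theta>)\<^sup>2 + (cos \<theta>)\<^sup>2)"
    by (simp only: power2_eq_square) algebra
  then show "x \<in> chord_seg \<theta> t w"
    using s by (simp add: chord_seg_def chord_pt_def)
next
  fix x assume x: "x \<in> chord_seg \<theta> t w"
  define s where "s = x $ 2 * cos \<theta> - x $ 1 * sin \<theta>"
  have r: "t * sqrt (1 - w\<^sup>2) = x $ 1 * cos \<theta> + x $ 2 * sin \<theta>" and w: "x $ 3 = w"
    using x by (auto simp: chord_seg_def)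
  have "(x $ 1 * cos \<theta> + x $ 2 * sin \<theta>) * cos \<theta> - s * sin \<theta>
          = x $ 1 * ((sin \<theta>)\<^sup>2 + (cos \<theta>)\<^sup>2)"
    "(x $ 1 * cos \<theta> + x $ 2 * sin \<theta>) * sin \<theta> + s * cos \<theta>
          = x $ 2 * ((sin \<theta>)\<^sup>2 + (cos \<theta>)\<^sup>2)"
    unfolding s_def by (simp_all only: power2_eq_square) algebra+
  then have "x = chord_pt \<theta> t w s"
    by (simp add: chord_pt_def vec_eq_iff forall_3 r w)
  with x show "x \<in> chord_pt \<theta> t w ` {s. chord_pt \<theta> t w s \<in> cball 0 1}"
    by (auto simp: chord_seg_def)
qed

definition radon :: "real \<Rightarrow> (real^3 \<Rightarrow> real) \<Rightarrow> real \<Rightarrow> real \<Rightarrow> real \<Rightarrow> real" where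
  "radon \<mu> f \<theta> t w =
     (LINT s:{s. chord_pt \<theta> t w s \<in> chord_seg \<theta> t w}|lebesgue.
        f (chord_pt \<theta> t w s) * ball_weight \<mu> (chord_pt \<theta> t w s))"


section \<open>The kernels\<close>

definition disk_d :: "nat \<Rightarrow> nat \<Rightarrow> real" where
  "disk_d i k = (if 2 * i = k then 1 else 1/2)"

definition disk_h :: "real \<Rightarrow> nat \<Rightarrow> nat \<Rightarrow> real" where
  "disk_h \<mu> i k = sqrt (1 / disk_d i k *
     (Gamma (real (k - 2 * i) + \<mu> + 3/2) / (Gamma (\<mu> + 3/2) * Gamma (real (k - 2 * i) + 1))))"

definition ang :: "nat \<Rightarrow> nat \<Rightarrow> real \<Rightarrow> real" where
  "ang j \<epsilon> \<phi> = (if \<epsilon> = 0 then cos (real j * \<phi>) else sin (real j * \<phi>))"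

text \<open>Polar coordinates: \<open>r\<close> and \<open>\<phi>\<close> are the modulus and argument of \<open>x + iy\<close>.\<close>

definition disk_P :: "real \<Rightarrow> nat \<Rightarrow> nat \<Rightarrow> nat \<Rightarrow> real \<Rightarrow> real \<Rightarrow> real" where
  "disk_P \<mu> k i \<epsilon> x y =
     (let r = cmod (Complex x y); \<phi> = Arg (Complex x y) in
        disk_h \<mu> i k * poly (jacobi_poly (\<mu> - 1/2) (real (k - 2 * i)) i) (2 * r\<^sup>2 - 1) *
        r ^ (k - 2 * i) * ang (k - 2 * i) \<epsilon> \<phi>)"

definition disk_lambda :: "real \<Rightarrow> nat \<Rightarrow> nat \<Rightarrow> real" where
  "disk_lambda \<mu> i k =
     fact i * fact (k - i) * (real (k - i) + \<mu> + 1/2) /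
     (pochhammer (\<mu> + 1/2) i * pochhammer (\<mu> + 3/2) (k - i) * (real k + \<mu> + 1/2))"

text \<open>For \<open>\<epsilon> \<in> {0, 1}\<close> the admissible \<open>i\<close> are those with \<open>0 \<le> 2 i \<le> k - \<epsilon>\<close>.\<close>

definition disk_D :: "real \<Rightarrow> nat \<Rightarrow> real \<Rightarrow> real \<Rightarrow> real \<Rightarrow> real" where
  "disk_D \<mu> k \<xi> x y =
     (\<Sum>(i, \<epsilon>)\<in>{(i, \<epsilon>). \<epsilon> \<in> {0, 1} \<and> 2 * i + \<epsilon> \<le> k}.
        disk_lambda \<mu> i k * disk_P \<mu> k i \<epsilon> (cos \<xi>) (sin \<xi>) * disk_P \<mu> k i \<epsilon> x y)"

definition ridge_D :: "real \<Rightarrow> nat \<Rightarrow> real \<Rightarrow> real \<Rightarrow> real \<Rightarrow> real \<Rightarrow> real" where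
  "ridge_D \<mu> k \<xi> t x y =
     (real k + \<mu> + 1/2) / (\<mu> + 1/2) * gegenbauer k (\<mu> + 1/2) t * disk_D \<mu> k \<xi> x y"

definition slice_expr :: "real \<Rightarrow> nat \<Rightarrow> real \<Rightarrow> real \<Rightarrow> real^3 \<Rightarrow> real" where
  "slice_expr \<mu> k \<xi> t x =
     sqrt (1 - (x $ 3)\<^sup>2) ^ k *
     ridge_D \<mu> k \<xi> t (x $ 1 / sqrt (1 - (x $ 3)\<^sup>2)) (x $ 2 / sqrt (1 - (x $ 3)\<^sup>2))"

text \<open>
  On the open slab \<open>\<bar>x $ 3\<bar> < 1\<close> the expression \<open>slice_expr\<close> is a polynomial in \<open>x\<close>; elsewhere
  (in the ball: at the two poles only) it is read as the value of this polynomial.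
\<close>

definition slice_D :: "real \<Rightarrow> nat \<Rightarrow> real \<Rightarrow> real \<Rightarrow> real^3 \<Rightarrow> real" where
  "slice_D \<mu> k \<xi> t x =
     (if \<bar>x $ 3\<bar> < 1 then slice_expr \<mu> k \<xi> t x
      else (THE p. real_polynomial_function p \<and>
              (\<forall>y. \<bar>y $ 3\<bar> < 1 \<longrightarrow> p y = slice_expr \<mu> k \<xi> t y)) x)"

text \<open>\<open>hsq \<mu> k\<close> is the constant written \<open>h\<^sub>k\<^sup>2\<close>.\<close>

definition hsq :: "real \<Rightarrow> nat \<Rightarrow> real" where
  "hsq \<mu> k = pochhammer (\<mu> + 2) k / pochhammer (\<mu> + 3/2) k"

definition G_kernel :: "real \<Rightarrow> nat \<Rightarrow> real \<Rightarrow> real \<Rightarrow> real \<Rightarrow> real^3 \<Rightarrow> real" where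
  "G_kernel \<mu> l \<xi> t w x = ball_const \<mu> *
     (\<Sum>k = 0..l. hsq \<mu> k * slice_D \<mu> k \<xi> t x * sqrt (1 - w\<^sup>2) ^ k *
        gegenbauer_on (l - k) (real k + \<mu> + 1) w *
        gegenbauer_on (l - k) (real k + \<mu> + 1) (x $ 3))"

end

theory Submission
  imports Defs
begin

text \<open>
  The slice expansion of the kernel shows that the right-hand side is \<open>\<Sum>\<^sub>j \<langle>f, X\<^sub>j\<rangle> Y\<^sub>j(x)\<close>, where
  \<open>j = (k, i, \<epsilon>)\<close>, \<open>Y\<^sub>j\<close> is the usual basis of the polynomials of degree \<open>l\<close> orthogonal to lower degrees
  (a Gegenbauer polynomial in \<open>x\<^sub>3\<close> times a disk polynomial on the slice), and \<open>X\<^sub>j\<close> is a combination over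
  the nodes of the ridge polynomials obtained by replacing the disk polynomial by \<open>C\<^sub>k\<close> of a linear form.
  Such a sum is the orthogonal projection as soon as \<open>(Y\<^sub>j)\<close> and \<open>(X\<^sub>j)\<close> are biorthogonal, both lie in
  the space, and \<open>(Y\<^sub>j)\<close> spans it.

  Biorthogonality is the Logan--Shepp identity \<open>\<integral> P(u) C\<^sub>k(\<langle>u, \<xi>\<rangle>) = const * P(\<xi>)\<close> for disk polynomials
  \<open>P\<close> of degree \<open>k\<close>, followed by the discrete orthogonality of \<open>cos j\<phi>\<close>, \<open>sin j\<phi>\<close> on the nodes.
  For the former, the chord integral of \<open>P\<close> is a polynomial of degree at most \<open>k\<close> in the signed distance
  \<open>t\<close>, it is orthogonal to lower degrees, hence a multiple of \<open>C\<^sub>k\<close>, and the factor is read off at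
  \<open>t = 1\<close>, where the chord shrinks to the point \<open>\<xi>\<close>.

  The chord coordinates \<open>(w, t, \<sigma>)\<close> turn the ball weight into a product of three Gegenbauer weights.
  They exist for every direction, which also yields the rotation invariance needed for the disk; polar
  coordinates are avoided because the moments of \<open>1 - |z|\<^sup>2\<close> factor in chord coordinates.
\<close>

section \<open>Jacobi and Gegenbauer polynomials\<close>

text \<open>Three coincidences carry the formula. On the unit circle a disk polynomial with index
  \<open>(k, i, \<epsilon>)\<close> is a constant times \<open>cos\<close> or \<open>sin\<close> of
  \<open>k - 2 * i\<close> times the angle, and \<open>disk_lambda\<close> is the reciprocal of the
  mean of its square there. The factor \<open>hsq\<close> is the mass of the axial weight for
  \<open>k = 0\<close>, which is contained in \<open>ball_const\<close>, divided by its mass after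
  it has absorbed \<open>(1 - w\<^sup>2) ^ k\<close>. Within one degree \<open>k\<close> all
  frequencies \<open>k - 2 * i\<close> have the same parity, so only even frequencies up to
  \<open>2 * n\<close> have to sum to zero, and \<open>n + 1\<close> nodes on half a circle achieve
  this. Two obstacles shape the proof. The polynomials of the theorem are definite descriptions, so
  existence, uniqueness, norms and values at 1 need an explicit model. And \<open>f\<close> is
  Lebesgue measurable and matters up to null sets only, but \<open>radon\<close> evaluates it on
  single chords, so its values are controlled for almost every chord, by comparison with a Borel
  representative.\<close>

definition wint :: "real \<Rightarrow> real \<Rightarrow> (real \<Rightarrow> real) \<Rightarrow> real" where
  "wint \<alpha> \<beta> g = (LINT t:{-1..1}|lborel. g t * jacobi_weight \<alpha> \<beta> t)"

text \<open>Euler's Beta integral under the substitution \<open>t = 2 * s - 1\<close>. The form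
  \<open>has_bochner_integral\<close> delivers integrability together with the value.\<close>

lemma jacobi_weight_Beta:
  assumes "\<alpha> > -1" "\<beta> > -1"
  shows "has_bochner_integral lborel (\<lambda>t. indicator {-1..1} t * jacobi_weight \<alpha> \<beta> t)
           (2 powr (\<alpha> + \<beta> + 1) * Beta (\<alpha> + 1) (\<beta> + 1))"
proof -
  let ?f = "\<lambda>s::real. indicator {0..1} s * (s powr \<beta> * (1 - s) powr \<alpha>)"
  have hi: "((\<lambda>t. t powr \<beta> * (1 - t) powr \<alpha>) has_integral Beta (\<beta> + 1) (\<alpha> + 1)) {0..1}"
    using has_integral_Beta_real[of "\<beta> + 1" "\<alpha> + 1"] assms by simp
  \<comment> \<open>The gauge integral becomes a Lebesgue integral because the integrand is
    nonnegative; Borel measurability then removes the completion.\<close>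
  then have "(\<lambda>t. t powr \<beta> * (1 - t) powr \<alpha>) absolutely_integrable_on {0..1}"
    by (intro nonnegative_absolutely_integrable_1) (auto simp: integrable_on_def)
  then have si: "set_integrable lborel {0..1} (\<lambda>t. t powr \<beta> * (1 - t) powr \<alpha>)"
    unfolding set_integrable_def by (subst (asm) integrable_completion) auto
  then have 1: "has_bochner_integral lborel ?f (Beta (\<beta> + 1) (\<alpha> + 1))"
    using set_borel_integral_eq_integral(2)[OF si] integral_unique[OF hi]
    by (simp add: has_bochner_integral_iff set_integrable_def set_lebesgue_integral_def)
  have "has_bochner_integral lborel (\<lambda>x. ?f (1/2 + 1/2 * x)) (Beta (\<beta> + 1) (\<alpha> + 1) /\<^sub>R \<bar>1/2\<bar>)"
    using lborel_has_bochner_integral_real_affine_iff[of "1/2" ?f _ "1/2"] 1 by simp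
  then have "has_bochner_integral lborel (\<lambda>x. 2 powr (\<alpha> + \<beta>) * ?f (1/2 + 1/2 * x))
      (2 powr (\<alpha> + \<beta>) * (Beta (\<beta> + 1) (\<alpha> + 1) /\<^sub>R \<bar>1/2\<bar>))"
    by (intro has_bochner_integral_mult_right) auto
  moreover have "2 powr (\<alpha> + \<beta>) * ?f (1/2 + 1/2 * x) =
      indicator {-1..1} x * jacobi_weight \<alpha> \<beta> x" for x
  proof (cases "x \<in> {-1..1}")
    case True
    have e: "2 * ((1 - x) / 2) = 1 - x" "2 * ((1 + x) / 2) = 1 + x" by auto
    have "jacobi_weight \<alpha> \<beta> x = (2 * ((1 - x) / 2)) powr \<alpha> * (2 * ((1 + x) / 2)) powr \<beta>"
      by (simp only: jacobi_weight_def e)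
    also have "\<dots> = 2 powr \<alpha> * ((1 - x) / 2) powr \<alpha> * (2 powr \<beta> * ((1 + x) / 2) powr \<beta>)"
      using True by (subst (1 2) powr_mult) auto
    finally have "jacobi_weight \<alpha> \<beta> x = 2 powr \<alpha> * ((1 - x) / 2) powr \<alpha> * (2 powr \<beta> * ((1 + x) / 2) powr \<beta>)" .
    moreover have "(1 - x) / 2 = 1 - (1/2 + 1/2 * x)" "(1 + x) / 2 = 1/2 + 1/2 * x"
      by (auto simp: field_simps)
    ultimately show ?thesis
      using True by (auto simp: powr_add indicator_def)
  next
    case False
    then show ?thesis by (auto simp: indicator_def)
  qed
  moreover have "2 powr (\<alpha> + \<beta>) * (Beta (\<beta> + 1) (\<alpha> + 1) /\<^sub>R \<bar>1/2\<bar>) =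
      2 powr (\<alpha> + \<beta> + 1) * Beta (\<alpha> + 1) (\<beta> + 1)"
    by (simp add: powr_add Beta_commute)
  ultimately show ?thesis by simp
qed

lemma wint_integrable:
  assumes "\<alpha> > -1" "\<beta> > -1" "continuous_on {-1..1} g"
  shows "set_integrable lborel {-1..1} (\<lambda>t. g t * jacobi_weight \<alpha> \<beta> t)"
proof -
  have "bounded (g ` {-1..1})"
    using assms(3) compact_continuous_image compact_imp_bounded by blast
  then obtain B where B: "\<forall>x\<in>g ` {-1..1}. norm x \<le> B"
    unfolding bounded_iff by blast
  have m: "set_borel_measurable lborel {-1..1} g"
    using borel_measurable_continuous_on_indicator[OF _ assms(3)]
    by (simp add: set_borel_measurable_def)
  have "integrable lborel (\<lambda>t. B * (indicator {-1..1} t * jacobi_weight \<alpha> \<beta> t))"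
    using jacobi_weight_Beta[OF assms(1,2)] by (auto simp: has_bochner_integral_iff)
  then show ?thesis
    unfolding set_integrable_def
  proof (rule Bochner_Integration.integrable_bound)
    have "(\<lambda>x. (indicator {-1..1} x *\<^sub>R g x) * jacobi_weight \<alpha> \<beta> x) \<in> borel_measurable lborel"
      using m unfolding set_borel_measurable_def jacobi_weight_def by measurable
    then show "(\<lambda>x. indicat_real {-1..1} x *\<^sub>R (g x * jacobi_weight \<alpha> \<beta> x)) \<in> borel_measurable lborel"
      by (simp add: mult.assoc)
    show "AE x in lborel. norm (indicat_real {- 1..1} x *\<^sub>R (g x * jacobi_weight \<alpha> \<beta> x))
        \<le> norm (B * (indicat_real {- 1..1} x * jacobi_weight \<alpha> \<beta> x))"
    proof (intro AE_I2)
      fix x :: real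
      show "norm (indicat_real {- 1..1} x *\<^sub>R (g x * jacobi_weight \<alpha> \<beta> x))
        \<le> norm (B * (indicat_real {- 1..1} x * jacobi_weight \<alpha> \<beta> x))"
        using B by (auto simp: indicator_def abs_mult jacobi_weight_def intro!: mult_right_mono order_trans[OF _ abs_ge_self])
    qed
  qed
qed

lemma wint_cong: "(\<And>t. t \<in> {-1..1} \<Longrightarrow> g t = h t) \<Longrightarrow> wint \<alpha> \<beta> g = wint \<alpha> \<beta> h"
  unfolding wint_def by (intro set_lebesgue_integral_cong) auto

lemma wint_add:
  assumes "\<alpha> > -1" "\<beta> > -1" "continuous_on {-1..1} g" "continuous_on {-1..1} h"
  shows "wint \<alpha> \<beta> (\<lambda>t. g t + h t) = wint \<alpha> \<beta> g + wint \<alpha> \<beta> h"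
  unfolding wint_def
  using set_integral_add(2)[OF wint_integrable[OF assms(1,2,3)] wint_integrable[OF assms(1,2,4)]]
  by (simp add: algebra_simps)

lemma wint_cmult [simp]: "wint \<alpha> \<beta> (\<lambda>t. c * g t) = c * wint \<alpha> \<beta> g"
  unfolding wint_def by (simp add: mult.assoc)

lemma wint_cmult_right [simp]: "wint \<alpha> \<beta> (\<lambda>t. g t * c) = wint \<alpha> \<beta> g * c"
  using wint_cmult[of \<alpha> \<beta> c g] by (simp add: mult.commute)

lemma wint_zero [simp]: "wint \<alpha> \<beta> (\<lambda>t. 0) = 0"
  unfolding wint_def by simp

lemma wint_sum:
  assumes "\<alpha> > -1" "\<beta> > -1" "\<And>i. i \<in> A \<Longrightarrow> continuous_on {-1..1} (g i)"
  shows "wint \<alpha> \<beta> (\<lambda>t. \<Sum>i\<in>A. g i t) = (\<Sum>i\<in>A. wint \<alpha> \<beta> (g i))"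
  using assms(3)
proof (induction A rule: infinite_finite_induct)
  case (insert i A)
  then have "wint \<alpha> \<beta> (\<lambda>t. g i t + (\<Sum>i\<in>A. g i t)) = wint \<alpha> \<beta> (g i) + wint \<alpha> \<beta> (\<lambda>t. \<Sum>i\<in>A. g i t)"
    by (intro wint_add assms(1,2) continuous_on_sum insert.prems) auto
  with insert show ?case by simp
qed simp_all

lemma wint_one:
  assumes "\<alpha> > -1" "\<beta> > -1"
  shows "wint \<alpha> \<beta> (\<lambda>t. 1) = 2 powr (\<alpha> + \<beta> + 1) * Beta (\<alpha> + 1) (\<beta> + 1)"
  using jacobi_weight_Beta[OF assms]
  by (simp add: wint_def set_lebesgue_integral_def has_bochner_integral_iff)

lemma power_mult_powr: "(x::real) \<ge> 0 \<Longrightarrow> x ^ i * x powr a = x powr (a + real i)"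
  by (cases "x = 0") (auto simp: powr_add powr_realpow)

text \<open>Powers of \<open>1 - t\<close> and \<open>1 + t\<close> only move the parameters of the
  weight. This is the reason for keeping both parameters general: moments in these powers reduce to
  the total mass \<open>wint_one\<close>.\<close>

lemma wint_shift:
  "wint \<alpha> \<beta> (\<lambda>t. (1 - t) ^ i * (1 + t) ^ j * g t) = wint (\<alpha> + real i) (\<beta> + real j) g"
  unfolding wint_def
proof (intro set_lebesgue_integral_cong)
  show "\<forall>t. t \<in> {-1..1} \<longrightarrow> (1 - t) ^ i * (1 + t) ^ j * g t * jacobi_weight \<alpha> \<beta> t =
      g t * jacobi_weight (\<alpha> + real i) (\<beta> + real j) t"
  proof (intro allI impI)
    fix t :: real assume t: "t \<in> {-1..1}"
    have "(1 - t) ^ i * (1 + t) ^ j * g t * jacobi_weight \<alpha> \<beta> t =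
      g t * (((1 - t) ^ i * (1 - t) powr \<alpha>) * ((1 + t) ^ j * (1 + t) powr \<beta>))"
      by (simp add: jacobi_weight_def mult_ac)
    also have "\<dots> = g t * jacobi_weight (\<alpha> + real i) (\<beta> + real j) t"
      using t by (simp add: power_mult_powr jacobi_weight_def)
    finally show "(1 - t) ^ i * (1 + t) ^ j * g t * jacobi_weight \<alpha> \<beta> t =
      g t * jacobi_weight (\<alpha> + real i) (\<beta> + real j) t" .
  qed
qed auto

text \<open>A nonzero polynomial has finitely many roots and the weight is positive inside the
  interval, so a vanishing integral would make \<open>{-1<..<1}\<close> a null set.\<close>

lemma wint_eq_0_imp:
  assumes ab: "\<alpha> > -1" "\<beta> > -1" and 0: "wint \<alpha> \<beta> (\<lambda>t. (poly p t)\<^sup>2) = 0"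
  shows "p = 0"
proof -
  let ?g = "\<lambda>t. indicator {-1..1} t * ((poly p t)\<^sup>2 * jacobi_weight \<alpha> \<beta> t)"
  have "set_integrable lborel {-1..1} (\<lambda>t. (poly p t)\<^sup>2 * jacobi_weight \<alpha> \<beta> t)"
    by (intro wint_integrable ab continuous_intros)
  then have "integrable lborel ?g" by (simp add: set_integrable_def)
  moreover have "AE t in lborel. 0 \<le> ?g t"
    by (auto simp: jacobi_weight_def)
  moreover have "integral\<^sup>L lborel ?g = 0"
    using 0 by (simp add: wint_def set_lebesgue_integral_def)
  ultimately have ae: "AE t in lborel. ?g t = 0"
    by (simp add: integral_nonneg_eq_0_iff_AE)
  show "p = 0"
  proof (rule ccontr)
    assume "p \<noteq> 0"
    then have "finite {t. poly p t = 0}" by (rule poly_roots_finite)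
    then have nz: "AE t in lborel. t \<notin> {t. poly p t = 0}"
      by (intro AE_not_in finite_imp_null_set_lborel)
    have "AE t::real in lborel. t \<notin> {-1<..<1}"
      using ae nz by eventually_elim (auto simp: jacobi_weight_def)
    then have "emeasure lborel {-1<..<(1::real)} = 0"
      by (subst (asm) AE_iff_measurable[of "{-1<..<1}"]) auto
    then show False by simp
  qed
qed

section \<open>Polynomial integrands and the hypergeometric model\<close>

abbreviation wpoly :: "real \<Rightarrow> real \<Rightarrow> real poly \<Rightarrow> real" where
  "wpoly \<alpha> \<beta> p \<equiv> wint \<alpha> \<beta> (poly p)"

lemma smult_left_inj: "c \<noteq> 0 \<Longrightarrow> smult c p = smult c q \<longleftrightarrow> p = q" for c :: real
  by (auto simp: poly_eq_iff)

lemma poly_ops: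
  "poly (p + q) = (\<lambda>t. poly p t + poly q t)" "poly (p - q) = (\<lambda>t. poly p t - poly q t)"
  "poly (smult c p) = (\<lambda>t. c * poly p t)" "poly (p * q) = (\<lambda>t. poly p t * poly q t)"
  "poly (p ^ n) = (\<lambda>t. poly p t ^ n)" "poly (- p) = (\<lambda>t. - poly p t)"
  for p q :: "real poly"
  by (auto simp: fun_eq_iff poly_power)

lemma wpoly_add: "\<alpha> > -1 \<Longrightarrow> \<beta> > -1 \<Longrightarrow> wpoly \<alpha> \<beta> (p + q) = wpoly \<alpha> \<beta> p + wpoly \<alpha> \<beta> q"
  using wint_add[of \<alpha> \<beta> "poly p" "poly q"] by (simp add: poly_ops continuous_on_poly)

lemma wpoly_smult: "wpoly \<alpha> \<beta> (smult c p) = c * wpoly \<alpha> \<beta> p"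
  by (simp add: poly_ops)

lemma wpoly_diff: "\<alpha> > -1 \<Longrightarrow> \<beta> > -1 \<Longrightarrow> wpoly \<alpha> \<beta> (p - q) = wpoly \<alpha> \<beta> p - wpoly \<alpha> \<beta> q"
  using wpoly_add[of \<alpha> \<beta> p "smult (-1) q"] wpoly_smult[of \<alpha> \<beta> "-1" q] by simp

text \<open>Subtracting a multiple of \<open>Q k\<close> cancels the leading term, so a property
  stable under linear combinations has to be checked on one polynomial of each degree. It is applied
  to the powers of \<open>1 + t\<close> and to orthogonal families.\<close>

lemma degree_lt_induct [consumes 1, case_names sub scale family zero]:
  fixes Q :: "nat \<Rightarrow> real poly"
  assumes "p = 0 \<or> degree p < n"
    and add: "\<And>p q. P p \<Longrightarrow> P q \<Longrightarrow> P (p + q)"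
    and smult: "\<And>c p. P p \<Longrightarrow> P (smult c p)"
    and fam: "\<And>k. k < n \<Longrightarrow> degree (Q k) = k \<and> Q k \<noteq> 0 \<and> P (Q k)"
    and zero: "P 0"
  shows "P p"
  using assms(1)
proof (induction "degree p" arbitrary: p rule: less_induct)
  case less
  show ?case
  proof (cases "p = 0")
    case True
    then show ?thesis using zero by simp
  next
    case False
    define k where "k = degree p"
    have k: "k < n" using False less.prems by (auto simp: k_def)
    have Q: "degree (Q k) = k" "Q k \<noteq> 0" "P (Q k)" using fam[OF k] by auto
    define c where "c = lead_coeff p / lead_coeff (Q k)"
    define r where "r = p - smult c (Q k)"
    have ck: "coeff r k = 0" using Q False by (simp add: r_def c_def k_def leading_coeff_0_iff[symmetric] del: leading_coeff_0_iff)
    have "degree r \<le> k" unfolding r_def k_def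
      by (rule order_trans[OF degree_diff_le_max]) (use Q in \<open>auto simp: k_def degree_smult_le\<close>)
    then have "r = 0 \<or> degree r < k"
      using ck by (metis leading_coeff_0_iff le_neq_implies_less)
    then have "P r"
      using less.hyps[of r] zero k by (cases "r = 0") (auto simp: k_def)
    moreover have "p = r + smult c (Q k)" by (simp add: r_def)
    ultimately show ?thesis using add smult Q by metis
  qed
qed

text \<open>
  The hypergeometric polynomial \<open>\<^sub>2F\<^sub>1(-n, n + \<alpha> + \<beta> + 1; \<alpha> + 1; (1 - t)/2)\<close>; expanding at \<open>t = 1\<close> and testing
  against powers of \<open>1 + t\<close> reduces orthogonality and norm to the Chu--Vandermonde sum.
\<close>

definition jacobi_F :: "real \<Rightarrow> real \<Rightarrow> nat \<Rightarrow> real poly" where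
  "jacobi_F \<alpha> \<beta> n = (\<Sum>k\<le>n. smult (pochhammer (- real n) k * pochhammer (real n + \<alpha> + \<beta> + 1) k /
      (pochhammer (\<alpha> + 1) k * fact k)) ([:1/2, -1/2:] ^ k))"

lemma poly_jacobi_F:
  "poly (jacobi_F \<alpha> \<beta> n) t = (\<Sum>k\<le>n. pochhammer (- real n) k * pochhammer (real n + \<alpha> + \<beta> + 1) k /
      (pochhammer (\<alpha> + 1) k * fact k) * ((1 - t) / 2) ^ k)"
  by (simp add: jacobi_F_def poly_sum poly_power diff_divide_distrib)

lemma poly_jacobi_F_1: "poly (jacobi_F \<alpha> \<beta> n) 1 = 1"
proof -
  have "poly (jacobi_F \<alpha> \<beta> n) 1 = (\<Sum>k\<in>{0}. pochhammer (- real n) k * pochhammer (real n + \<alpha> + \<beta> + 1) k /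
      (pochhammer (\<alpha> + 1) k * fact k) * ((1 - 1) / 2) ^ k)"
    unfolding poly_jacobi_F by (rule sum.mono_neutral_right) auto
  then show ?thesis by simp
qed

lemma coeff_jacobi_F:
  "coeff (jacobi_F \<alpha> \<beta> n) n = pochhammer (real n + \<alpha> + \<beta> + 1) n / (2 ^ n * pochhammer (\<alpha> + 1) n)"
proof -
  have d: "degree ([:1/2, - (1/2)::real:] ^ k) = k" for k
    by (simp add: degree_power_eq)
  have l: "coeff ([:1/2, - (1/2)::real:] ^ n) n = (- 1/2) ^ n"
    using lead_coeff_power[of "[:1/2, - (1/2)::real:]" n] unfolding d by simp
  have "coeff (jacobi_F \<alpha> \<beta> n) n = (\<Sum>k\<in>{n}. pochhammer (- real n) k * pochhammer (real n + \<alpha> + \<beta> + 1) k /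
      (pochhammer (\<alpha> + 1) k * fact k) * coeff ([:1/2, -1/2::real:] ^ k) n)"
    unfolding jacobi_F_def coeff_sum coeff_smult
    by (rule sum.mono_neutral_right) (auto intro!: coeff_eq_0 simp: d)
  also have "\<dots> = pochhammer (real n + \<alpha> + \<beta> + 1) n / (2 ^ n * pochhammer (\<alpha> + 1) n)"
  proof -
    \<comment> \<open>\<open>pochhammer (- real n) n\<close> equals
      \<open>(-1) ^ n * fact n\<close>; its sign cancels the one in the leading coefficient of
      \<open>((1 - t) / 2) ^ n\<close>.\<close>
    have "(-1) ^ n * (- (1/2)) ^ n = (1/2::real) ^ n" by (simp flip: power_mult_distrib)
    then have "(-1) ^ n * X * (- (1/2)) ^ n = X / 2 ^ n" for X :: real
      by (simp add: power_divide mult.assoc mult.left_commute[of _ X])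
    then show ?thesis using l by (simp add: pochhammer_same)
  qed
  finally show ?thesis .
qed

text \<open>With \<open>\<alpha> + \<beta> + 1 > 0\<close> every factor of
  \<open>pochhammer (real n + \<alpha> + \<beta> + 1) n\<close> is positive, hence so is the
  coefficient of \<open>t ^ n\<close>. This covers the Gegenbauer weights with
  \<open>lam > 0\<close> and the Jacobi parameters \<open>(\<mu> - 1/2, j)\<close> with
  \<open>\<mu> \<ge> 0\<close>.\<close>

lemma jacobi_F_deg:
  assumes "\<alpha> > -1" "\<alpha> + \<beta> + 1 > 0"
  shows "degree (jacobi_F \<alpha> \<beta> n) = n" "lead_coeff (jacobi_F \<alpha> \<beta> n) > 0" "jacobi_F \<alpha> \<beta> n \<noteq> 0"
proof -
  have p: "coeff (jacobi_F \<alpha> \<beta> n) n > 0"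
    using assms by (auto simp: coeff_jacobi_F intro!: divide_pos_pos mult_pos_pos pochhammer_pos)
  have "degree (jacobi_F \<alpha> \<beta> n) \<le> n" unfolding jacobi_F_def
    by (intro degree_sum_le) (auto intro!: order_trans[OF degree_smult_le] order_trans[OF degree_power_le])
  then show 1: "degree (jacobi_F \<alpha> \<beta> n) = n" using p by (intro antisym le_degree) auto
  then show "lead_coeff (jacobi_F \<alpha> \<beta> n) > 0" using p by simp
  show "jacobi_F \<alpha> \<beta> n \<noteq> 0" using p by auto
qed

text \<open>The Beta integral of \<open>(1 - t) ^ k * (1 + t) ^ m\<close> contains
  \<open>pochhammer (\<alpha> + 1) k\<close>, which cancels the denominator in
  \<open>jacobi_F\<close>; a terminating hypergeometric series at 1 remains. The factor
  \<open>pochhammer (real m + 1 - real n) n\<close> vanishes exactly for \<open>m < n\<close> and is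
  \<open>fact n\<close> for \<open>m = n\<close>, so orthogonality and norm come from the same
  formula.\<close>

lemma wint_jacobi_F_moment:
  assumes a: "\<alpha> > -1" and b: "\<beta> > -1" and ab: "\<alpha> + \<beta> + 1 > 0"
  shows "wint \<alpha> \<beta> (\<lambda>t. poly (jacobi_F \<alpha> \<beta> n) t * (1 + t) ^ m) =
    2 powr (\<alpha> + \<beta> + real m + 1) * Gamma (\<beta> + real m + 1) * Gamma (\<alpha> + 1) / Gamma (\<alpha> + \<beta> + real m + 2) *
    (pochhammer (real m + 1 - real n) n / pochhammer (\<alpha> + \<beta> + real m + 2) n)"
proof -
  define c where "c k = pochhammer (- real n) k * pochhammer (real n + \<alpha> + \<beta> + 1) k /
      (pochhammer (\<alpha> + 1) k * fact k)" for k
  let ?C = "2 powr (\<alpha> + \<beta> + real m + 1) * Gamma (\<beta> + real m + 1) * Gamma (\<alpha> + 1) / Gamma (\<alpha> + \<beta> + real m + 2)"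
  have nz: "\<alpha> + 1 \<notin> \<int>\<^sub>\<le>\<^sub>0" "\<alpha> + \<beta> + real m + 2 \<notin> \<int>\<^sub>\<le>\<^sub>0"
    using a b ab by (auto elim!: nonpos_Ints_cases)
  have "wint \<alpha> \<beta> (\<lambda>t. poly (jacobi_F \<alpha> \<beta> n) t * (1 + t) ^ m) =
        wint \<alpha> \<beta> (\<lambda>t. \<Sum>k\<le>n. (c k / 2 ^ k) * ((1 - t) ^ k * (1 + t) ^ m * 1))"
    by (rule wint_cong) (simp add: poly_jacobi_F c_def sum_distrib_right sum_distrib_left power_divide mult_ac)
  also have "\<dots> = (\<Sum>k\<le>n. c k / 2 ^ k * wint \<alpha> \<beta> (\<lambda>t. (1 - t) ^ k * (1 + t) ^ m * 1))"
    unfolding wint_cmult[symmetric] by (rule wint_sum) (use a b in \<open>auto intro!: continuous_intros\<close>)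
  also have "\<dots> = (\<Sum>k\<le>n. ?C * (pochhammer (real n + \<alpha> + \<beta> + 1) k * pochhammer (- real n) k /
        (fact k * pochhammer (\<alpha> + \<beta> + real m + 2) k)))"
  proof (rule sum.cong[OF refl])
    fix k
    have g1: "Gamma (\<alpha> + real k + 1) = pochhammer (\<alpha> + 1) k * Gamma (\<alpha> + 1)"
      using pochhammer_Gamma[OF nz(1), of k] Gamma_eq_zero_iff[of "\<alpha> + 1"] nz(1)
      by (simp add: field_simps add_ac)
    have g2: "Gamma (\<alpha> + \<beta> + real m + 2 + real k) =
        pochhammer (\<alpha> + \<beta> + real m + 2) k * Gamma (\<alpha> + \<beta> + real m + 2)"
      using pochhammer_Gamma[OF nz(2), of k] Gamma_eq_zero_iff[of "\<alpha> + \<beta> + real m + 2"] nz(2)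
      by (simp add: field_simps add_ac)
    have p1: "pochhammer (\<alpha> + 1) k \<noteq> 0" using a by (intro less_imp_neq[symmetric] pochhammer_pos) auto
    have p2: "pochhammer (\<alpha> + \<beta> + real m + 2) k \<noteq> 0" using a b
      by (intro less_imp_neq[symmetric] pochhammer_pos) auto
    have g3: "Gamma (\<alpha> + \<beta> + real m + 2) \<noteq> 0" using nz by (simp add: Gamma_eq_zero_iff)
    have "c k / 2 ^ k * wint \<alpha> \<beta> (\<lambda>t. (1 - t) ^ k * (1 + t) ^ m * 1) =
      c k / 2 ^ k * (2 powr (\<alpha> + real k + (\<beta> + real m) + 1) * Beta (\<alpha> + real k + 1) (\<beta> + real m + 1))"
      using a b by (simp only: wint_shift) (simp add: wint_one)
    also have "2 powr (\<alpha> + real k + (\<beta> + real m) + 1) = 2 powr (\<alpha> + \<beta> + real m + 1) * 2 ^ k"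
      by (simp add: powr_realpow powr_add[symmetric] add_ac flip: powr_realpow)
    also have "Beta (\<alpha> + real k + 1) (\<beta> + real m + 1) =
       pochhammer (\<alpha> + 1) k * Gamma (\<alpha> + 1) * Gamma (\<beta> + real m + 1) /
        (pochhammer (\<alpha> + \<beta> + real m + 2) k * Gamma (\<alpha> + \<beta> + real m + 2))"
      unfolding Beta_def g1[symmetric] g2[symmetric] by (simp add: add_ac)
    finally show "c k / 2 ^ k * wint \<alpha> \<beta> (\<lambda>t. (1 - t) ^ k * (1 + t) ^ m * 1) =
      ?C * (pochhammer (real n + \<alpha> + \<beta> + 1) k * pochhammer (- real n) k /
        (fact k * pochhammer (\<alpha> + \<beta> + real m + 2) k))"
      using p1 p2 g3 by (simp add: c_def field_simps)
  qed
  also have "\<dots> = ?C * (\<Sum>k=0..n. (pochhammer (real n + \<alpha> + \<beta> + 1) k * pochhammer (- real n) k /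
        (fact k * pochhammer (\<alpha> + \<beta> + real m + 2) k)))"
    by (simp add: sum_distrib_left atMost_atLeast0)
  also have "(\<Sum>k=0..n. (pochhammer (real n + \<alpha> + \<beta> + 1) k * pochhammer (- real n) k /
        (fact k * pochhammer (\<alpha> + \<beta> + real m + 2) k))) =
        pochhammer (\<alpha> + \<beta> + real m + 2 - (real n + \<alpha> + \<beta> + 1)) n / pochhammer (\<alpha> + \<beta> + real m + 2) n"
    using Vandermonde_pochhammer[of n "\<alpha> + \<beta> + real m + 2" "real n + \<alpha> + \<beta> + 1"] a b by force
  also have "\<alpha> + \<beta> + real m + 2 - (real n + \<alpha> + \<beta> + 1) = real m + 1 - real n" by simp
  finally show ?thesis .
qed

lemma jacobi_F_orth:
  assumes a: "\<alpha> > -1" and b: "\<beta> > -1" and ab: "\<alpha> + \<beta> + 1 > 0" and q: "q = 0 \<or> degree q < n"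
  shows "wpoly \<alpha> \<beta> (jacobi_F \<alpha> \<beta> n * q) = 0"
  using q
proof (induction q rule: degree_lt_induct[where Q = "\<lambda>k. [:1, 1:] ^ k"])
  case (sub p q)
  then show ?case by (simp only: distrib_left wpoly_add a b)
next
  case (scale c p)
  then show ?case by simp
next
  case (family k)
  then have "pochhammer (real k + 1 - real n) n = 0"
    unfolding pochhammer_eq_0_iff by (intro exI[of _ "n - 1 - k"]) (auto simp: of_nat_diff)
  then show ?case using wint_jacobi_F_moment[OF a b ab, of n k]
    by (simp add: degree_power_eq poly_power poly_mult[abs_def] add.commute)
qed auto

text \<open>Orthogonality leaves only the term of degree \<open>n\<close> in \<open>q\<close>, and
  \<open>[:1,1:] ^ n\<close> is a monic representative whose moment is known.\<close>

lemma wpoly_jacobi_F_lead: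
  assumes a: "\<alpha> > -1" and b: "\<beta> > -1" and ab: "\<alpha> + \<beta> + 1 > 0" and q: "degree q \<le> n"
  shows "wpoly \<alpha> \<beta> (jacobi_F \<alpha> \<beta> n * q) = coeff q n * wpoly \<alpha> \<beta> (jacobi_F \<alpha> \<beta> n * [:1,1:] ^ n)"
proof -
  define r where "r = q - smult (coeff q n) ([:1,1:] ^ n)"
  have l: "coeff ([:1,1::real:] ^ n) n = 1"
    using lead_coeff_power[of "[:1, 1::real:]" n] by (simp add: degree_power_eq)
  have "degree r \<le> n" unfolding r_def
    by (rule order_trans[OF degree_diff_le_max]) (use q in \<open>auto simp: degree_power_eq\<close>)
  moreover have "coeff r n = 0" by (simp add: r_def l)
  ultimately have "r = 0 \<or> degree r < n"
    by (metis leading_coeff_0_iff le_neq_implies_less)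
  then have "wpoly \<alpha> \<beta> (jacobi_F \<alpha> \<beta> n * r) = 0" by (intro jacobi_F_orth assms)
  moreover have "jacobi_F \<alpha> \<beta> n * q = jacobi_F \<alpha> \<beta> n * r + smult (coeff q n) (jacobi_F \<alpha> \<beta> n * [:1,1:] ^ n)"
    by (simp add: r_def algebra_simps)
  ultimately show ?thesis using a b by (simp only: wpoly_add wpoly_smult)
qed

lemma jacobi_F_norm:
  assumes a: "\<alpha> > -1" and b: "\<beta> > -1" and ab: "\<alpha> + \<beta> + 1 > 0"
  shows "wpoly \<alpha> \<beta> (jacobi_F \<alpha> \<beta> n * jacobi_F \<alpha> \<beta> n) =
    fact n * pochhammer (\<beta> + 1) n * (\<alpha> + \<beta> + 1 + real n) /
      (pochhammer (\<alpha> + 1) n * pochhammer (\<alpha> + \<beta> + 2) n * (\<alpha> + \<beta> + 1 + 2 * real n)) * wint \<alpha> \<beta> (\<lambda>_. 1)"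
proof -
  have nz: "\<beta> + 1 \<notin> \<int>\<^sub>\<le>\<^sub>0" "\<alpha> + \<beta> + 2 \<notin> \<int>\<^sub>\<le>\<^sub>0"
    using a b ab by (auto elim!: nonpos_Ints_cases)
  have g1: "Gamma (\<beta> + real n + 1) = pochhammer (\<beta> + 1) n * Gamma (\<beta> + 1)"
    using pochhammer_Gamma[OF nz(1), of n] Gamma_eq_zero_iff[of "\<beta> + 1"] nz(1)
    by (simp add: field_simps add_ac)
  have g2: "Gamma (\<alpha> + \<beta> + real n + 2) = pochhammer (\<alpha> + \<beta> + 2) n * Gamma (\<alpha> + \<beta> + 2)"
    using pochhammer_Gamma[OF nz(2), of n] Gamma_eq_zero_iff[of "\<alpha> + \<beta> + 2"] nz(2)
    by (simp add: field_simps add_ac)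
  have p1: "pochhammer (\<alpha> + 1) n \<noteq> 0" using a by (intro less_imp_neq[symmetric] pochhammer_pos) auto
  have p2: "pochhammer (\<alpha> + \<beta> + 2) n \<noteq> 0" using a b
    by (intro less_imp_neq[symmetric] pochhammer_pos) auto
  have p3: "pochhammer (\<alpha> + \<beta> + real n + 2) n \<noteq> 0" using a b
    by (intro less_imp_neq[symmetric] pochhammer_pos) auto
  have g3: "Gamma (\<alpha> + \<beta> + 2) \<noteq> 0" using nz by (simp add: Gamma_eq_zero_iff)
  \<comment> \<open>Both sides are \<open>pochhammer a (Suc n)\<close> for
    \<open>a = real n + \<alpha> + \<beta> + 1\<close>, with the last or the first factor split
    off.\<close>
  have q: "(\<alpha> + \<beta> + 1 + 2 * real n) * pochhammer (real n + \<alpha> + \<beta> + 1) n =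
      (\<alpha> + \<beta> + 1 + real n) * pochhammer (\<alpha> + \<beta> + real n + 2) n"
    using pochhammer_rec[of "real n + \<alpha> + \<beta> + 1" n] pochhammer_rec'[of "real n + \<alpha> + \<beta> + 1" n]
    by (simp add: algebra_simps)
  have q': "pochhammer (real n + \<alpha> + \<beta> + 1) n =
      (\<alpha> + \<beta> + 1 + real n) * pochhammer (\<alpha> + \<beta> + real n + 2) n / (\<alpha> + \<beta> + 1 + 2 * real n)"
    using ab by (subst q[symmetric]) (simp add: add_pos_nonneg less_imp_neq[symmetric])
  have "wpoly \<alpha> \<beta> (jacobi_F \<alpha> \<beta> n * [:1,1:] ^ n) = wint \<alpha> \<beta> (\<lambda>t. poly (jacobi_F \<alpha> \<beta> n) t * (1 + t) ^ n)"
    by (simp add: poly_power poly_mult[abs_def] add.commute)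
  also note wint_jacobi_F_moment[OF assms, of n n]
  also have "pochhammer (real n + 1 - real n) n = fact n"
    by (simp add: pochhammer_fact)
  finally have 1: "wpoly \<alpha> \<beta> (jacobi_F \<alpha> \<beta> n * [:1,1:] ^ n) =
     2 powr (\<alpha> + \<beta> + real n + 1) * Gamma (\<beta> + real n + 1) * Gamma (\<alpha> + 1) / Gamma (\<alpha> + \<beta> + real n + 2) *
    (fact n / pochhammer (\<alpha> + \<beta> + real n + 2) n)" .
  have 2: "wint \<alpha> \<beta> (\<lambda>_. 1) = 2 powr (\<alpha> + \<beta> + 1) * (Gamma (\<alpha> + 1) * Gamma (\<beta> + 1) / Gamma (\<alpha> + \<beta> + 2))"
    using a b by (simp add: wint_one Beta_def add_ac)
  have 3: "2 powr (\<alpha> + \<beta> + real n + 1) = 2 powr (\<alpha> + \<beta> + 1) * 2 ^ n"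
    by (simp add: powr_add[symmetric] add_ac flip: powr_realpow)
  have D: "\<alpha> + \<beta> + 1 + 2 * real n \<noteq> 0" using ab by simp
  have alg: "(N * P3 / D) / (t * P1) * (pw * t * (B * GB) * GA / (P2 * G3) * (F / P3)) =
      F * B * N / (P1 * P2 * D) * (pw * (GA * GB / G3))"
    if "P3 \<noteq> 0" "D \<noteq> 0" "t \<noteq> 0" for N P3 D t P1 pw B GB GA P2 G3 F :: real
    using that by (simp add: field_simps)
  show ?thesis
    unfolding wpoly_jacobi_F_lead[OF assms order.refl[THEN ord_eq_le_trans[OF jacobi_F_deg(1)[OF a ab]]]]
      1 2 3 coeff_jacobi_F q' g1 g2
    by (rule alg) (use p3 D in auto)
qed

lemma wpoly_sq_eq_0: "\<alpha> > -1 \<Longrightarrow> \<beta> > -1 \<Longrightarrow> wpoly \<alpha> \<beta> (p * p) = 0 \<Longrightarrow> p = 0"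
  using wint_eq_0_imp[of \<alpha> \<beta> p] by (simp add: poly_ops power2_eq_square)

section \<open>Uniqueness of orthogonal families\<close>

lemma orth_lower_degree:
  assumes ab: "\<alpha> > -1" "\<beta> > -1"
    and deg: "\<And>k. degree (Q k) = k" and nz: "\<And>k. Q k \<noteq> 0"
    and orth: "\<And>k m. k \<noteq> m \<Longrightarrow> wpoly \<alpha> \<beta> (Q k * Q m) = 0"
    and q: "q = 0 \<or> degree q < n"
  shows "wpoly \<alpha> \<beta> (Q n * q) = 0"
  using q
proof (induction q rule: degree_lt_induct[where Q = Q])
  case (sub p q)
  then show ?case by (simp only: distrib_left wpoly_add ab)
next
  case (family k)
  then have "wpoly \<alpha> \<beta> (Q n * Q k) = 0" by (intro orth) simp
  then show ?case using deg nz by blast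
qed (auto simp: poly_ops)

text \<open>The cross-multiplied difference loses its leading term, is therefore orthogonal to both
  \<open>P\<close> and \<open>R\<close>, and hence to itself. This settles the uniqueness clauses of
  both families and the parity of the Gegenbauer polynomials.\<close>

lemma orth_unique_scaling:
  assumes ab: "\<alpha> > -1" "\<beta> > -1"
    and d: "degree P = n" "degree R = n" and nz: "P \<noteq> 0" "R \<noteq> 0"
    and P: "\<And>q. q = 0 \<or> degree q < n \<Longrightarrow> wpoly \<alpha> \<beta> (P * q) = 0"
    and R: "\<And>q. q = 0 \<or> degree q < n \<Longrightarrow> wpoly \<alpha> \<beta> (R * q) = 0"
  shows "smult (lead_coeff P) R = smult (lead_coeff R) P"
proof -
  define r where "r = smult (lead_coeff P) R - smult (lead_coeff R) P"
  have "degree r \<le> n" unfolding r_def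
    by (rule order_trans[OF degree_diff_le_max]) (use d in auto)
  moreover have "coeff r n = 0" using d by (simp add: r_def)
  ultimately have r: "r = 0 \<or> degree r < n"
    by (metis leading_coeff_0_iff le_neq_implies_less)
  have "r * r = smult (lead_coeff P) (R * r) - smult (lead_coeff R) (P * r)"
    by (subst (1) r_def) (simp add: algebra_simps)
  then have "wpoly \<alpha> \<beta> (r * r) = 0"
    using P[OF r] R[OF r] ab by (simp only: wpoly_diff wpoly_smult)
  then have "r = 0" using wpoly_sq_eq_0[OF ab] by blast
  then show ?thesis by (simp add: r_def)
qed

lemma jacobi_inner_wpoly: "jacobi_inner \<alpha> \<beta> p q = wpoly \<alpha> \<beta> (p * q) / wint \<alpha> \<beta> (\<lambda>_. 1)"
  by (simp add: jacobi_inner_def wint_def)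

lemma wint_one_pos:
  assumes "\<alpha> > -1" "\<beta> > -1"
  shows "wint \<alpha> \<beta> (\<lambda>_. 1) > 0"
  using assms by (simp add: wint_one Beta_def Gamma_real_pos)

text \<open>The squared norm of \<open>jacobi_F\<close> for the weight normalized to total mass \<open>1\<close>.\<close>

definition jacobi_nu :: "real \<Rightarrow> real \<Rightarrow> nat \<Rightarrow> real" where
  "jacobi_nu \<alpha> \<beta> n = fact n * pochhammer (\<beta> + 1) n * (\<alpha> + \<beta> + 1 + real n) /
      (pochhammer (\<alpha> + 1) n * pochhammer (\<alpha> + \<beta> + 2) n * (\<alpha> + \<beta> + 1 + 2 * real n))"

lemma jacobi_nu_pos:
  assumes "\<alpha> > -1" "\<beta> > -1" "\<alpha> + \<beta> + 1 > 0"
  shows "jacobi_nu \<alpha> \<beta> n > 0"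
  unfolding jacobi_nu_def using assms
  by (intro divide_pos_pos mult_pos_pos pochhammer_pos) auto

text \<open>Evaluates the definite description. In each degree a competitor is a multiple of the
  normalized \<open>jacobi_F\<close>; equal norms force \<open>c\<^sup>2 = 1\<close>, and positive
  leading coefficients select \<open>c = 1\<close>.\<close>

lemma jacobi_poly_eq:
  assumes a: "\<alpha> > -1" and b: "\<beta> > -1" and ab: "\<alpha> + \<beta> + 1 > 0"
  shows "jacobi_poly \<alpha> \<beta> = (\<lambda>n. smult (1 / sqrt (jacobi_nu \<alpha> \<beta> n)) (jacobi_F \<alpha> \<beta> n))"
    (is "_ = ?p")
  unfolding jacobi_poly_def
proof (rule the_equality)
  note F = jacobi_F_deg[OF a ab]
  have nu: "jacobi_nu \<alpha> \<beta> n > 0" for n by (rule jacobi_nu_pos[OF assms])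
  have orth: "wpoly \<alpha> \<beta> (jacobi_F \<alpha> \<beta> l * jacobi_F \<alpha> \<beta> m) = 0" if "l \<noteq> m" for l m
  proof (cases "m < l")
    case True
    then show ?thesis using jacobi_F_orth[OF assms, of "jacobi_F \<alpha> \<beta> m" l] F by auto
  next
    case False
    then show ?thesis using jacobi_F_orth[OF assms, of "jacobi_F \<alpha> \<beta> l" m] F that
      by (auto simp: mult.commute)
  qed
  have norm: "wpoly \<alpha> \<beta> (jacobi_F \<alpha> \<beta> l * jacobi_F \<alpha> \<beta> l) = jacobi_nu \<alpha> \<beta> l * wint \<alpha> \<beta> (\<lambda>_. 1)" for l
    unfolding jacobi_F_norm[OF assms] jacobi_nu_def ..
  have w1: "wint \<alpha> \<beta> (\<lambda>_. 1) > 0" by (rule wint_one_pos[OF a b])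
  have p: "degree (?p l) = l" "lead_coeff (?p l) > 0" "?p l \<noteq> 0" for l
    using F nu[of l] by (auto simp: less_le)
  have on: "jacobi_inner \<alpha> \<beta> (?p l) (?p m) = (if l = m then 1 else 0)" for l m
  proof (cases "l = m")
    case True
    have "wpoly \<alpha> \<beta> (?p l * ?p l) = (1 / sqrt (jacobi_nu \<alpha> \<beta> l))\<^sup>2 * wpoly \<alpha> \<beta> (jacobi_F \<alpha> \<beta> l * jacobi_F \<alpha> \<beta> l)"
      by (simp only: mult_smult_left mult_smult_right wpoly_smult) (simp add: power2_eq_square)
    also have "\<dots> = wint \<alpha> \<beta> (\<lambda>_. 1)"
      using nu[of l] by (simp add: norm power_divide)
    finally show ?thesis using True w1 by (simp add: jacobi_inner_wpoly)
  next
    case False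
    then show ?thesis
      by (simp only: jacobi_inner_wpoly mult_smult_left mult_smult_right wpoly_smult orth[OF False]) simp
  qed
  show "(\<forall>l. degree (?p l) = l \<and> 0 < lead_coeff (?p l)) \<and>
    (\<forall>l m. jacobi_inner \<alpha> \<beta> (?p l) (?p m) = (if l = m then 1 else 0))"
    using p on by blast
  fix q :: "nat \<Rightarrow> real poly"
  assume q: "(\<forall>l. degree (q l) = l \<and> 0 < lead_coeff (q l)) \<and>
    (\<forall>l m. jacobi_inner \<alpha> \<beta> (q l) (q m) = (if l = m then 1 else 0))"
  then have q1: "degree (q l) = l" "0 < lead_coeff (q l)" "q l \<noteq> 0" for l
    by (auto dest: spec[of _ l])
  have wq: "wpoly \<alpha> \<beta> (q l * q m) = (if l = m then wint \<alpha> \<beta> (\<lambda>_. 1) else 0)" for l m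
    using q w1 by (auto simp: jacobi_inner_wpoly split: if_splits)
  show "q = ?p"
  proof
    fix n
    have e: "smult (lead_coeff (?p n)) (q n) = smult (lead_coeff (q n)) (?p n)"
    proof (rule orth_unique_scaling[OF a b, of _ n])
      fix r :: "real poly" assume r: "r = 0 \<or> degree r < n"
      show "wpoly \<alpha> \<beta> (?p n * r) = 0"
        using jacobi_F_orth[OF assms r] by (simp only: mult_smult_left wpoly_smult mult_zero_right)
      show "wpoly \<alpha> \<beta> (q n * r) = 0"
        by (rule orth_lower_degree[OF a b]) (use q1 wq r in auto)
    qed (use q1 p in auto)
    define c where "c = lead_coeff (q n) / lead_coeff (?p n)"
    have c: "c > 0" unfolding c_def using q1(2)[of n] p(2)[of n] by (rule divide_pos_pos)
    have qc: "q n = smult c (?p n)"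
    proof -
      have "L > 0 \<Longrightarrow> q n = smult (1 / L) (smult L (q n))" for L
        by simp
      from this[OF p(2)[of n]] have "q n = smult (1 / lead_coeff (?p n)) (smult (lead_coeff (q n)) (?p n))"
        unfolding e .
      then show ?thesis unfolding c_def smult_smult by (simp only: times_divide_eq_left mult_1_left)
    qed
    have "wint \<alpha> \<beta> (\<lambda>_. 1) = c\<^sup>2 * wpoly \<alpha> \<beta> (?p n * ?p n)"
      using wq[of n n] unfolding qc
      by (simp only: mult_smult_left mult_smult_right wpoly_smult if_True simp_thms) (simp add: power2_eq_square)
    also have "wpoly \<alpha> \<beta> (?p n * ?p n) = wint \<alpha> \<beta> (\<lambda>_. 1)"
      using on[of n n] w1 by (simp add: jacobi_inner_wpoly)
    finally have "c\<^sup>2 = 1" using w1 by simp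
    then have "c = 1" using c by (simp add: power2_eq_1_iff)
    then show "q n = ?p n" using qc by simp
  qed
qed

lemma jacobi_poly_facts:
  assumes a: "\<alpha> > -1" and b: "\<beta> > -1" and ab: "\<alpha> + \<beta> + 1 > 0"
  shows "degree (jacobi_poly \<alpha> \<beta> n) = n" "jacobi_poly \<alpha> \<beta> n \<noteq> 0"
    and "q = 0 \<or> degree q < n \<Longrightarrow> wpoly \<alpha> \<beta> (jacobi_poly \<alpha> \<beta> n * q) = 0"
    and "(poly (jacobi_poly \<alpha> \<beta> n) 1)\<^sup>2 = 1 / jacobi_nu \<alpha> \<beta> n"
proof -
  have nu: "jacobi_nu \<alpha> \<beta> n > 0" by (rule jacobi_nu_pos[OF assms])
  show "degree (jacobi_poly \<alpha> \<beta> n) = n" "jacobi_poly \<alpha> \<beta> n \<noteq> 0"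
    using jacobi_F_deg[OF a ab, of n] nu by (auto simp: jacobi_poly_eq[OF assms])
  show "wpoly \<alpha> \<beta> (jacobi_poly \<alpha> \<beta> n * q) = 0" if "q = 0 \<or> degree q < n"
    using jacobi_F_orth[OF assms that] by (simp only: jacobi_poly_eq[OF assms] mult_smult_left wpoly_smult mult_zero_right)
  show "(poly (jacobi_poly \<alpha> \<beta> n) 1)\<^sup>2 = 1 / jacobi_nu \<alpha> \<beta> n"
    using nu by (simp add: jacobi_poly_eq[OF assms] poly_jacobi_F_1 power_divide)
qed

section \<open>Gegenbauer polynomials: closed form, norm and parity\<close>

lemma gegenbauer_weight:
  "(LINT s:{-1..1}|lborel. poly p s * poly q s * (1 - s\<^sup>2) powr a) = wpoly a a (p * q)"
  unfolding wint_def
proof (intro set_lebesgue_integral_cong)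
  show "\<forall>s. s \<in> {-1..1} \<longrightarrow> poly p s * poly q s * (1 - s\<^sup>2) powr a = poly (p * q) s * jacobi_weight a a s"
  proof (intro allI impI)
    fix s :: real assume "s \<in> {-1..1}"
    moreover have "1 - s\<^sup>2 = (1 - s) * (1 + s)" by (simp add: power2_eq_square algebra_simps)
    ultimately show "poly p s * poly q s * (1 - s\<^sup>2) powr a = poly (p * q) s * jacobi_weight a a s"
      by (simp add: jacobi_weight_def powr_mult)
  qed
qed auto

text \<open>Since \<open>jacobi_F\<close> has the value 1 at 1, the prescribed value is the scaling
  factor. It is positive for \<open>lam > 0\<close> and therefore fixes the scalar that
  orthogonality leaves open.\<close>

lemma gegenbauer_poly_eq:
  assumes l: "lam > 0"
  shows "gegenbauer_poly lam =
    (\<lambda>n. smult (pochhammer (2 * lam) n / fact n) (jacobi_F (lam - 1/2) (lam - 1/2) n))" (is "_ = ?p")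
  unfolding gegenbauer_poly_def gegenbauer_weight
proof (rule the_equality)
  let ?a = "lam - 1/2"
  have a: "?a > -1" "?a + ?a + 1 > 0" using l by auto
  note F = jacobi_F_deg[OF a]
  have nu: "pochhammer (2 * lam) n / fact n > 0" for n
    using l by (intro divide_pos_pos pochhammer_pos) auto
  have orth: "wpoly ?a ?a (jacobi_F ?a ?a l * jacobi_F ?a ?a m) = 0" if "l \<noteq> m" for l m
  proof (cases "m < l")
    case True
    then show ?thesis using jacobi_F_orth[OF a(1) a, of "jacobi_F ?a ?a m" l] F by auto
  next
    case False
    then show ?thesis using jacobi_F_orth[OF a(1) a, of "jacobi_F ?a ?a l" m] F that
      by (auto simp: mult.commute)
  qed
  have p: "degree (?p l) = l" "poly (?p l) 1 = pochhammer (2 * lam) l / fact l" "?p l \<noteq> 0" for l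
    using F nu[of l] by (auto simp: poly_jacobi_F_1)
  have on: "wpoly ?a ?a (?p l * ?p m) = 0" if "l \<noteq> m" for l m
    by (simp only: mult_smult_left mult_smult_right wpoly_smult orth[OF that] mult_zero_right)
  show "(\<forall>k. degree (?p k) = k \<and> poly (?p k) 1 = pochhammer (2 * lam) k / fact k) \<and>
    (\<forall>k m. k \<noteq> m \<longrightarrow> wpoly ?a ?a (?p k * ?p m) = 0)"
    using p on by blast
  fix q :: "nat \<Rightarrow> real poly"
  assume q: "(\<forall>k. degree (q k) = k \<and> poly (q k) 1 = pochhammer (2 * lam) k / fact k) \<and>
    (\<forall>k m. k \<noteq> m \<longrightarrow> wpoly ?a ?a (q k * q m) = 0)"
  then have q1: "degree (q l) = l" "poly (q l) 1 = pochhammer (2 * lam) l / fact l" for l by auto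
  have q2: "q l \<noteq> 0" for l using q1(2)[of l] nu[of l] by auto
  show "q = ?p"
  proof
    fix n
    have e: "smult (lead_coeff (?p n)) (q n) = smult (lead_coeff (q n)) (?p n)"
    proof (rule orth_unique_scaling[OF a(1) a(1), of _ n])
      fix r :: "real poly" assume r: "r = 0 \<or> degree r < n"
      show "wpoly ?a ?a (?p n * r) = 0"
        using jacobi_F_orth[OF a(1) a r] by (simp only: mult_smult_left wpoly_smult mult_zero_right)
      show "wpoly ?a ?a (q n * r) = 0"
        by (rule orth_lower_degree[OF a(1) a(1)]) (use q1 q2 q r in auto)
    qed (use q1 q2 p in auto)
    have "lead_coeff (?p n) * poly (q n) 1 = lead_coeff (q n) * poly (?p n) 1"
      using e by (metis poly_smult)
    then have "lead_coeff (?p n) * (pochhammer (2 * lam) n / fact n) =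
        lead_coeff (q n) * (pochhammer (2 * lam) n / fact n)"
      unfolding q1(2) p(2) .
    then have "lead_coeff (?p n) = lead_coeff (q n)"
      using nu[of n] by (metis less_irrefl mult_right_cancel)
    moreover have "lead_coeff (q n) \<noteq> 0" using q2 by simp
    ultimately show "q n = ?p n" using e by (metis smult_left_inj)
  qed
qed

lemma gegenbauer_poly_facts:
  assumes l: "lam > 0"
  shows "degree (gegenbauer_poly lam n) = n" "gegenbauer_poly lam n \<noteq> 0"
    and "q = 0 \<or> degree q < n \<Longrightarrow> wpoly (lam - 1/2) (lam - 1/2) (gegenbauer_poly lam n * q) = 0"
    and "poly (gegenbauer_poly lam n) 1 = pochhammer (2 * lam) n / fact n"
    and "wpoly (lam - 1/2) (lam - 1/2) (gegenbauer_poly lam n * gegenbauer_poly lam n) =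
      lam * pochhammer (2 * lam) n / ((real n + lam) * fact n) * wint (lam - 1/2) (lam - 1/2) (\<lambda>_. 1)"
proof -
  let ?a = "lam - 1/2"
  have a: "?a > -1" "?a + ?a + 1 > 0" using l by auto
  have p: "pochhammer (2 * lam) n > 0" using l by (intro pochhammer_pos) auto
  have p': "pochhammer (lam + 1/2) n > 0" "pochhammer (2 * lam + 1) n > 0"
    using l by (auto intro!: pochhammer_pos)
  show "degree (gegenbauer_poly lam n) = n" "gegenbauer_poly lam n \<noteq> 0"
    using jacobi_F_deg[OF a, of n] p by (auto simp: gegenbauer_poly_eq[OF l])
  show "wpoly ?a ?a (gegenbauer_poly lam n * q) = 0" if "q = 0 \<or> degree q < n"
    using jacobi_F_orth[OF a(1) a that] by (simp only: gegenbauer_poly_eq[OF l] mult_smult_left wpoly_smult mult_zero_right)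
  show "poly (gegenbauer_poly lam n) 1 = pochhammer (2 * lam) n / fact n"
    by (simp add: gegenbauer_poly_eq[OF l] poly_jacobi_F_1)
  \<comment> \<open>Again two ways of splitting a factor off
    \<open>pochhammer (2 * lam) (Suc n)\<close>.\<close>
  have r: "2 * lam * pochhammer (2 * lam + 1) n = pochhammer (2 * lam) n * (2 * lam + real n)"
    using pochhammer_rec[of "2 * lam" n] pochhammer_rec'[of "2 * lam" n] by (simp add: mult.commute)
  have "wpoly ?a ?a (gegenbauer_poly lam n * gegenbauer_poly lam n) =
      (pochhammer (2 * lam) n / fact n)\<^sup>2 * (jacobi_nu ?a ?a n * wint ?a ?a (\<lambda>_. 1))"
    unfolding gegenbauer_poly_eq[OF l] mult_smult_left mult_smult_right wpoly_smult
      jacobi_F_norm[OF a(1) a, folded jacobi_nu_def] by (simp add: power2_eq_square mult_ac)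
  also have "jacobi_nu ?a ?a n = fact n * (2 * lam + real n) / (pochhammer (2 * lam + 1) n * (2 * (lam + real n)))"
    using p' by (simp add: jacobi_nu_def add_ac)
  also have "\<dots> = fact n * lam / (pochhammer (2 * lam) n * (lam + real n))"
  proof -
    have "(2 * lam + real n) / pochhammer (2 * lam + 1) n = 2 * lam / pochhammer (2 * lam) n"
      using r p p' by (simp add: field_simps)
    then have "fact n * ((2 * lam + real n) / pochhammer (2 * lam + 1) n) / (2 * (lam + real n)) =
      fact n * (2 * lam / pochhammer (2 * lam) n) / (2 * (lam + real n))" by (simp only:)
    moreover have "F * (A / B) / (2 * C) = F * A / (B * (2 * C))" "F * (2 * lam / B) / (2 * C) = F * lam / (B * C)"
      for F A B C :: real by simp_all
    ultimately show ?thesis by (simp only:)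
  qed
  also have "(pochhammer (2 * lam) n / fact n)\<^sup>2 * (fact n * lam / (pochhammer (2 * lam) n * (lam + real n)) * w) =
      lam * pochhammer (2 * lam) n / ((real n + lam) * fact n) * w" for w
  proof -
    have "(P / F)\<^sup>2 * (F * lam / (P * D) * w) = lam * P / (D * F) * w" if "P \<noteq> 0" "F \<noteq> 0" for P F D :: real
      using that by (simp add: power2_eq_square mult_ac)
    from this[of "pochhammer (2 * lam) n" "fact n" "lam + real n"] p show ?thesis
      by (simp add: add.commute)
  qed
  finally show "wpoly ?a ?a (gegenbauer_poly lam n * gegenbauer_poly lam n) =
      lam * pochhammer (2 * lam) n / ((real n + lam) * fact n) * wint ?a ?a (\<lambda>_. 1)" .
qed

lemma wint_reflect: "wint a a (\<lambda>t. g (- t)) = wint a a g"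
proof -
  let ?f = "\<lambda>t. indicator {-1..1} t * (g t * jacobi_weight a a t)"
  have "wint a a g = (LINT t|lborel. ?f t)"
    by (simp add: wint_def set_lebesgue_integral_def)
  also have "\<dots> = (LINT t|lborel. ?f (0 + (-1) * t))"
    by (subst lborel_integral_real_affine[of "-1" _ 0]) auto
  also have "\<dots> = wint a a (\<lambda>t. g (- t))"
    unfolding wint_def set_lebesgue_integral_def
    by (intro Bochner_Integration.integral_cong) (auto simp: jacobi_weight_def indicator_def)
  finally show ?thesis by simp
qed

lemma wpoly_reflect: "wpoly a a (pcompose p [:0, -1:]) = wpoly a a p"
proof -
  have "poly (pcompose p [:0, -1:]) = (\<lambda>t. poly p (- t))" by (auto simp: poly_pcompose)
  then show ?thesis by (simp only: wint_reflect)
qed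

text \<open>The weight is even, so the reflected polynomial is orthogonal to lower degrees as well
  and thus a multiple of the original; comparing leading coefficients gives
  \<open>(-1) ^ n\<close>.\<close>

lemma gegenbauer_parity:
  assumes l: "lam > 0"
  shows "poly (gegenbauer_poly lam n) (- t) = (-1) ^ n * poly (gegenbauer_poly lam n) t"
proof -
  let ?a = "lam - 1/2" and ?C = "gegenbauer_poly lam n"
  have a: "?a > -1" using l by auto
  let ?R = "pcompose ?C [:0, -1:]"
  note C = gegenbauer_poly_facts[OF l, where n = n]
  have d: "degree ?R = n" by (simp add: degree_pcompose C(1))
  have lR: "lead_coeff ?R = lead_coeff ?C * (-1) ^ n"
    by (subst lead_coeff_comp) (auto simp: C(1))
  have "smult (lead_coeff ?C) ?R = smult (lead_coeff ?R) ?C"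
  proof (rule orth_unique_scaling[OF a a, of _ n])
    fix q :: "real poly" assume q: "q = 0 \<or> degree q < n"
    show "wpoly ?a ?a (?C * q) = 0" by (rule C(3)[OF q])
    have "wpoly ?a ?a (?R * q) = wpoly ?a ?a (pcompose (?R * q) [:0, -1:])" by (rule wpoly_reflect[symmetric])
    also have "pcompose (?R * q) [:0, -1:] = ?C * pcompose q [:0, -1:]"
      by (simp add: pcompose_mult pcompose_assoc[symmetric] pcompose_pCons pcompose_idR)
    also have "wpoly ?a ?a \<dots> = 0" by (rule C(3)) (use q in \<open>auto simp: degree_pcompose\<close>)
    finally show "wpoly ?a ?a (?R * q) = 0" .
  qed (use C d lR in \<open>auto simp: pcompose_eq_0_iff\<close>)
  then have "smult (lead_coeff ?C) ?R = smult (lead_coeff ?C) (smult ((-1) ^ n) ?C)"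
    unfolding lR by simp
  then have "?R = smult ((-1) ^ n) ?C"
    using C(2) by (metis leading_coeff_0_iff smult_left_inj)
  then have "poly ?R t = poly (smult ((-1) ^ n) ?C) t" by simp
  then show ?thesis by (simp add: poly_pcompose)
qed

section \<open>Chord coordinates on the ball\<close>

lemma vec3_axis: "(vector [a, b, c] :: real^3) = a *\<^sub>R axis 1 1 + b *\<^sub>R axis 2 1 + c *\<^sub>R axis 3 1"
  by (simp add: vec_eq_iff forall_3 axis_def)

lemma measurable_vec3 [measurable]:
  assumes [measurable]: "f \<in> borel_measurable M" "g \<in> borel_measurable M" "h \<in> borel_measurable M"
  shows "(\<lambda>x. vector [f x, g x, h x] :: real^3) \<in> borel_measurable M"
  unfolding vec3_axis by measurable

lemma measurable_fst_borel [measurable]: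
  fixes f :: "'a \<Rightarrow> 'b::topological_space \<times> 'c::topological_space"
  assumes [measurable]: "f \<in> M \<rightarrow>\<^sub>M borel"
  shows "(\<lambda>x. fst (f x)) \<in> M \<rightarrow>\<^sub>M borel" "(\<lambda>x. snd (f x)) \<in> M \<rightarrow>\<^sub>M borel"
  by (rule measurable_compose[OF assms];
      intro borel_measurable_continuous_onI continuous_intros)+

text \<open>Compared on boxes, where both measures are products of side lengths. The height
  \<open>w\<close> comes first so that iterated integration has the order of the theorem: height,
  signed distance, arc length.\<close>

lemma lborel_vec3: "distr lborel borel (\<lambda>(w, t, s). vector [t, s, w] :: real^3) = lborel"
proof (rule lborel_eqI[symmetric])
  fix l u :: "real^3" assume lu: "\<And>b. b \<in> Basis \<Longrightarrow> l \<bullet> b \<le> u \<bullet> b"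
  have le: "l $ i \<le> u $ i" for i
    using lu[of "axis i 1"] by (simp add: inner_axis)
  have m: "(\<lambda>(w, t, s). vector [t, s, w] :: real^3) \<in> borel_measurable lborel"
    unfolding case_prod_beta by measurable
  have pre: "(\<lambda>(w, t, s). vector [t, s, w] :: real^3) -` box l u \<inter> space lborel
     = {l$3<..<u$3} \<times> ({l$1<..<u$1} \<times> {l$2<..<u$2})"
    by (auto simp: mem_box_cart forall_3)
  have "emeasure (distr lborel borel (\<lambda>(w, t, s). vector [t, s, w] :: real^3)) (box l u) =
     emeasure (lborel \<Otimes>\<^sub>M (lborel \<Otimes>\<^sub>M lborel)) ({l$3<..<u$3} \<times> ({l$1<..<u$1} \<times> {l$2<..<u$2}))"
    by (subst emeasure_distr[OF m]) (simp, simp only: pre lborel_prod)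
  also have "\<dots> = emeasure lborel {l$3<..<u$3} * (emeasure lborel {l$1<..<u$1} * emeasure lborel {l$2<..<u$2})"
  proof -
    have "emeasure (lborel \<Otimes>\<^sub>M lborel) ({l$3<..<u$3} \<times> ({l$1<..<u$1} \<times> {l$2<..<u$2})) =
        emeasure lborel {l$3<..<u$3} * emeasure lborel ({l$1<..<u$1} \<times> {l$2<..<u$2})"
      by (rule lborel.emeasure_pair_measure_Times) (auto intro!: borel_open open_Times)
    also have "emeasure lborel ({l$1<..<u$1} \<times> {l$2<..<u$2}) =
        emeasure lborel {l$1<..<u$1} * emeasure lborel {l$2<..<u$2}"
      unfolding lborel_prod[symmetric] by (rule lborel.emeasure_pair_measure_Times) auto
    finally show ?thesis by (simp add: lborel_prod)
  qed
  also have "\<dots> = ennreal ((u$3 - l$3) * ((u$1 - l$1) * (u$2 - l$2)))"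
    using le by (simp add: ennreal_mult)
  also have "(u$3 - l$3) * ((u$1 - l$1) * (u$2 - l$2)) = (\<Prod>i\<in>UNIV. (u - l) $ i)"
    unfolding UNIV_3 by simp
  also have "\<dots> = (\<Prod>b\<in>Basis. (u - l) \<bullet> b)"
  proof -
    have "(\<Prod>b\<in>Basis. (u - l) \<bullet> b) = (\<Prod>i\<in>(UNIV :: 3 set). (u - l) \<bullet> axis i 1)"
      by (rule prod.reindex_cong[of "\<lambda>i. axis i 1"])
         (auto simp: Basis_vec_def inj_on_def axis_eq_axis)
    then show ?thesis by (simp add: inner_axis)
  qed
  finally show "emeasure (distr lborel borel (\<lambda>(w, t, s). vector [t, s, w] :: real^3)) (box l u) =
    ennreal (\<Prod>b\<in>Basis. (u - l) \<bullet> b)" .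
qed simp

text \<open>The preimage of a box is its image under the inverse map, which is again orthogonal, so
  the invariance of Lebesgue measure for images applies.\<close>

lemma lborel_orthogonal:
  fixes f :: "real^'n::{finite,wellorder} \<Rightarrow> real^'n::_"
  assumes f: "orthogonal_transformation f"
  shows "distr lborel borel f = lborel"
proof (rule lborel_eqI[symmetric])
  fix l u :: "real^'n::{finite,wellorder}" assume lu: "\<And>b. b \<in> Basis \<Longrightarrow> l \<bullet> b \<le> u \<bullet> b"
  have lin: "linear f" using f by (rule orthogonal_transformation_linear)
  then have m: "f \<in> borel_measurable borel"
    by (intro borel_measurable_continuous_onI linear_continuous_on) (simp add: linear_conv_bounded_linear)
  have if': "orthogonal_transformation (inv f)" by (rule orthogonal_transformation_inv[OF f])
  have bij: "bij f" by (rule orthogonal_transformation_bij[OF f])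
  have pre: "f -` box l u = inv f ` box l u" using bij by (simp add: bij_vimage_eq_inv_image)
  have sets: "f -` box l u \<in> sets borel" using measurable_sets[OF m, of "box l u"] by simp
  have lm: "inv f ` box l u \<in> lmeasurable" by (rule measurable_orthogonal_image[OF if']) simp
  have "emeasure (distr lborel borel f) (box l u) = emeasure lborel (f -` box l u)"
    using m by (subst emeasure_distr) auto
  also have "\<dots> = emeasure lebesgue (f -` box l u)"
    using sets by simp
  also have "\<dots> = ennreal (measure lebesgue (inv f ` box l u))"
    unfolding pre by (rule emeasure_eq_measure2[OF lm])
  also have "\<dots> = ennreal (measure lebesgue (box l u))"
    by (subst measure_orthogonal_image[OF if']) auto
  also have "\<dots> = ennreal (\<Prod>b\<in>Basis. (u - l) \<bullet> b)"
    using lu by (simp add: measure_lborel_box_eq)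
  finally show "emeasure (distr lborel borel f) (box l u) = ennreal (\<Prod>b\<in>Basis. (u - l) \<bullet> b)" .
qed simp

text \<open>Unlike in \<open>chord_pt\<close>, the parameter \<open>t\<close> is not rescaled, so \<open>(w, t, s)\<close> are isometric coordinates.\<close>

definition chord :: "real \<Rightarrow> real \<Rightarrow> real \<Rightarrow> real \<Rightarrow> real^3" where
  "chord \<theta> w t s = vector [t * cos \<theta> - s * sin \<theta>, t * sin \<theta> + s * cos \<theta>, w]"

lemma chord_pt_chord: "chord_pt \<theta> t w s = chord \<theta> w (sqrt (1 - w\<^sup>2) * t) s"
  by (simp add: chord_pt_def chord_def mult.commute)

lemma measurable_chord [measurable]:
  assumes [measurable]: "f \<in> borel_measurable M" "g \<in> borel_measurable M" "h \<in> borel_measurable M"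
  shows "(\<lambda>x. chord \<theta> (f x) (g x) (h x)) \<in> borel_measurable M"
  unfolding chord_def by measurable

lemma measurable_chord_prod [measurable]:
  "(\<lambda>(w, t, s). chord \<theta> w t s) \<in> borel_measurable borel"
proof -
  have "(\<lambda>(w, t, s). chord \<theta> w t s) \<in> borel_measurable lborel"
    unfolding case_prod_beta by measurable
  then show ?thesis by simp
qed

lemma norm_chord: "(norm (chord \<theta> w t s))\<^sup>2 = w\<^sup>2 + t\<^sup>2 + s\<^sup>2"
proof -
  have "(norm (chord \<theta> w t s))\<^sup>2 = (t * cos \<theta> - s * sin \<theta>)\<^sup>2 + (t * sin \<theta> + s * cos \<theta>)\<^sup>2 + w\<^sup>2"
    by (simp add: norm_vec_def L2_set_def sum_3 chord_def)
  also have "\<dots> = w\<^sup>2 + (t\<^sup>2 + s\<^sup>2) * ((sin \<theta>)\<^sup>2 + (cos \<theta>)\<^sup>2)"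
    by (simp only: power2_eq_square) algebra
  finally show ?thesis by simp
qed

text \<open>The map is a permutation of coordinates followed by a rotation about the third
  axis.\<close>

lemma lborel_chord: "distr lborel borel (\<lambda>(w, t, s). chord \<theta> w t s) = lborel"
proof -
  define R :: "real^3 \<Rightarrow> real^3" where
    "R x = vector [x$1 * cos \<theta> - x$2 * sin \<theta>, x$1 * sin \<theta> + x$2 * cos \<theta>, x$3]" for x
  have "linear R"
    by (rule linearI) (simp_all add: R_def vec_eq_iff forall_3 algebra_simps)
  moreover have "norm (R x) = norm x" for x
  proof -
    have "(norm (R x))\<^sup>2 = (norm (chord \<theta> (x$3) (x$1) (x$2)))\<^sup>2" by (simp add: R_def chord_def)
    also have "\<dots> = (norm x)\<^sup>2" unfolding norm_chord by (simp add: norm_vec_def L2_set_def sum_3)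
    finally show ?thesis by simp
  qed
  ultimately have o: "orthogonal_transformation R" by (simp add: orthogonal_transformation)
  have m: "R \<in> borel_measurable borel"
    by (intro borel_measurable_continuous_onI linear_continuous_on)
       (simp add: \<open>linear R\<close> linear_conv_bounded_linear[symmetric])
  have m1: "(\<lambda>(w, t, s). vector [t, s, w] :: real^3) \<in> lborel \<rightarrow>\<^sub>M borel"
    unfolding case_prod_beta by measurable
  have "lborel = distr (distr lborel borel (\<lambda>(w, t, s). vector [t, s, w])) borel R"
    by (simp add: lborel_vec3 lborel_orthogonal[OF o])
  also have "\<dots> = distr lborel borel (R \<circ> (\<lambda>(w, t, s). vector [t, s, w]))"
    using m m1 by (subst distr_distr) auto
  also have "R \<circ> (\<lambda>(w, t, s). vector [t, s, w]) = (\<lambda>(w, t, s). chord \<theta> w t s)"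
    by (auto simp: fun_eq_iff R_def chord_def)
  finally show ?thesis by simp
qed

lemma nn_integral_chord:
  assumes [measurable]: "h \<in> borel_measurable borel"
  shows "(\<integral>\<^sup>+x. h x \<partial>lborel) = (\<integral>\<^sup>+w. \<integral>\<^sup>+t. \<integral>\<^sup>+s. h (chord \<theta> w t s) \<partial>lborel \<partial>lborel \<partial>lborel)"
proof -
  have "(\<integral>\<^sup>+x. h x \<partial>lborel) = (\<integral>\<^sup>+p. h ((\<lambda>(w, t, s). chord \<theta> w t s) p) \<partial>lborel)"
    by (subst lborel_chord[of \<theta>, symmetric], subst nn_integral_distr)
       simp_all
  also have "\<dots> = (\<integral>\<^sup>+p. h ((\<lambda>(w, t, s). chord \<theta> w t s) p) \<partial>(lborel \<Otimes>\<^sub>M lborel))"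
    by (simp add: lborel_prod)
  also have "\<dots> = (\<integral>\<^sup>+w. \<integral>\<^sup>+q. h ((\<lambda>(w, t, s). chord \<theta> w t s) (w, q)) \<partial>lborel \<partial>lborel)"
    by (rule lborel.nn_integral_fst[symmetric]) (simp add: case_prod_beta)
  also have "\<dots> = (\<integral>\<^sup>+w. \<integral>\<^sup>+t. \<integral>\<^sup>+s. h (chord \<theta> w t s) \<partial>lborel \<partial>lborel \<partial>lborel)"
  proof (intro nn_integral_cong)
    fix w :: real
    have "(\<integral>\<^sup>+q. h ((\<lambda>(w, t, s). chord \<theta> w t s) (w, q)) \<partial>lborel) =
        (\<integral>\<^sup>+q. h (chord \<theta> w (fst q) (snd q)) \<partial>(lborel \<Otimes>\<^sub>M lborel))"
      by (simp add: lborel_prod case_prod_beta)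
    also have "\<dots> = (\<integral>\<^sup>+t. \<integral>\<^sup>+s. h (chord \<theta> w (fst (t, s)) (snd (t, s))) \<partial>lborel \<partial>lborel)"
      by (rule lborel.nn_integral_fst[symmetric]) simp
    finally show "(\<integral>\<^sup>+q. h ((\<lambda>(w, t, s). chord \<theta> w t s) (w, q)) \<partial>lborel) =
       (\<integral>\<^sup>+t. \<integral>\<^sup>+s. h (chord \<theta> w t s) \<partial>lborel \<partial>lborel)" by simp
  qed
  finally show ?thesis .
qed

lemma integral_chord:
  fixes h :: "real^3 \<Rightarrow> real"
  assumes h: "integrable lborel h"
  shows "(LINT x|lborel. h x) = (LINT w|lborel. LINT t|lborel. LINT s|lborel. h (chord \<theta> w t s))"
proof -
  have [measurable]: "h \<in> borel_measurable borel" using h by auto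
  let ?H = "\<lambda>p. h ((\<lambda>(w, t, s). chord \<theta> w t s) p)"
  have i: "integrable (lborel \<Otimes>\<^sub>M lborel) ?H"
    unfolding lborel_prod
    by (subst integrable_distr_eq[symmetric, where g = "\<lambda>(w, t, s). chord \<theta> w t s" and f = h and N = borel])
       (simp_all add: lborel_chord h)
  have "(LINT x|lborel. h x) = (LINT p|lborel. ?H p)"
    by (subst lborel_chord[of \<theta>, symmetric], subst integral_distr) simp_all
  also have "\<dots> = (LINT p|(lborel \<Otimes>\<^sub>M lborel). ?H p)"
    by (simp add: lborel_prod)
  also have "\<dots> = (LINT w|lborel. LINT q|lborel. ?H (w, q))"
    by (rule lborel_pair.integral_fst'[symmetric, OF i])
  also have "\<dots> = (LINT w|lborel. LINT t|lborel. LINT s|lborel. h (chord \<theta> w t s))"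
  proof (intro integral_cong_AE)
    \<comment> \<open>Fubini is used twice; the inner application requires an integrable slice,
      which is available for almost every \<open>w\<close>.\<close>
    have "AE w in lborel. integrable lborel (\<lambda>q. ?H (w, q))"
      by (rule lborel_pair.AE_integrable_fst'[OF i])
    then show "AE w in lborel. (LINT q|lborel. ?H (w, q)) = (LINT t|lborel. LINT s|lborel. h (chord \<theta> w t s))"
    proof eventually_elim
      case (elim w)
      then have "integrable (lborel \<Otimes>\<^sub>M lborel) (\<lambda>q. ?H (w, q))" by (simp add: lborel_prod)
      from lborel_pair.integral_fst'[OF this] show ?case by (simp add: lborel_prod)
    qed
  qed (simp_all add: case_prod_beta)
  finally show ?thesis .
qed

section \<open>Chords rescaled to the unit interval\<close>

lemma measurable_chord_pt [measurable]:
  assumes [measurable]: "f \<in> borel_measurable M" "g \<in> borel_measurable M" "h \<in> borel_measurable M"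
  shows "(\<lambda>x. chord_pt \<theta> (f x) (g x) (h x)) \<in> borel_measurable M"
  unfolding chord_pt_chord by measurable

lemma measurable_ball_weight [measurable]: "ball_weight \<mu> \<in> borel_measurable borel"
  unfolding ball_weight_def by measurable

lemma one_minus_sq_pos: "\<bar>w\<bar> < 1 \<Longrightarrow> 1 - w\<^sup>2 > 0" for w :: real
  by (simp add: abs_square_less_1)

lemma norm_chord_pt:
  assumes "\<bar>w\<bar> \<le> 1"
  shows "(norm (chord_pt \<theta> t w s))\<^sup>2 = w\<^sup>2 + (1 - w\<^sup>2) * t\<^sup>2 + s\<^sup>2"
  using assms by (simp add: chord_pt_chord norm_chord power_mult_distrib abs_square_le_1)

text \<open>Since \<open>1 - w\<^sup>2 - (1 - w\<^sup>2) * t\<^sup>2\<close> is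
  \<open>(1 - w\<^sup>2) * (1 - t\<^sup>2)\<close>, the half-length of the chord is the square root
  of this product, and measuring \<open>s\<close> in that unit separates the three
  variables.\<close>

lemma chord_pt_scaled:
  assumes "\<bar>w\<bar> < 1" "\<bar>t\<bar> < 1"
  shows "1 - (norm (chord_pt \<theta> t w (sqrt ((1 - w\<^sup>2) * (1 - t\<^sup>2)) * \<sigma>)))\<^sup>2 =
    ((1 - w\<^sup>2) * (1 - t\<^sup>2)) * (1 - \<sigma>\<^sup>2)"
  using one_minus_sq_pos[OF assms(1)] one_minus_sq_pos[OF assms(2)] assms
  by (simp add: norm_chord_pt power_mult_distrib) (simp add: algebra_simps)

lemma mem_cball_chord_pt_scaled:
  assumes "\<bar>w\<bar> < 1" "\<bar>t\<bar> < 1"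
  shows "chord_pt \<theta> t w (sqrt ((1 - w\<^sup>2) * (1 - t\<^sup>2)) * \<sigma>) \<in> cball 0 1 \<longleftrightarrow> \<sigma> \<in> {-1..1}"
proof -
  have p: "(1 - w\<^sup>2) * (1 - t\<^sup>2) > 0" using assms by (intro mult_pos_pos one_minus_sq_pos)
  let ?n = "norm (chord_pt \<theta> t w (sqrt ((1 - w\<^sup>2) * (1 - t\<^sup>2)) * \<sigma>))"
  have "?n \<le> 1 \<longleftrightarrow> 0 \<le> 1 - ?n\<^sup>2"
    by (simp add: power_le_one_iff abs_square_le_1)
  also have "\<dots> \<longleftrightarrow> 0 \<le> 1 - \<sigma>\<^sup>2"
  proof -
    have "0 < P \<Longrightarrow> 0 \<le> P * x \<longleftrightarrow> 0 \<le> x" for P x :: real by (auto simp: zero_le_mult_iff)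
    from this[OF p] show ?thesis unfolding chord_pt_scaled[OF assms] .
  qed
  also have "\<dots> \<longleftrightarrow> \<sigma> \<in> {-1..1}" by (simp add: abs_square_le_1 abs_le_iff) linarith
  finally show ?thesis by simp
qed

lemma norm_chord_ge: "\<bar>w\<bar> \<ge> 1 \<Longrightarrow> norm (chord \<theta> w t s) \<ge> 1"
proof -
  assume "\<bar>w\<bar> \<ge> 1"
  then have "1 \<le> w\<^sup>2" by (simp add: abs_le_square_iff[of 1, simplified])
  then have "1 \<le> (norm (chord \<theta> w t s))\<^sup>2" unfolding norm_chord
    using zero_le_power2[of t] zero_le_power2[of s] by linarith
  then show ?thesis using power2_le_imp_le[of 1 "norm (chord \<theta> w t s)"] by simp
qed

lemma norm_chord_pt_ge: "\<bar>w\<bar> < 1 \<Longrightarrow> \<bar>t\<bar> \<ge> 1 \<Longrightarrow> norm (chord_pt \<theta> t w s) \<ge> 1"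
proof -
  assume w: "\<bar>w\<bar> < 1" and "\<bar>t\<bar> \<ge> 1"
  then have "1 \<le> t\<^sup>2" by (simp add: abs_le_square_iff[of 1, simplified])
  then have le: "(1 - w\<^sup>2) * 1 \<le> (1 - w\<^sup>2) * t\<^sup>2" using one_minus_sq_pos[OF w]
    by (intro mult_left_mono) auto
  have "1 \<le> (norm (chord_pt \<theta> t w s))\<^sup>2"
  proof -
    have "(norm (chord_pt \<theta> t w s))\<^sup>2 = w\<^sup>2 + (1 - w\<^sup>2) * t\<^sup>2 + s\<^sup>2"
      using w by (simp add: norm_chord_pt)
    moreover have "w\<^sup>2 + (1 - w\<^sup>2) * 1 + 0 \<le> w\<^sup>2 + (1 - w\<^sup>2) * t\<^sup>2 + s\<^sup>2"
      by (intro add_mono le) auto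
    ultimately show ?thesis by simp
  qed
  then show ?thesis using power2_le_imp_le[of 1 "norm (chord_pt \<theta> t w s)"] by simp
qed

text \<open>Rescaling the signed distance by \<open>sqrt (1 - w\<^sup>2)\<close> produces the
  Jacobian factor of the theorem. Vanishing of \<open>H\<close> on the sphere lets the open
  intervals suffice; the ball weight satisfies it through \<open>0 powr a = 0\<close>, also for
  negative exponents.\<close>

lemma integral_chord_pt:
  fixes H :: "real^3 \<Rightarrow> real"
  assumes H: "integrable lborel H" and 0: "\<And>x. norm x \<ge> 1 \<Longrightarrow> H x = 0"
  shows "(LINT x|lborel. H x) = (LINT w:{-1<..<1}|lborel. (LINT t:{-1<..<1}|lborel.
           LINT s|lborel. H (chord_pt \<theta> t w s)) * sqrt (1 - w\<^sup>2))"
  unfolding integral_chord[OF H, of \<theta>] set_lebesgue_integral_def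
proof (intro Bochner_Integration.integral_cong refl)
  fix w :: real
  show "(LINT t|lborel. LINT s|lborel. H (chord \<theta> w t s)) =
    indicat_real {-1<..<1} w *\<^sub>R ((LINT t|lborel. indicat_real {-1<..<1} t *\<^sub>R
      (LINT s|lborel. H (chord_pt \<theta> t w s))) * sqrt (1 - w\<^sup>2))"
  proof (cases "\<bar>w\<bar> < 1")
    case True
    let ?c = "sqrt (1 - w\<^sup>2)"
    have c: "?c > 0" using one_minus_sq_pos[OF True] by simp
    have "(LINT t|lborel. LINT s|lborel. H (chord \<theta> w t s)) =
        \<bar>?c\<bar> *\<^sub>R (LINT t|lborel. LINT s|lborel. H (chord \<theta> w (0 + ?c * t) s))"
      by (rule lborel_integral_real_affine) (use c in auto)
    also have "(LINT t|lborel. LINT s|lborel. H (chord \<theta> w (0 + ?c * t) s)) =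
        (LINT t|lborel. indicat_real {-1<..<1} t *\<^sub>R (LINT s|lborel. H (chord_pt \<theta> t w s)))"
    proof (intro Bochner_Integration.integral_cong refl)
      fix t :: real
      show "(LINT s|lborel. H (chord \<theta> w (0 + ?c * t) s)) =
        indicat_real {-1<..<1} t *\<^sub>R (LINT s|lborel. H (chord_pt \<theta> t w s))"
        using norm_chord_pt_ge[OF True, of t \<theta>] 0
        by (cases "\<bar>t\<bar> < 1") (auto simp: chord_pt_chord indicator_def abs_less_iff)
    qed
    finally show ?thesis using c True by (auto simp: mult.commute indicator_def abs_less_iff)
  next
    case False
    then have "H (chord \<theta> w t s) = 0" for t s using norm_chord_ge[of w \<theta> t s] 0 by auto
    then show ?thesis using False by (auto simp: indicator_def)
  qed
qed

lemma nn_integral_chord_pt: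
  fixes h :: "real^3 \<Rightarrow> ennreal"
  assumes [measurable]: "h \<in> borel_measurable borel" and w: "\<bar>w\<bar> < 1"
  shows "(\<integral>\<^sup>+t. \<integral>\<^sup>+s. h (chord \<theta> w t s) \<partial>lborel \<partial>lborel) =
     ennreal (sqrt (1 - w\<^sup>2)) * (\<integral>\<^sup>+t. \<integral>\<^sup>+s. h (chord_pt \<theta> t w s) \<partial>lborel \<partial>lborel)"
proof -
  have c: "sqrt (1 - w\<^sup>2) > 0" using one_minus_sq_pos[OF w] by simp
  have "(\<integral>\<^sup>+t. \<integral>\<^sup>+s. h (chord \<theta> w t s) \<partial>lborel \<partial>lborel) =
     \<bar>sqrt (1 - w\<^sup>2)\<bar> * (\<integral>\<^sup>+t. \<integral>\<^sup>+s. h (chord \<theta> w (0 + sqrt (1 - w\<^sup>2) * t) s) \<partial>lborel \<partial>lborel)"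
    by (rule nn_integral_real_affine) (use c in auto)
  then show ?thesis using c by (simp add: chord_pt_chord)
qed

text \<open>Tonelli for the indicator of \<open>N\<close>. As \<open>radon\<close> evaluates its
  argument on single lines, a change of \<open>f\<close> on a null set is harmless only for almost
  every chord.\<close>

lemma AE_chord_pt:
  assumes N: "N \<in> null_sets lborel"
  shows "AE w in lborel. \<bar>w\<bar> < 1 \<longrightarrow> (AE t in lborel. AE s in lborel. chord_pt \<theta> t w s \<notin> N)"
proof -
  have [measurable]: "N \<in> sets borel" using N by auto
  have "(\<integral>\<^sup>+w. \<integral>\<^sup>+t. \<integral>\<^sup>+s. indicator N (chord \<theta> w t s) \<partial>lborel \<partial>lborel \<partial>lborel) = (\<integral>\<^sup>+x. indicator N x \<partial>lborel)"
    by (rule nn_integral_chord[symmetric]) measurable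
  also have "\<dots> = 0" using N by (simp add: null_sets_def)
  finally have "AE w in lborel. (\<integral>\<^sup>+t. \<integral>\<^sup>+s. indicator N (chord \<theta> w t s) \<partial>lborel \<partial>lborel) = 0"
    by (subst (asm) nn_integral_0_iff_AE) auto
  then show ?thesis
  proof eventually_elim
    case (elim w)
    show ?case
    proof
      assume w: "\<bar>w\<bar> < 1"
      have "(\<integral>\<^sup>+t. \<integral>\<^sup>+s. indicator N (chord_pt \<theta> t w s) \<partial>lborel \<partial>lborel) = 0"
        using elim nn_integral_chord_pt[of "indicator N" w \<theta>] w one_minus_sq_pos[OF w]
        by (simp add: ennreal_eq_0_iff not_le)
      then have "AE t in lborel. (\<integral>\<^sup>+s. indicator N (chord_pt \<theta> t w s) \<partial>lborel) = 0"
        by (subst (asm) nn_integral_0_iff_AE) auto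
      then show "AE t in lborel. AE s in lborel. chord_pt \<theta> t w s \<notin> N"
      proof eventually_elim
        case (elim t)
        then have "AE s in lborel. indicator N (chord_pt \<theta> t w s) = (0::ennreal)"
          by (subst (asm) nn_integral_0_iff_AE) auto
        then show ?case by eventually_elim (auto simp: indicator_def split: if_splits)
      qed
    qed
  qed
qed

section \<open>Integrals against the ball weight\<close>

lemma jacobi_weight_same: "t \<in> {-1..1} \<Longrightarrow> jacobi_weight a a t = (1 - t\<^sup>2) powr a"
proof -
  assume "t \<in> {-1..1}"
  moreover have "1 - t\<^sup>2 = (1 - t) * (1 + t)" by (simp add: power2_eq_square algebra_simps)
  ultimately show ?thesis by (simp add: jacobi_weight_def powr_mult)
qed

lemma wint_open: "wint a a g = (LINT t:{-1<..<1}|lborel. g t * (1 - t\<^sup>2) powr a)"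
  unfolding wint_def set_lebesgue_integral_def
  by (intro Bochner_Integration.integral_cong)
     (auto simp: indicator_def jacobi_weight_same power2_eq_square intro!: disjI2)

text \<open>For \<open>\<mu> < 1/2\<close> the weight is unbounded near the sphere. The chord
  scaling contributes \<open>sqrt X\<close>, which turns \<open>X powr (\<mu> - 1/2)\<close> into
  \<open>X powr \<mu>\<close>; this is at most 1 because \<open>\<mu> \<ge> 0\<close>, and what
  remains is a Jacobi weight with exponent above -1.\<close>

lemma ball_weight_integrable:
  assumes mu: "\<mu> \<ge> 0"
  shows "integrable lborel (\<lambda>x. indicator (cball 0 1) x * ball_weight \<mu> x)"
proof (rule integrableI_nonneg)
  let ?K = "\<lambda>x. ennreal (indicator (cball 0 1) x * ball_weight \<mu> x)"
  let ?B = "\<integral>\<^sup>+\<sigma>. ennreal (indicator {-1..1} \<sigma> * jacobi_weight (\<mu> - 1/2) (\<mu> - 1/2) \<sigma>) \<partial>lborel"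
  have B: "?B < \<infinity>"
    using jacobi_weight_Beta[of "\<mu> - 1/2" "\<mu> - 1/2"] mu
    by (subst nn_integral_eq_integral) (auto simp: has_bochner_integral_iff jacobi_weight_def)
  have Km: "?K \<in> borel_measurable borel"
    by (intro measurable_compose[OF _ measurable_ennreal] borel_measurable_times borel_measurable_indicator
        measurable_ball_weight) simp
  have K0: "?K x = 0" if "norm x \<ge> 1" for x
    using that by (cases "norm x = 1") (auto simp: ball_weight_def indicator_def)
  have inner: "(\<integral>\<^sup>+s. ?K (chord_pt 0 t w s) \<partial>lborel) \<le> indicator {-1..1} t * ?B" if w: "\<bar>w\<bar> < 1" for w t
  proof (cases "\<bar>t\<bar> < 1")
    case True
    define X where "X = (1 - w\<^sup>2) * (1 - t\<^sup>2)"
    have X: "X > 0" using one_minus_sq_pos[OF w] one_minus_sq_pos[OF True] by (simp add: X_def)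
    have X1: "X \<le> 1" unfolding X_def using one_minus_sq_pos[OF w] one_minus_sq_pos[OF True]
      by (intro mult_le_one) auto
    have Kc: "(\<lambda>s. ?K (chord_pt 0 t w (g s))) \<in> borel_measurable lborel"
      if [measurable]: "g \<in> borel_measurable borel" for g
      by (rule measurable_compose[OF _ Km]) measurable
    have "(\<integral>\<^sup>+s. ?K (chord_pt 0 t w s) \<partial>lborel) =
        \<bar>sqrt X\<bar> * (\<integral>\<^sup>+\<sigma>. ?K (chord_pt 0 t w (0 + sqrt X * \<sigma>)) \<partial>lborel)"
      by (rule nn_integral_real_affine) (use X Kc[of "\<lambda>s. s"] in simp_all)
    also have "\<dots> = (\<integral>\<^sup>+\<sigma>. \<bar>sqrt X\<bar> * ?K (chord_pt 0 t w (0 + sqrt X * \<sigma>)) \<partial>lborel)"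
      by (rule nn_integral_cmult[symmetric], rule Kc) measurable
    also have "\<dots> \<le> ?B"
    proof (intro nn_integral_mono)
      fix \<sigma> :: real
      show "\<bar>sqrt X\<bar> * ?K (chord_pt 0 t w (0 + sqrt X * \<sigma>)) \<le>
        ennreal (indicator {-1..1} \<sigma> * jacobi_weight (\<mu> - 1/2) (\<mu> - 1/2) \<sigma>)"
      proof (cases "\<sigma> \<in> {-1..1}")
        case s: True
        have "sqrt X * ball_weight \<mu> (chord_pt 0 t w (sqrt X * \<sigma>)) =
            sqrt X * (X powr (\<mu> - 1/2) * (1 - \<sigma>\<^sup>2) powr (\<mu> - 1/2))"
          unfolding ball_weight_def X_def chord_pt_scaled[OF w True]
          using X s unfolding X_def by (subst powr_mult) (auto simp: abs_square_le_1)
        also have "\<dots> = X powr \<mu> * (1 - \<sigma>\<^sup>2) powr (\<mu> - 1/2)"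
          using X by (simp add: powr_half_sqrt[symmetric] powr_add[symmetric])
        also have "\<dots> \<le> 1 * (1 - \<sigma>\<^sup>2) powr (\<mu> - 1/2)"
          using X X1 mu by (intro mult_right_mono powr_le1) auto
        finally show ?thesis
          using s X by (auto simp: jacobi_weight_same ennreal_mult'[symmetric] indicator_def
              intro!: ennreal_leI)
      next
        case False
        then have "chord_pt 0 t w (sqrt X * \<sigma>) \<notin> cball 0 1"
          unfolding X_def mem_cball_chord_pt_scaled[OF w True] .
        then show ?thesis by (simp add: indicator_def)
      qed
    qed
    finally show ?thesis using True by (auto simp: indicator_def)
  next
    case False
    then have "?K (chord_pt 0 t w s) = 0" for s
      using K0 norm_chord_pt_ge[OF w, of t 0 s] by simp
    then show ?thesis by simp
  qed
  have "(\<integral>\<^sup>+x. ?K x \<partial>lborel) = (\<integral>\<^sup>+w. \<integral>\<^sup>+t. \<integral>\<^sup>+s. ?K (chord 0 w t s) \<partial>lborel \<partial>lborel \<partial>lborel)"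
    by (rule nn_integral_chord[OF Km])
  also have "\<dots> \<le> (\<integral>\<^sup>+w. indicator {-1..1::real} w * (2 * ?B) \<partial>lborel)"
  proof (rule nn_integral_mono)
    fix w :: real
    show "(\<integral>\<^sup>+t. \<integral>\<^sup>+s. ?K (chord 0 w t s) \<partial>lborel \<partial>lborel) \<le> indicator {-1..1} w * (2 * ?B)"
    proof (cases "\<bar>w\<bar> < 1")
      case True
      have "(\<integral>\<^sup>+t. \<integral>\<^sup>+s. ?K (chord 0 w t s) \<partial>lborel \<partial>lborel) =
        ennreal (sqrt (1 - w\<^sup>2)) * (\<integral>\<^sup>+t. \<integral>\<^sup>+s. ?K (chord_pt 0 t w s) \<partial>lborel \<partial>lborel)"
        by (rule nn_integral_chord_pt[OF Km True])
      also have "\<dots> \<le> 1 * (\<integral>\<^sup>+t. indicator {-1..1::real} t * ?B \<partial>lborel)"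
        using True by (intro mult_mono nn_integral_mono inner) (auto intro!: ennreal_leI)
      also have "\<dots> = 2 * ?B"
        by (subst nn_integral_multc) auto
      finally show ?thesis using True by (auto simp: indicator_def)
    next
      case False
      then have "?K (chord 0 w t s) = 0" for t s
        using K0 norm_chord_ge[of w 0 t s] by simp
      then show ?thesis by simp
    qed
  qed
  also have "\<dots> = 2 * (2 * ?B)" by (subst nn_integral_multc) auto
  also have "\<dots> < \<infinity>" using B by (simp add: ennreal_mult_less_top)
  finally show "(\<integral>\<^sup>+x. ?K x \<partial>lborel) < \<infinity>" .
  show "(\<lambda>x. indicat_real (cball 0 1) x * ball_weight \<mu> x) \<in> borel_measurable lborel"
    by (intro borel_measurable_times borel_measurable_indicator) auto
qed (auto simp: ball_weight_def)

definition ball_integral :: "real \<Rightarrow> (real^3 \<Rightarrow> real) \<Rightarrow> real" where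
  "ball_integral \<mu> g = (LINT x:cball 0 1|lebesgue. g x * ball_weight \<mu> x)"

lemma ball_integral_lborel:
  assumes [measurable]: "g \<in> borel_measurable borel"
  shows "ball_integral \<mu> g = (LINT x|lborel. indicator (cball 0 1) x * (g x * ball_weight \<mu> x))"
proof -
  have "(\<lambda>x. indicator (cball 0 1) x *\<^sub>R (g x * ball_weight \<mu> x)) \<in> borel_measurable lborel"
    by (intro borel_measurable_scaleR borel_measurable_times borel_measurable_indicator) auto
  then show ?thesis
    unfolding ball_integral_def set_lebesgue_integral_def by (subst integral_completion) auto
qed

text \<open>The rescaling of the chord parameter that gives \<open>1 - |x|\<^sup>2 = (1 - w\<^sup>2) (1 - t\<^sup>2) (1 - \<sigma>\<^sup>2)\<close>.\<close>

definition ball_pt :: "real \<Rightarrow> real \<Rightarrow> real \<Rightarrow> real \<Rightarrow> real^3" where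
  "ball_pt \<theta> w t \<sigma> = chord_pt \<theta> t w (sqrt ((1 - w\<^sup>2) * (1 - t\<^sup>2)) * \<sigma>)"

lemma bounded_times_weight_integrable:
  assumes mu: "\<mu> \<ge> 0" and g: "continuous_on UNIV g"
  shows "integrable lborel (\<lambda>x. indicator (cball 0 1) x * (g x * ball_weight \<mu> x))"
proof -
  have "compact (g ` cball 0 1)"
    by (intro compact_continuous_image continuous_on_subset[OF g]) auto
  then obtain B where B: "\<forall>y\<in>g ` cball 0 1. norm y \<le> B"
    unfolding bounded_iff[symmetric] by (metis compact_imp_bounded bounded_iff)
  have [measurable]: "g \<in> borel_measurable borel" by (rule borel_measurable_continuous_onI[OF g])
  have m: "(\<lambda>x. indicator (cball 0 1) x * (g x * ball_weight \<mu> x)) \<in> borel_measurable lborel"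
    by (intro borel_measurable_times borel_measurable_indicator) auto
  show ?thesis
  proof (rule Bochner_Integration.integrable_bound[OF _ m])
    show "integrable lborel (\<lambda>x. B * (indicator (cball 0 1) x * ball_weight \<mu> x))"
      by (intro integrable_mult_right ball_weight_integrable mu)
    show "AE x in lborel. norm (indicator (cball 0 1) x * (g x * ball_weight \<mu> x)) \<le>
        norm (B * (indicator (cball 0 1) x * ball_weight \<mu> x))"
    proof (intro AE_I2)
      fix x :: "real^3"
      show "norm (indicator (cball 0 1) x * (g x * ball_weight \<mu> x)) \<le>
        norm (B * (indicator (cball 0 1) x * ball_weight \<mu> x))"
        using B by (cases "x \<in> cball 0 1")
          (auto simp: abs_mult ball_weight_def intro!: mult_right_mono order_trans[OF _ abs_ge_self])
    qed
  qed
qed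

text \<open>Scaling \<open>\<sigma>\<close> contributes
  \<open>sqrt ((1 - w\<^sup>2) * (1 - t\<^sup>2))\<close> and scaling \<open>t\<close> a further
  \<open>sqrt (1 - w\<^sup>2)\<close>, so the exponent grows by 1/2 from each variable to the next
  outer one. The exponents \<open>\<mu>\<close> and \<open>\<mu> + 1/2\<close> belong to the
  Gegenbauer parameters \<open>\<mu> + 1/2\<close> and \<open>\<mu> + 1\<close>, the origin of those
  in the kernel.\<close>

lemma ball_integral_iterated:
  assumes mu: "\<mu> \<ge> 0" and g: "continuous_on UNIV g"
  shows "ball_integral \<mu> g = wint (\<mu> + 1/2) (\<mu> + 1/2) (\<lambda>w. wint \<mu> \<mu> (\<lambda>t.
     wint (\<mu> - 1/2) (\<mu> - 1/2) (\<lambda>\<sigma>. g (ball_pt \<theta> w t \<sigma>))))"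
proof -
  let ?H = "\<lambda>x. indicator (cball 0 1) x * (g x * ball_weight \<mu> x)"
  have gm: "g \<in> borel_measurable borel" by (rule borel_measurable_continuous_onI[OF g])
  have H0: "?H x = 0" if "norm x \<ge> 1" for x
    using that by (cases "norm x = 1") (auto simp: ball_weight_def indicator_def)
  have inner: "(LINT s|lborel. ?H (chord_pt \<theta> t w s)) =
      (1 - w\<^sup>2) powr \<mu> * (1 - t\<^sup>2) powr \<mu> * wint (\<mu> - 1/2) (\<mu> - 1/2) (\<lambda>\<sigma>. g (ball_pt \<theta> w t \<sigma>))"
    if w: "\<bar>w\<bar> < 1" and t: "\<bar>t\<bar> < 1" for w t
  proof -
    define X where "X = (1 - w\<^sup>2) * (1 - t\<^sup>2)"
    have p: "1 - w\<^sup>2 > 0" "1 - t\<^sup>2 > 0" using w t by (simp_all only: one_minus_sq_pos)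
    then have X: "X > 0" unfolding X_def by (rule mult_pos_pos)
    have "(LINT s|lborel. ?H (chord_pt \<theta> t w s)) =
        \<bar>sqrt X\<bar> *\<^sub>R (LINT \<sigma>|lborel. ?H (chord_pt \<theta> t w (0 + sqrt X * \<sigma>)))"
      by (rule lborel_integral_real_affine) (use X in auto)
    also have "(LINT \<sigma>|lborel. ?H (chord_pt \<theta> t w (0 + sqrt X * \<sigma>))) =
      (LINT \<sigma>|lborel. X powr (\<mu> - 1/2) * (indicator {-1..1} \<sigma> *
         (g (ball_pt \<theta> w t \<sigma>) * jacobi_weight (\<mu> - 1/2) (\<mu> - 1/2) \<sigma>)))"
    proof (intro Bochner_Integration.integral_cong refl)
      fix \<sigma> :: real
      have mem: "chord_pt \<theta> t w (sqrt X * \<sigma>) \<in> cball 0 1 \<longleftrightarrow> \<sigma> \<in> {-1..1}"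
        unfolding X_def by (rule mem_cball_chord_pt_scaled[OF w t])
      show "?H (chord_pt \<theta> t w (0 + sqrt X * \<sigma>)) = X powr (\<mu> - 1/2) * (indicator {-1..1} \<sigma> *
         (g (ball_pt \<theta> w t \<sigma>) * jacobi_weight (\<mu> - 1/2) (\<mu> - 1/2) \<sigma>))"
      proof (cases "\<sigma> \<in> {-1..1}")
        case s: True
        have "ball_weight \<mu> (chord_pt \<theta> t w (sqrt X * \<sigma>)) = (X * (1 - \<sigma>\<^sup>2)) powr (\<mu> - 1/2)"
          unfolding ball_weight_def X_def chord_pt_scaled[OF w t] ..
        also have "\<dots> = X powr (\<mu> - 1/2) * (1 - \<sigma>\<^sup>2) powr (\<mu> - 1/2)"
          using X s by (subst powr_mult) (auto simp: abs_square_le_1)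
        finally show ?thesis
          using s mem by (simp add: ball_pt_def X_def[symmetric] jacobi_weight_same)
      next
        case False
        then show ?thesis using mem by simp
      qed
    qed
    also have "\<dots> = X powr (\<mu> - 1/2) * wint (\<mu> - 1/2) (\<mu> - 1/2) (\<lambda>\<sigma>. g (ball_pt \<theta> w t \<sigma>))"
      by (simp add: wint_def set_lebesgue_integral_def)
    also have "\<bar>sqrt X\<bar> *\<^sub>R (X powr (\<mu> - 1/2) * W) = (1 - w\<^sup>2) powr \<mu> * (1 - t\<^sup>2) powr \<mu> * W" for W
    proof -
      have "sqrt X * X powr (\<mu> - 1/2) = X powr \<mu>"
        using X by (simp add: powr_half_sqrt[symmetric] powr_add[symmetric])
      also have "\<dots> = (1 - w\<^sup>2) powr \<mu> * (1 - t\<^sup>2) powr \<mu>"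
        unfolding X_def using p by (simp add: powr_mult)
      finally show ?thesis using X by (simp add: mult.assoc[symmetric])
    qed
    finally show ?thesis .
  qed
  have "ball_integral \<mu> g = (LINT x|lborel. ?H x)" by (rule ball_integral_lborel[OF gm])
  also have "\<dots> = (LINT w:{-1<..<1}|lborel. (LINT t:{-1<..<1}|lborel.
           LINT s|lborel. ?H (chord_pt \<theta> t w s)) * sqrt (1 - w\<^sup>2))"
    by (rule integral_chord_pt[OF bounded_times_weight_integrable[OF mu g] H0])
  also have "\<dots> = (LINT w:{-1<..<1}|lborel. wint \<mu> \<mu> (\<lambda>t.
     wint (\<mu> - 1/2) (\<mu> - 1/2) (\<lambda>\<sigma>. g (ball_pt \<theta> w t \<sigma>))) * (1 - w\<^sup>2) powr (\<mu> + 1/2))"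
  proof (intro set_lebesgue_integral_cong allI impI)
    fix w :: real assume w': "w \<in> {-1<..<1}"
    then have w: "\<bar>w\<bar> < 1" by auto
    have p: "1 - w\<^sup>2 > 0" using w by (rule one_minus_sq_pos)
    have "(LINT t:{-1<..<1}|lborel. LINT s|lborel. ?H (chord_pt \<theta> t w s)) =
      (LINT t:{-1<..<1}|lborel. (1 - w\<^sup>2) powr \<mu> * (wint (\<mu> - 1/2) (\<mu> - 1/2) (\<lambda>\<sigma>. g (ball_pt \<theta> w t \<sigma>)) * (1 - t\<^sup>2) powr \<mu>))"
    proof (intro set_lebesgue_integral_cong allI impI)
      fix t :: real assume "t \<in> {-1<..<1}"
      then have t: "\<bar>t\<bar> < 1" by auto
      show "(LINT s|lborel. ?H (chord_pt \<theta> t w s)) = (1 - w\<^sup>2) powr \<mu> *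
          (wint (\<mu> - 1/2) (\<mu> - 1/2) (\<lambda>\<sigma>. g (ball_pt \<theta> w t \<sigma>)) * (1 - t\<^sup>2) powr \<mu>)"
        unfolding inner[OF w t] by (simp only: mult_ac)
    qed auto
    also have "\<dots> = (1 - w\<^sup>2) powr \<mu> * wint \<mu> \<mu> (\<lambda>t. wint (\<mu> - 1/2) (\<mu> - 1/2) (\<lambda>\<sigma>. g (ball_pt \<theta> w t \<sigma>)))"
      by (simp add: wint_open)
    finally show "(LINT t:{-1<..<1}|lborel. LINT s|lborel. ?H (chord_pt \<theta> t w s)) * sqrt (1 - w\<^sup>2) =
        wint \<mu> \<mu> (\<lambda>t. wint (\<mu> - 1/2) (\<mu> - 1/2) (\<lambda>\<sigma>. g (ball_pt \<theta> w t \<sigma>))) * (1 - w\<^sup>2) powr (\<mu> + 1/2)"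
      using p by (simp add: powr_add powr_half_sqrt)
  qed auto
  finally show ?thesis by (simp add: wint_open)
qed

section \<open>Square-integrable functions and their chord integrals\<close>

text \<open>Completeness of \<open>lebesgue\<close> makes \<open>F\<close> measurable as soon as it
  agrees almost everywhere with a Borel function. In this way measurability of integrals of
  \<open>radon\<close> is obtained rather than presupposed.\<close>

lemma integral_lebesgue_AE:
  fixes F F' :: "real \<Rightarrow> real"
  assumes m: "F' \<in> borel_measurable borel" and ae: "AE s in lborel. F s = F' s"
  shows "integral\<^sup>L lebesgue F = integral\<^sup>L lborel F'"
proof -
  have ae': "AE s in lebesgue. F' s = F s"
    by (rule AE_completion) (use ae in eventually_elim, simp)
  have m': "F' \<in> borel_measurable lebesgue" by (rule measurable_completion) (use m in simp)
  have "integral\<^sup>L lebesgue F = integral\<^sup>L lebesgue F'"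
    by (rule integral_cong_AE[OF borel_measurable_AE[OF m' ae'] m']) (use ae' in eventually_elim, auto)
  also have "\<dots> = integral\<^sup>L lborel F'" by (rule integral_completion) (use m in simp)
  finally show ?thesis .
qed

text \<open>Fubini is applied to products of Borel measures, whereas \<open>f\<close> is only
  Lebesgue measurable, hence the representative \<open>f'\<close>. Its product with \<open>g\<close>
  is dominated by \<open>(f' x)\<^sup>2 + (g x)\<^sup>2\<close>, and both squares are integrable
  against the weight.\<close>

lemma ball_L2_borel_version:
  assumes mu: "\<mu> \<ge> 0" and f: "f \<in> ball_L2 \<mu>" and g: "continuous_on UNIV g"
  obtains f' where "f' \<in> borel_measurable borel"
    "AE x in lborel. indicator (cball 0 1) x * f x = f' x"
    "integrable lborel (\<lambda>x. indicator (cball 0 1) x * (f' x * g x * ball_weight \<mu> x))"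
proof -
  let ?I = "indicator (cball 0 1) :: real^3 \<Rightarrow> real"
  have "(\<lambda>x. ?I x * f x) \<in> borel_measurable lebesgue"
    using f by (simp add: ball_L2_def set_borel_measurable_def)
  from completion_ex_borel_measurable_real[OF this] obtain f'
    where f': "f' \<in> borel_measurable borel" and ae: "AE x in lborel. ?I x * f x = f' x" by auto
  have fi: "integrable lebesgue (\<lambda>x. ?I x * ((f x)\<^sup>2 * ball_weight \<mu> x))"
    using f by (simp add: ball_L2_def set_integrable_def)
  have mq: "(\<lambda>x. ?I x * ((f' x)\<^sup>2 * ball_weight \<mu> x)) \<in> borel_measurable lborel"
    using f' by (intro borel_measurable_times borel_measurable_indicator) auto
  have "AE x in lebesgue. ?I x * ((f x)\<^sup>2 * ball_weight \<mu> x) = ?I x * ((f' x)\<^sup>2 * ball_weight \<mu> x)"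
    by (rule AE_completion) (use ae in eventually_elim, auto simp: indicator_def)
  then have "integrable lebesgue (\<lambda>x. ?I x * ((f' x)\<^sup>2 * ball_weight \<mu> x))"
    by (rule integrable_cong_AE_imp[OF fi measurable_completion[OF mq]])
  then have i1: "integrable lborel (\<lambda>x. ?I x * ((f' x)\<^sup>2 * ball_weight \<mu> x))"
    using integrable_completion[OF mq] by simp
  have g2: "continuous_on UNIV (\<lambda>x. (g x)\<^sup>2)" by (intro continuous_intros g)
  have i2: "integrable lborel (\<lambda>x. ?I x * ((g x)\<^sup>2 * ball_weight \<mu> x))"
    by (rule bounded_times_weight_integrable[OF mu g2])
  have gm: "g \<in> borel_measurable borel" by (rule borel_measurable_continuous_onI[OF g])
  have m: "(\<lambda>x. ?I x * (f' x * g x * ball_weight \<mu> x)) \<in> borel_measurable lborel"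
    using f' gm by (intro borel_measurable_times borel_measurable_indicator) auto
  have "integrable lborel (\<lambda>x. ?I x * (f' x * g x * ball_weight \<mu> x))"
  proof (rule Bochner_Integration.integrable_bound[OF Bochner_Integration.integrable_add[OF i1 i2] m], intro AE_I2)
    fix x
    have "\<bar>f' x * g x\<bar> \<le> (f' x)\<^sup>2 + (g x)\<^sup>2"
    proof -
      have "2 * \<bar>f' x\<bar> * \<bar>g x\<bar> \<le> \<bar>f' x\<bar>\<^sup>2 + \<bar>g x\<bar>\<^sup>2" by (rule sum_squares_bound)
      moreover have "0 \<le> \<bar>f' x\<bar> * \<bar>g x\<bar>" by simp
      ultimately show ?thesis unfolding abs_mult power2_abs by linarith
    qed
    then have "\<bar>f' x * g x\<bar> * ball_weight \<mu> x \<le> ((f' x)\<^sup>2 + (g x)\<^sup>2) * ball_weight \<mu> x"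
      by (intro mult_right_mono) (auto simp: ball_weight_def)
    then show "norm (?I x * (f' x * g x * ball_weight \<mu> x)) \<le>
        norm (?I x * ((f' x)\<^sup>2 * ball_weight \<mu> x) + ?I x * ((g x)\<^sup>2 * ball_weight \<mu> x))"
      by (auto simp: indicator_def abs_mult ball_weight_def distrib_right intro: order_trans[OF _ abs_ge_self])
  qed
  with f' ae that show thesis by blast
qed

text \<open>\<open>g\<close> is constant along each chord with value \<open>G t w\<close>, so it can
  be moved under the arc-length integral, and the claim becomes Fubini for \<open>f * g\<close>
  times the ball weight. Only almost every pair \<open>(w, t)\<close> is controlled;
  \<open>integral_lebesgue_AE\<close>, used on both levels, absorbs the exceptions.\<close>

lemma radon_integral:
  assumes mu: "\<mu> \<ge> 0" and f: "f \<in> ball_L2 \<mu>" and g: "continuous_on UNIV g"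
    and G: "\<And>w t s. \<bar>w\<bar> < 1 \<Longrightarrow> \<bar>t\<bar> < 1 \<Longrightarrow> G t w = g (chord_pt \<theta> t w s)"
  shows "(LINT w:{-1<..<1}|lebesgue. (LINT t:{-1<..<1}|lebesgue. radon \<mu> f \<theta> t w * G t w) * sqrt (1 - w\<^sup>2))
     = ball_integral \<mu> (\<lambda>x. f x * g x)"
proof -
  let ?I = "indicator (cball 0 1) :: real^3 \<Rightarrow> real"
  obtain f' where f' [measurable]: "f' \<in> borel_measurable borel"
    and ae: "AE x in lborel. ?I x * f x = f' x"
    and int: "integrable lborel (\<lambda>x. ?I x * (f' x * g x * ball_weight \<mu> x))"
    by (rule ball_L2_borel_version[OF mu f g])
  let ?H = "\<lambda>x. ?I x * (f' x * g x * ball_weight \<mu> x)"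
  have Hm [measurable]: "?H \<in> borel_measurable borel" using int by auto
  have H0: "?H x = 0" if "norm x \<ge> 1" for x
    using that by (cases "norm x = 1") (auto simp: ball_weight_def indicator_def)
  obtain N where N: "N \<in> null_sets lborel" and eq: "\<And>x. x \<notin> N \<Longrightarrow> ?I x * f x = f' x"
  proof -
    from AE_E3[OF ae] obtain N where "\<And>x. x \<in> space lborel - N \<Longrightarrow> ?I x * f x = f' x" "N \<in> null_sets lborel"
      by blast
    then show thesis by (intro that[of N]) auto
  qed
  have rhs: "ball_integral \<mu> (\<lambda>x. f x * g x) = (LINT x|lborel. ?H x)"
  proof -
    have ae': "AE x in lebesgue. ?H x = ?I x * (f x * g x * ball_weight \<mu> x)"
      by (rule AE_completion) (use ae in eventually_elim, auto simp: indicator_def)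
    have m': "?H \<in> borel_measurable lebesgue" by (rule measurable_completion) (use Hm in simp)
    have "ball_integral \<mu> (\<lambda>x. f x * g x) = (LINT x|lebesgue. ?H x)"
      unfolding ball_integral_def set_lebesgue_integral_def real_scaleR_def
      by (rule integral_cong_AE[OF borel_measurable_AE[OF m' ae'] m']) (use ae' in eventually_elim, auto)
    also have "\<dots> = (LINT x|lborel. ?H x)" by (rule integral_completion) (use Hm in auto)
    finally show ?thesis .
  qed
  have rad: "radon \<mu> f \<theta> t w * G t w = (LINT s|lborel. ?H (chord_pt \<theta> t w s))"
    if w: "\<bar>w\<bar> < 1" and t: "\<bar>t\<bar> < 1" and aes: "AE s in lborel. chord_pt \<theta> t w s \<notin> N" for w t
  proof -
    let ?F = "\<lambda>x. ?I x * (f' x * ball_weight \<mu> x)"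
    have Fm: "(\<lambda>s. ?F (chord_pt \<theta> t w s)) \<in> borel_measurable borel"
    proof (rule measurable_compose[where g = ?F and N = borel])
      show "?F \<in> borel_measurable borel"
        by (intro borel_measurable_times borel_measurable_indicator) auto
    qed measurable
    have "chord_pt \<theta> t w s \<in> chord_seg \<theta> t w \<longleftrightarrow> chord_pt \<theta> t w s \<in> cball 0 1" for s
      using chord_pt_image[of \<theta> t w] by (auto simp: chord_seg_def)
    then have "radon \<mu> f \<theta> t w = integral\<^sup>L lebesgue (\<lambda>s. ?I (chord_pt \<theta> t w s) * (f (chord_pt \<theta> t w s) * ball_weight \<mu> (chord_pt \<theta> t w s)))"
      unfolding radon_def set_lebesgue_integral_def
      by (intro Bochner_Integration.integral_cong) (auto simp: indicator_def)
    also have "\<dots> = integral\<^sup>L lborel (\<lambda>s. ?F (chord_pt \<theta> t w s))"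
    proof (rule integral_lebesgue_AE[OF Fm])
      show "AE s in lborel. ?I (chord_pt \<theta> t w s) * (f (chord_pt \<theta> t w s) * ball_weight \<mu> (chord_pt \<theta> t w s))
          = ?F (chord_pt \<theta> t w s)"
        using aes
      proof eventually_elim
        case (elim s)
        from eq[OF this] show ?case by (auto simp: indicator_def)
      qed
    qed
    finally have "radon \<mu> f \<theta> t w * G t w = (LINT s|lborel. ?F (chord_pt \<theta> t w s) * G t w)" by simp
    also have "\<dots> = (LINT s|lborel. ?H (chord_pt \<theta> t w s))"
    proof (intro Bochner_Integration.integral_cong refl)
      fix s show "?F (chord_pt \<theta> t w s) * G t w = ?H (chord_pt \<theta> t w s)"
        unfolding G[OF w t, of s] by simp
    qed
    finally show ?thesis .
  qed
  \<comment> \<open>Joint measurability makes the inner integrals of the Borel version Borel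
    functions of \<open>t\<close> and of \<open>w\<close>.\<close>
  have m1: "(\<lambda>(w, t). LINT s|lborel. ?H (chord_pt \<theta> t w s)) \<in> borel_measurable (borel \<Otimes>\<^sub>M borel)"
  proof -
    have "(\<lambda>q. ?H (chord_pt \<theta> (snd (fst q)) (fst (fst q)) (snd q))) \<in> borel_measurable ((borel \<Otimes>\<^sub>M borel) \<Otimes>\<^sub>M lborel)"
      by (rule measurable_compose[OF _ Hm]) measurable
    then have "(\<lambda>p. LINT s|lborel. ?H (chord_pt \<theta> (snd p) (fst p) s)) \<in> borel_measurable (borel \<Otimes>\<^sub>M borel)"
      by (intro lborel.borel_measurable_lebesgue_integral) (simp add: case_prod_beta)
    then show ?thesis by (simp add: case_prod_beta)
  qed
  have m1w: "(\<lambda>t. LINT s|lborel. ?H (chord_pt \<theta> t w s)) \<in> borel_measurable borel" for w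
    using measurable_compose[OF _ m1, of "\<lambda>t. (w, t)" borel] by simp
  have m2: "(\<lambda>w. LINT t|lborel. indicat_real {-1<..<1} t * (LINT s|lborel. ?H (chord_pt \<theta> t w s))) \<in> borel_measurable borel"
  proof (intro lborel.borel_measurable_lebesgue_integral)
    have "(\<lambda>p. indicat_real {-1<..<1} (snd p) * (case p of (w, t) \<Rightarrow> LINT s|lborel. ?H (chord_pt \<theta> t w s)))
        \<in> borel_measurable (borel \<Otimes>\<^sub>M borel)"
      by (intro borel_measurable_times m1) measurable
    then show "(\<lambda>(w, t). indicat_real {-1<..<1} t * (LINT s|lborel. ?H (chord_pt \<theta> t w s))) \<in> borel_measurable (borel \<Otimes>\<^sub>M lborel)"
      by (simp add: case_prod_beta)
  qed
  have "(LINT w:{-1<..<1}|lebesgue. (LINT t:{-1<..<1}|lebesgue. radon \<mu> f \<theta> t w * G t w) * sqrt (1 - w\<^sup>2)) =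
     (LINT w|lborel. indicator {-1<..<1} w * ((LINT t|lborel. indicator {-1<..<1} t *
         (LINT s|lborel. ?H (chord_pt \<theta> t w s))) * sqrt (1 - w\<^sup>2)))"
    unfolding set_lebesgue_integral_def real_scaleR_def
  proof (rule integral_lebesgue_AE)
    show "(\<lambda>w. indicat_real {-1<..<1} w * ((LINT t|lborel. indicat_real {-1<..<1} t *
         (LINT s|lborel. ?H (chord_pt \<theta> t w s))) * sqrt (1 - w\<^sup>2))) \<in> borel_measurable borel"
      by (intro borel_measurable_times m2) measurable
    show "AE w in lborel. indicat_real {-1<..<1} w * ((LINT t|lebesgue. indicat_real {-1<..<1} t *
          (radon \<mu> f \<theta> t w * G t w)) * sqrt (1 - w\<^sup>2)) =
        indicat_real {-1<..<1} w * ((LINT t|lborel. indicat_real {-1<..<1} t *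
         (LINT s|lborel. ?H (chord_pt \<theta> t w s))) * sqrt (1 - w\<^sup>2))"
      using AE_chord_pt[OF N, of \<theta>]
    proof eventually_elim
      case (elim w)
      show ?case
      proof (cases "w \<in> {-1<..<1}")
        case True
        then have w: "\<bar>w\<bar> < 1" by auto
        have "(LINT t|lebesgue. indicat_real {-1<..<1} t * (radon \<mu> f \<theta> t w * G t w)) =
          (LINT t|lborel. indicat_real {-1<..<1} t * (LINT s|lborel. ?H (chord_pt \<theta> t w s)))"
        proof (rule integral_lebesgue_AE)
          show "(\<lambda>t. indicat_real {-1<..<1} t * (LINT s|lborel. ?H (chord_pt \<theta> t w s))) \<in> borel_measurable borel"
            by (intro borel_measurable_times m1w) measurable
          have "AE t in lborel. AE s in lborel. chord_pt \<theta> t w s \<notin> N" using elim w by blast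
          then show "AE t in lborel. indicat_real {-1<..<1} t * (radon \<mu> f \<theta> t w * G t w) =
              indicat_real {-1<..<1} t * (LINT s|lborel. ?H (chord_pt \<theta> t w s))"
          proof eventually_elim
            case (elim t)
            show ?case
            proof (cases "t \<in> {-1<..<1}")
              case True
              then have "\<bar>t\<bar> < 1" by auto
              from rad[OF w this elim] show ?thesis by simp
            qed simp
          qed
        qed
        then show ?thesis by simp
      qed simp
    qed
  qed
  also have "\<dots> = (LINT x|lborel. ?H x)"
    using integral_chord_pt[OF int H0, of \<theta>]
    unfolding set_lebesgue_integral_def real_scaleR_def by (rule sym)
  finally show ?thesis using rhs by simp
qed

section \<open>Disk polynomials\<close>

lemma wint_bound:
  assumes ab: "\<alpha> > -1" "\<beta> > -1" and c: "continuous_on {-1..1} g"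
    and B: "\<And>t. t \<in> {-1..1} \<Longrightarrow> \<bar>g t\<bar> \<le> B"
  shows "\<bar>wint \<alpha> \<beta> g\<bar> \<le> B * wint \<alpha> \<beta> (\<lambda>_. 1)"
proof -
  have i: "set_integrable lborel {-1..1} (\<lambda>t. g t * jacobi_weight \<alpha> \<beta> t)" by (rule wint_integrable[OF ab c])
  have "\<bar>wint \<alpha> \<beta> g\<bar> \<le> (LINT t:{-1..1}|lborel. \<bar>g t * jacobi_weight \<alpha> \<beta> t\<bar>)"
    unfolding wint_def using set_integral_norm_bound[OF i] by simp
  also have "\<dots> \<le> (LINT t:{-1..1}|lborel. B * jacobi_weight \<alpha> \<beta> t)"
  proof (rule set_integral_mono)
    show "set_integrable lborel {-1..1} (\<lambda>t. \<bar>g t * jacobi_weight \<alpha> \<beta> t\<bar>)"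
      by (rule set_integrable_abs[OF i])
    show "set_integrable lborel {-1..1} (\<lambda>t. B * jacobi_weight \<alpha> \<beta> t)"
      by (rule wint_integrable[OF ab]) simp
    show "\<bar>g t * jacobi_weight \<alpha> \<beta> t\<bar> \<le> B * jacobi_weight \<alpha> \<beta> t" if "t \<in> {-1..1}" for t
      using B[OF that] by (simp add: abs_mult jacobi_weight_def mult_right_mono)
  qed
  also have "\<dots> = B * wint \<alpha> \<beta> (\<lambda>_. 1)"
    by (simp add: wint_def)
  finally show ?thesis .
qed

lemma wint_diff:
  assumes "\<alpha> > -1" "\<beta> > -1" "continuous_on {-1..1} g" "continuous_on {-1..1} h"
  shows "wint \<alpha> \<beta> (\<lambda>t. g t - h t) = wint \<alpha> \<beta> g - wint \<alpha> \<beta> h"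
  using wint_add[OF assms(1-3), of "\<lambda>t. - 1 * h t"] assms(4)
  by (simp only: wint_cmult) (simp add: continuous_on_minus)

text \<open>Uniform continuity on the compact square together with \<open>wint_bound\<close>.
  Additivity of \<open>wint\<close> is stated for continuous integrands, so the outer integrand of
  \<open>disk_integral\<close> has to be continuous.\<close>

lemma wint_param_continuous:
  fixes F :: "real \<Rightarrow> real \<Rightarrow> real"
  assumes ab: "\<alpha> > -1" "\<beta> > -1" and c: "continuous_on ({-1..1} \<times> {-1..1}) (\<lambda>p. F (fst p) (snd p))"
  shows "continuous_on {-1..1} (\<lambda>t. wint \<alpha> \<beta> (F t))"
proof -
  have cF: "continuous_on {-1..1} (F t)" if "t \<in> {-1..1}" for t
  proof -
    have "continuous_on {-1..1} ((\<lambda>p. F (fst p) (snd p)) \<circ> (\<lambda>s. (t, s)))"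
      by (intro continuous_on_compose continuous_on_subset[OF c] continuous_intros) (use that in auto)
    then show ?thesis by (simp add: o_def)
  qed
  have u: "uniformly_continuous_on ({-1..1} \<times> {-1..1}) (\<lambda>p. F (fst p) (snd p))"
    by (intro compact_uniformly_continuous c compact_Times) auto
  let ?Z = "wint \<alpha> \<beta> (\<lambda>_. 1)"
  have Z: "?Z > 0" by (rule wint_one_pos[OF ab])
  show ?thesis unfolding continuous_on_iff
  proof (intro ballI allI impI)
    fix t e :: real assume t: "t \<in> {-1..1}" and e: "e > 0"
    then have "e / (2 * ?Z) > 0" using Z by simp
    with u obtain d where d: "d > 0" and
      D: "\<And>p q. p \<in> {-1..1} \<times> {-1..1} \<Longrightarrow> q \<in> {-1..1} \<times> {-1..1} \<Longrightarrow> dist q p < d \<Longrightarrow>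
        dist (F (fst q) (snd q)) (F (fst p) (snd p)) < e / (2 * ?Z)"
      unfolding uniformly_continuous_on_def by metis
    show "\<exists>d>0. \<forall>t'\<in>{-1..1}. dist t' t < d \<longrightarrow> dist (wint \<alpha> \<beta> (F t')) (wint \<alpha> \<beta> (F t)) < e"
    proof (intro exI[of _ d] conjI d ballI impI)
      fix t' :: real assume t': "t' \<in> {-1..1}" and dist: "dist t' t < d"
      have "\<bar>F t' s - F t s\<bar> \<le> e / (2 * ?Z)" if "s \<in> {-1..1}" for s
        using D[of "(t, s)" "(t', s)"] t t' that dist by (auto simp: dist_Pair_Pair dist_real_def)
      then have "\<bar>wint \<alpha> \<beta> (\<lambda>s. F t' s - F t s)\<bar> \<le> e / (2 * ?Z) * ?Z"
        by (intro wint_bound ab continuous_on_diff cF t t')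
      also have "\<dots> < e" using Z e by (simp add: field_simps)
      finally show "dist (wint \<alpha> \<beta> (F t')) (wint \<alpha> \<beta> (F t)) < e"
        using wint_diff[OF ab cF[OF t'] cF[OF t]] by (simp add: dist_real_def)
    qed
  qed
qed

text \<open>The integral over the unit disk for \<open>W\<^sub>\<mu>\<close>, in chord coordinates for the direction \<open>\<theta> = 0\<close>.\<close>

definition disk_integral :: "real \<Rightarrow> (complex \<Rightarrow> real) \<Rightarrow> real" where
  "disk_integral \<mu> F = wint \<mu> \<mu> (\<lambda>t. wint (\<mu> - 1/2) (\<mu> - 1/2) (\<lambda>\<sigma>. F (Complex t (sqrt (1 - t\<^sup>2) * \<sigma>))))"

lemma disk_integral_inner_continuous:
  assumes mu: "\<mu> \<ge> 0" and F: "continuous_on UNIV F"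
  shows "continuous_on {-1..1} (\<lambda>\<sigma>. F (Complex t (sqrt (1 - t\<^sup>2) * \<sigma>)))"
    and "continuous_on {-1..1} (\<lambda>t. wint (\<mu> - 1/2) (\<mu> - 1/2) (\<lambda>\<sigma>. F (Complex t (sqrt (1 - t\<^sup>2) * \<sigma>))))"
proof -
  have c: "continuous_on A (\<lambda>x. F (Complex (f x) (g x)))" if "continuous_on A f" "continuous_on A g"
    for f g and A :: "'a::topological_space set"
    by (rule continuous_on_compose2[OF F]) (auto intro!: continuous_intros that simp: Complex_eq)
  show "continuous_on {-1..1} (\<lambda>\<sigma>. F (Complex t (sqrt (1 - t\<^sup>2) * \<sigma>)))"
    by (intro c continuous_intros)
  show "continuous_on {-1..1} (\<lambda>t. wint (\<mu> - 1/2) (\<mu> - 1/2) (\<lambda>\<sigma>. F (Complex t (sqrt (1 - t\<^sup>2) * \<sigma>))))"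
    by (rule wint_param_continuous) (use mu in \<open>auto intro!: c continuous_intros\<close>)
qed

lemma disk_integral_cmult [simp]: "disk_integral \<mu> (\<lambda>z. c * F z) = c * disk_integral \<mu> F"
  by (simp add: disk_integral_def)

lemma disk_integral_zero [simp]: "disk_integral \<mu> (\<lambda>z. 0) = 0"
  by (simp add: disk_integral_def)

lemma disk_integral_add:
  assumes mu: "\<mu> \<ge> 0" and F: "continuous_on UNIV F" and G: "continuous_on UNIV G"
  shows "disk_integral \<mu> (\<lambda>z. F z + G z) = disk_integral \<mu> F + disk_integral \<mu> G"
proof -
  have "wint (\<mu> - 1/2) (\<mu> - 1/2) (\<lambda>\<sigma>. F (Complex t (sqrt (1 - t\<^sup>2) * \<sigma>)) + G (Complex t (sqrt (1 - t\<^sup>2) * \<sigma>))) =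
     wint (\<mu> - 1/2) (\<mu> - 1/2) (\<lambda>\<sigma>. F (Complex t (sqrt (1 - t\<^sup>2) * \<sigma>))) +
     wint (\<mu> - 1/2) (\<mu> - 1/2) (\<lambda>\<sigma>. G (Complex t (sqrt (1 - t\<^sup>2) * \<sigma>)))" for t
    by (rule wint_add) (use mu disk_integral_inner_continuous[OF mu F] disk_integral_inner_continuous[OF mu G] in auto)
  then show ?thesis unfolding disk_integral_def
    by (simp only:) (rule wint_add; use mu disk_integral_inner_continuous[OF mu F] disk_integral_inner_continuous[OF mu G] in auto)
qed

lemma disk_integral_sum:
  assumes mu: "\<mu> \<ge> 0" and "\<And>i. i \<in> A \<Longrightarrow> continuous_on UNIV (F i)"
  shows "disk_integral \<mu> (\<lambda>z. \<Sum>i\<in>A. F i z) = (\<Sum>i\<in>A. disk_integral \<mu> (F i))"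
  using assms(2)
proof (induction A rule: infinite_finite_induct)
  case (insert i A)
  then have "disk_integral \<mu> (\<lambda>z. F i z + (\<Sum>i\<in>A. F i z)) = disk_integral \<mu> (F i) + disk_integral \<mu> (\<lambda>z. \<Sum>i\<in>A. F i z)"
    by (intro disk_integral_add mu continuous_on_sum insert.prems) auto
  with insert show ?case by simp
qed simp_all

definition planar_part :: "real^3 \<Rightarrow> complex" where "planar_part x = Complex (x$1) (x$2)"

lemma ball_pt_parts:
  "ball_pt \<theta> w t \<sigma> $ 3 = w"
  "planar_part (ball_pt \<theta> w t \<sigma>) = of_real (sqrt (1 - w\<^sup>2)) * (cis \<theta> * Complex t (sqrt (1 - t\<^sup>2) * \<sigma>))"
  unfolding ball_pt_def real_sqrt_mult
  by (simp_all add: chord_pt_def planar_part_def complex_eq_iff algebra_simps)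

lemma continuous_planar_part [continuous_intros]: "continuous_on A planar_part"
  unfolding planar_part_def Complex_eq by (intro continuous_intros)

text \<open>
  The left-hand side does not mention \<open>\<theta>\<close>; this is how rotation invariance of \<open>disk_integral\<close> is obtained.
\<close>

lemma disk_integral_rotate_ball_integral:
  assumes mu: "\<mu> \<ge> 0" and F: "continuous_on UNIV F"
    and h: "\<And>r z. r \<ge> 0 \<Longrightarrow> F (of_real r * z) = r ^ d * F z"
  shows "ball_integral \<mu> (\<lambda>x. F (planar_part x)) =
     wint (\<mu> + 1/2) (\<mu> + 1/2) (\<lambda>w. sqrt (1 - w\<^sup>2) ^ d) * disk_integral \<mu> (\<lambda>z. F (cis \<theta> * z))"
proof -
  have c: "continuous_on UNIV (\<lambda>x. F (planar_part x))"
    by (rule continuous_on_compose2[OF F]) (auto intro: continuous_intros)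
  have "ball_integral \<mu> (\<lambda>x. F (planar_part x)) = wint (\<mu> + 1/2) (\<mu> + 1/2) (\<lambda>w. sqrt (1 - w\<^sup>2) ^ d * disk_integral \<mu> (\<lambda>z. F (cis \<theta> * z)))"
    unfolding ball_integral_iterated[OF mu c, of \<theta>]
  proof (rule wint_cong)
    fix w :: real assume "w \<in> {-1..1}"
    then have "sqrt (1 - w\<^sup>2) \<ge> 0" by (auto simp: abs_square_le_1 abs_le_iff)
    then show "wint \<mu> \<mu> (\<lambda>t. wint (\<mu> - 1/2) (\<mu> - 1/2) (\<lambda>\<sigma>. F (planar_part (ball_pt \<theta> w t \<sigma>)))) =
        sqrt (1 - w\<^sup>2) ^ d * disk_integral \<mu> (\<lambda>z. F (cis \<theta> * z))"
      unfolding ball_pt_parts by (simp add: h disk_integral_def)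
  qed
  then show ?thesis by simp
qed

text \<open>The power only raises the exponent of the weight. Positivity allows this axial factor to
  be cancelled when two rotation angles are compared.\<close>

lemma wint_sqrt_pos:
  assumes "\<mu> \<ge> 0"
  shows "wint (\<mu> + 1/2) (\<mu> + 1/2) (\<lambda>w. sqrt (1 - w\<^sup>2) ^ d) > 0"
proof -
  have "wint (\<mu> + 1/2) (\<mu> + 1/2) (\<lambda>w. sqrt (1 - w\<^sup>2) ^ d) = wint (\<mu> + 1/2 + d/2) (\<mu> + 1/2 + d/2) (\<lambda>_. 1)"
    unfolding wint_open
  proof (intro set_lebesgue_integral_cong allI impI)
    fix w :: real assume "w \<in> {-1<..<1}"
    then have p: "1 - w\<^sup>2 > 0" by (intro one_minus_sq_pos) auto
    then have "sqrt (1 - w\<^sup>2) ^ d = (1 - w\<^sup>2) powr (d / 2)"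
      by (simp add: powr_half_sqrt[symmetric] powr_powr flip: powr_realpow)
    then show "sqrt (1 - w\<^sup>2) ^ d * (1 - w\<^sup>2) powr (\<mu> + 1/2) = 1 * (1 - w\<^sup>2) powr (\<mu> + 1/2 + d/2)"
      by (simp add: powr_add[symmetric] add_ac)
  qed auto
  also have "\<dots> > 0" by (rule wint_one_pos) (use assms in auto)
  finally show ?thesis .
qed

text \<open>Homogeneity separates the height from the disk, so one and the same ball integral,
  expressed with the angles \<open>\<theta>\<close> and 0, carries the same axial factor.\<close>

lemma disk_integral_rotate:
  assumes mu: "\<mu> \<ge> 0" and F: "continuous_on UNIV F"
    and h: "\<And>r z. r \<ge> 0 \<Longrightarrow> F (of_real r * z) = r ^ d * F z"
  shows "disk_integral \<mu> (\<lambda>z. F (cis \<theta> * z)) = disk_integral \<mu> F"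
  using disk_integral_rotate_ball_integral[OF assms, of \<theta>] disk_integral_rotate_ball_integral[OF assms, of 0] wint_sqrt_pos[OF mu, of d]
  by simp

section \<open>Solid harmonics and trigonometric sums\<close>

text \<open>The solid harmonics \<open>r ^ j * cos (j * \<phi>)\<close> and
  \<open>r ^ j * sin (j * \<phi>)\<close>.\<close>

definition harm :: "nat \<Rightarrow> nat \<Rightarrow> complex \<Rightarrow> real" where
  "harm j \<epsilon> z = (if \<epsilon> = 0 then Re (z ^ j) else Im (z ^ j))"

lemma continuous_harm [continuous_intros]:
  "continuous_on A f \<Longrightarrow> continuous_on A (\<lambda>x. harm j \<epsilon> (f x))"
  unfolding harm_def by (cases "\<epsilon> = 0") (auto intro!: continuous_intros)

lemma harm_scale: "harm j \<epsilon> (of_real r * z) = r ^ j * harm j \<epsilon> z"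
  by (simp add: harm_def power_mult_distrib flip: of_real_power)

lemma harm_0_1 [simp]: "\<epsilon> \<noteq> 0 \<Longrightarrow> harm 0 \<epsilon> z = 0"
  by (simp add: harm_def)

text \<open>The two exponential sums that product-to-sum formulas produce, with frequency 0
  excluded. Abstract nodes serve both a fine equidistant set, for averaging over rotations, and the
  nodes of the theorem.\<close>

definition good_nodes :: "nat \<Rightarrow> (nat \<Rightarrow> real) \<Rightarrow> nat \<Rightarrow> nat \<Rightarrow> bool" where
  "good_nodes N \<theta> j j' \<longleftrightarrow>
    (j + j' \<noteq> 0 \<longrightarrow> (\<Sum>\<nu><N. cis (\<theta> \<nu>) ^ (j + j')) = 0) \<and>
    (j \<noteq> j' \<longrightarrow> (\<Sum>\<nu><N. cis (\<theta> \<nu>) ^ j * cnj (cis (\<theta> \<nu>) ^ j')) = 0)"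

text \<open>The mean of the square of \<open>harm j \<epsilon>\<close> over the unit circle.\<close>

definition harm_mean :: "nat \<Rightarrow> nat \<Rightarrow> real" where
  "harm_mean j \<epsilon> = (if j = 0 then (if \<epsilon> = 0 then 1 else 0) else 1/2)"

lemma Re_Im_products:
  "Re x * Re y = (Re (x * y) + Re (x * cnj y)) / 2"
  "Im x * Im y = (Re (x * cnj y) - Re (x * y)) / 2"
  "Re x * Im y = (Im (x * y) - Im (x * cnj y)) / 2"
  "Im x * Re y = (Im (x * y) + Im (x * cnj y)) / 2"
  by (auto simp: algebra_simps)

text \<open>Products of real and imaginary parts are combinations of \<open>X * Y\<close> and
  \<open>X * cnj Y\<close>, whose node sums \<open>good_nodes\<close> controls. The free point
  \<open>z\<close> allows integration over the disk afterwards; the quadrature takes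
  \<open>z = 1\<close>.\<close>

lemma harm_sum_orth:
  assumes g: "good_nodes N \<theta> j j'" and e: "\<epsilon> < 2" "\<epsilon>' < 2"
  shows "(\<Sum>\<nu><N. harm j \<epsilon> (cis (\<theta> \<nu>) * z) * harm j' \<epsilon>' (cis (\<theta> \<nu>) * z)) =
    (if j = j' \<and> \<epsilon> = \<epsilon>' then real N * harm_mean j \<epsilon> * cmod z ^ (2 * j) else 0)"
proof -
  define X where "X \<nu> = (cis (\<theta> \<nu>) * z) ^ j" for \<nu>
  define Y where "Y \<nu> = (cis (\<theta> \<nu>) * z) ^ j'" for \<nu>
  have S1: "(\<Sum>\<nu><N. X \<nu> * Y \<nu>) = z ^ (j + j') * (\<Sum>\<nu><N. cis (\<theta> \<nu>) ^ (j + j'))"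
    by (simp add: X_def Y_def power_mult_distrib power_add sum_distrib_left mult_ac)
  have S2: "(\<Sum>\<nu><N. X \<nu> * cnj (Y \<nu>)) = z ^ j * cnj (z ^ j') * (\<Sum>\<nu><N. cis (\<theta> \<nu>) ^ j * cnj (cis (\<theta> \<nu>) ^ j'))"
    by (simp add: X_def Y_def power_mult_distrib sum_distrib_left mult_ac)
  have zz: "z ^ j * cnj (z ^ j) = of_real (cmod z ^ (2 * j))"
    by (simp only: complex_norm_square[symmetric] norm_power power_mult[symmetric] mult.commute[of j]
        of_real_power[symmetric])
  have cc: "cis x ^ j * cnj (cis x ^ j) = 1" for x
    by (simp only: complex_norm_square[symmetric] norm_power norm_cis power_one of_real_1)
  have A: "(\<Sum>\<nu><N. X \<nu> * Y \<nu>) = (if j + j' = 0 then of_nat N else 0)"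
    using g unfolding S1 good_nodes_def by auto
  have B: "(\<Sum>\<nu><N. X \<nu> * cnj (Y \<nu>)) = (if j = j' then of_real (real N * cmod z ^ (2 * j)) else 0)"
    using g cc zz unfolding S2 good_nodes_def by auto
  have RR: "(\<Sum>\<nu><N. Re (X \<nu>) * Re (Y \<nu>)) = (Re (\<Sum>\<nu><N. X \<nu> * Y \<nu>) + Re (\<Sum>\<nu><N. X \<nu> * cnj (Y \<nu>))) / 2"
    unfolding Re_Im_products Re_sum sum.distrib[symmetric] sum_divide_distrib by simp
  have II: "(\<Sum>\<nu><N. Im (X \<nu>) * Im (Y \<nu>)) = (Re (\<Sum>\<nu><N. X \<nu> * cnj (Y \<nu>)) - Re (\<Sum>\<nu><N. X \<nu> * Y \<nu>)) / 2"
    unfolding Re_Im_products Re_sum sum_subtractf[symmetric] sum_divide_distrib by simp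
  have RI: "(\<Sum>\<nu><N. Re (X \<nu>) * Im (Y \<nu>)) = (Im (\<Sum>\<nu><N. X \<nu> * Y \<nu>) - Im (\<Sum>\<nu><N. X \<nu> * cnj (Y \<nu>))) / 2"
    unfolding Re_Im_products Im_sum sum_subtractf[symmetric] sum_divide_distrib by simp
  have IR: "(\<Sum>\<nu><N. Im (X \<nu>) * Re (Y \<nu>)) = (Im (\<Sum>\<nu><N. X \<nu> * Y \<nu>) + Im (\<Sum>\<nu><N. X \<nu> * cnj (Y \<nu>))) / 2"
    unfolding Re_Im_products Im_sum sum.distrib[symmetric] sum_divide_distrib by simp
  have "\<epsilon> = 0 \<or> \<epsilon> = 1" "\<epsilon>' = 0 \<or> \<epsilon>' = 1" using e by auto
  then show ?thesis
    unfolding harm_def X_def[symmetric] Y_def[symmetric]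
    by (elim disjE; simp add: RR II RI IR A B harm_mean_def)
qed

lemma cis_neq_1:
  assumes "0 < \<bar>x\<bar>" "\<bar>x\<bar> < 2 * pi"
  shows "cis x \<noteq> 1"
proof
  assume "cis x = 1"
  then have "cos x = 1" by (simp add: complex_eq_iff)
  then obtain n :: int where n: "x = of_int n * 2 * pi"
    by (auto simp: cos_one_2pi_int)
  have "n \<noteq> 0" using n assms by auto
  then have "1 \<le> \<bar>of_int n :: real\<bar>" by linarith
  then have "2 * pi \<le> \<bar>x\<bar>" unfolding n by (simp add: abs_mult)
  then show False using assms by simp
qed

lemma cis_geometric:
  assumes "0 < \<bar>x\<bar>" "\<bar>x\<bar> < 2 * pi" and "cis (real N * x) = 1"
  shows "(\<Sum>\<nu><N. cis (real \<nu> * x)) = 0"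
proof -
  have "(\<Sum>\<nu><N. cis (real \<nu> * x)) = (\<Sum>\<nu><N. cis x ^ \<nu>)" by (simp only: Complex.DeMoivre)
  also have "\<dots> = (1 - cis x ^ N) / (1 - cis x)"
    using cis_neq_1[OF assms(1,2)] by (simp add: sum_gp_strict)
  also have "cis x ^ N = 1" using assms(3) by (simp add: Complex.DeMoivre)
  finally show ?thesis by simp
qed

lemma cis_power_cnj: "cis x ^ j * cnj (cis x ^ j') = cis ((real j - real j') * x)"
  by (simp add: Complex.DeMoivre cis_cnj cis_mult algebra_simps)

text \<open>A nonzero frequency of modulus below \<open>N\<close> gives a nontrivial
  \<open>N\<close>-th root of unity, whose powers sum to 0.\<close>

lemma good_nodes_equidistant:
  assumes N: "N > j + j'"
  shows "good_nodes N (\<lambda>\<nu>. 2 * pi * real \<nu> / real N) j j'"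
proof -
  have geo: "(\<Sum>\<nu><N. cis (real_of_int r * (2 * pi * real \<nu> / real N))) = 0"
    if r: "r \<noteq> 0" "\<bar>r\<bar> < int N" for r
  proof -
    have "(\<Sum>\<nu><N. cis (real \<nu> * (real_of_int r * 2 * pi / real N))) = 0"
    proof (rule cis_geometric)
      show "0 < \<bar>real_of_int r * 2 * pi / real N\<bar>" using r N by simp
      have "\<bar>real_of_int r\<bar> / real N < 1" using r N by simp
      then have "\<bar>real_of_int r\<bar> / real N * (2 * pi) < 1 * (2 * pi)" by (intro mult_strict_right_mono) auto
      then show "\<bar>real_of_int r * 2 * pi / real N\<bar> < 2 * pi" by (simp add: abs_mult mult_ac)
      have "real N * (real_of_int r * 2 * pi / real N) = 2 * pi * of_int r" using N by simp
      then show "cis (real N * (real_of_int r * 2 * pi / real N)) = 1"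
        by (simp only: cis_multiple_2pi Ints_of_int)
    qed
    then show ?thesis by (simp add: mult_ac)
  qed
  show ?thesis unfolding good_nodes_def cis_power_cnj
    using geo[of "int j + int j'"] geo[of "int j - int j'"] N by (auto simp: Complex.DeMoivre)
qed

text \<open>By averaging over the rotations of a sufficiently fine equidistant set.\<close>

lemma disk_integral_harm_orth:
  assumes mu: "\<mu> \<ge> 0" and e: "\<epsilon> < 2" "\<epsilon>' < 2"
  shows "disk_integral \<mu> (\<lambda>z. cmod z ^ (2 * m) * (harm j \<epsilon> z * harm j' \<epsilon>' z)) =
    (if j = j' \<and> \<epsilon> = \<epsilon>' then harm_mean j \<epsilon> * disk_integral \<mu> (\<lambda>z. cmod z ^ (2 * (m + j))) else 0)"
proof -
  let ?F = "\<lambda>z. cmod z ^ (2 * m) * (harm j \<epsilon> z * harm j' \<epsilon>' z)"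
  define N where "N = j + j' + 1"
  define \<theta> where "\<theta> = (\<lambda>\<nu>. 2 * pi * real \<nu> / real N)"
  have g: "good_nodes N \<theta> j j'" unfolding \<theta>_def by (rule good_nodes_equidistant) (simp add: N_def)
  have cF: "continuous_on UNIV ?F" by (intro continuous_intros)
  have rot: "disk_integral \<mu> (\<lambda>z. ?F (cis (\<theta> \<nu>) * z)) = disk_integral \<mu> ?F" for \<nu>
    by (rule disk_integral_rotate[OF mu cF, where d = "2 * m + j + j'"])
       (simp only: harm_scale norm_mult power_mult_distrib power_add norm_of_real abs_of_nonneg, simp only: mult_ac)
  have "real N * disk_integral \<mu> ?F = (\<Sum>\<nu><N. disk_integral \<mu> (\<lambda>z. ?F (cis (\<theta> \<nu>) * z)))"
    unfolding rot by simp
  also have "\<dots> = disk_integral \<mu> (\<lambda>z. \<Sum>\<nu><N. ?F (cis (\<theta> \<nu>) * z))"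
    by (rule disk_integral_sum[symmetric, OF mu]) (intro continuous_intros)
  also have "(\<lambda>z. \<Sum>\<nu><N. ?F (cis (\<theta> \<nu>) * z)) = (\<lambda>z. cmod z ^ (2 * m) *
      (\<Sum>\<nu><N. harm j \<epsilon> (cis (\<theta> \<nu>) * z) * harm j' \<epsilon>' (cis (\<theta> \<nu>) * z)))"
    by (simp add: norm_mult sum_distrib_left)
  also have "\<dots> = (\<lambda>z. real N * (if j = j' \<and> \<epsilon> = \<epsilon>' then harm_mean j \<epsilon> else 0) * cmod z ^ (2 * (m + j)))"
    unfolding harm_sum_orth[OF g e] by (auto simp: power_add distrib_left fun_eq_iff mult_ac)
  also have "disk_integral \<mu> \<dots> = real N * ((if j = j' \<and> \<epsilon> = \<epsilon>' then harm_mean j \<epsilon> else 0) * disk_integral \<mu> (\<lambda>z. cmod z ^ (2 * (m + j))))"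
    by (simp only: disk_integral_cmult mult.assoc)
  finally show ?thesis using N_def by simp
qed

section \<open>Total masses and radial integrals\<close>

lemma Gamma_legendre_duplication_pos_real:
  assumes "x > (0::real)"
  shows "Gamma x * Gamma (x + 1/2) = exp ((1 - 2 * x) * ln 2) * sqrt pi * Gamma (2 * x)"
proof -
  have n: "x \<notin> \<int>\<^sub>\<le>\<^sub>0" "x + 1/2 \<notin> \<int>\<^sub>\<le>\<^sub>0" using assms by (auto dest!: nonpos_Ints_nonpos)
  have "complex_of_real x \<notin> \<int>\<^sub>\<le>\<^sub>0" "complex_of_real x + 1/2 \<notin> \<int>\<^sub>\<le>\<^sub>0"
    using n of_real_in_nonpos_Ints_iff[of x, where 'a = complex]
      of_real_in_nonpos_Ints_iff[of "x + 1/2", where 'a = complex] by auto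
  from Gamma_legendre_duplication[OF this]
  have "complex_of_real (Gamma x * Gamma (x + 1/2)) =
      complex_of_real (exp ((1 - 2 * x) * ln 2) * sqrt pi * Gamma (2 * x))"
    using Gamma_complex_of_real[of "x + 1/2"] Gamma_complex_of_real[of "2 * x"]
    by (simp add: Gamma_complex_of_real exp_of_real[symmetric])
  then show ?thesis by (simp only: of_real_eq_iff)
qed

text \<open>Legendre's duplication formula removes the power of 2 and the doubled argument from the
  Beta value. The remaining Gamma values are half a step apart and telescope in
  \<open>wint_same_product\<close>.\<close>

lemma wint_same_one:
  assumes "a > -1"
  shows "wint a a (\<lambda>_. 1) = sqrt pi * Gamma (a + 1) / Gamma (a + 3/2)"
proof -
  have p: "a + 1 > 0" using assms by simp
  have G: "Gamma (a + 1) > 0" "Gamma (2 * (a + 1)) > 0" "Gamma (a + 3/2) > 0" using p by (auto intro!: Gamma_real_pos)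
  have "Gamma (a + 1) * Gamma (a + 1 + 1/2) = exp ((1 - 2 * (a + 1)) * ln 2) * sqrt pi * Gamma (2 * (a + 1))"
    by (rule Gamma_legendre_duplication_pos_real[OF p])
  also have "exp ((1 - 2 * (a + 1)) * ln 2) = 2 powr (- (2 * a + 1))"
    by (simp add: powr_def algebra_simps)
  finally have "Gamma (a + 1) * Gamma (a + 3/2) = 2 powr (- (2 * a + 1)) * sqrt pi * Gamma (2 * (a + 1))"
    by (simp add: add.commute)
  then have dup: "2 powr (2 * a + 1) * (Gamma (a + 1) * Gamma (a + 3/2)) = sqrt pi * Gamma (2 * (a + 1))"
    by (simp add: mult.assoc[symmetric] powr_add[symmetric])
  have "wint a a (\<lambda>_. 1) = 2 powr (2 * a + 1) * (Gamma (a + 1) * Gamma (a + 1) / Gamma (2 * (a + 1)))"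
    using assms by (simp add: wint_one Beta_def algebra_simps)
  also have "\<dots> = (2 powr (2 * a + 1) * (Gamma (a + 1) * Gamma (a + 3/2))) * Gamma (a + 1) / (Gamma (2 * (a + 1)) * Gamma (a + 3/2))"
    using G by simp
  also have "\<dots> = sqrt pi * Gamma (a + 1) / Gamma (a + 3/2)"
    unfolding dup using G by simp
  finally show ?thesis .
qed

text \<open>\<open>Gamma (\<mu> + 1)\<close> cancels between the two factors. The value is the mass
  of the disk weight.\<close>

lemma wint_same_product:
  assumes "\<mu> > -1/2"
  shows "wint \<mu> \<mu> (\<lambda>_. 1) * wint (\<mu> - 1/2) (\<mu> - 1/2) (\<lambda>_. 1) = pi / (\<mu> + 1/2)"
proof -
  have G: "Gamma (\<mu> + 1) > 0" "Gamma (\<mu> + 1/2) > 0" using assms by (auto intro!: Gamma_real_pos)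
  have r: "Gamma (\<mu> + 3/2) = (\<mu> + 1/2) * Gamma (\<mu> + 1/2)"
  proof -
    have "\<mu> + 1/2 \<notin> \<int>\<^sub>\<le>\<^sub>0" using assms by (auto dest!: nonpos_Ints_nonpos)
    from Gamma_plus1[OF this] show ?thesis by (simp add: add.commute)
  qed
  have "\<mu> - 1/2 + 1 = \<mu> + 1/2" "\<mu> - 1/2 + 3/2 = \<mu> + 1" by simp_all
  then have "wint \<mu> \<mu> (\<lambda>_. 1) * wint (\<mu> - 1/2) (\<mu> - 1/2) (\<lambda>_. 1) =
     (sqrt pi * Gamma (\<mu> + 1) / Gamma (\<mu> + 3/2)) * (sqrt pi * Gamma (\<mu> + 1/2) / Gamma (\<mu> + 1))"
    using assms wint_same_one[of \<mu>] wint_same_one[of "\<mu> - 1/2"] by (simp only:)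
  also have "\<dots> = (sqrt pi * sqrt pi) / (\<mu> + 1/2)"
  proof -
    have "(s * a / (m * b)) * (s * b / a) = (s * s) / m" if "a \<noteq> 0" "b \<noteq> 0" for s a m b :: real
      using that by simp
    from this[OF less_imp_neq[OF G(1), symmetric] less_imp_neq[OF G(2), symmetric]]
    show ?thesis unfolding r .
  qed
  finally show ?thesis by simp
qed

text \<open>The formula that \<open>(cmod z)\<^sup>2 = (1 + t) / 2\<close> would yield in polar
  coordinates. Both sides are linear in \<open>p\<close>, and on the \<open>n\<close>-th power of 1
  minus the argument both equal \<open>pi / (\<mu> + n + 1/2)\<close>.\<close>

lemma disk_integral_radial:
  assumes mu: "\<mu> \<ge> 0"
  shows "disk_integral \<mu> (\<lambda>z. poly p ((cmod z)\<^sup>2)) = pi / 2 powr (\<mu> + 1/2) * wint (\<mu> - 1/2) 0 (\<lambda>t. poly p ((1 + t) / 2))"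
proof -
  let ?\<alpha> = "\<mu> - 1/2"
  \<comment> \<open>Recentres \<open>p\<close> at 1, which expands it in powers of
    \<open>1 - s\<close>.\<close>
  define q where "q = pcompose p [:1, -1:]"
  have q: "poly p s = (\<Sum>n\<le>degree q. coeff q n * (1 - s) ^ n)" for s
    using poly_altdef[of q "1 - s"] by (simp add: q_def poly_pcompose)
  have mom: "disk_integral \<mu> (\<lambda>z. (1 - (cmod z)\<^sup>2) ^ n) = pi / 2 powr (\<mu> + 1/2) * wint ?\<alpha> 0 (\<lambda>t. (1 - (1 + t) / 2) ^ n)" for n
  proof -
    have e1: "1 - (cmod (Complex t (sqrt (1 - t\<^sup>2) * s)))\<^sup>2 = ((1 - t) * (1 + t)) * ((1 - s) * (1 + s))"
      if "t \<in> {-1..1}" for t s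
    proof -
      have "(sqrt (1 - t\<^sup>2))\<^sup>2 = 1 - t\<^sup>2" using that by (auto simp: abs_square_le_1 abs_le_iff)
      then show ?thesis by (simp add: cmod_power2 power_mult_distrib) (simp add: power2_eq_square algebra_simps)
    qed
    have "disk_integral \<mu> (\<lambda>z. (1 - (cmod z)\<^sup>2) ^ n) =
      wint \<mu> \<mu> (\<lambda>t. (1 - t) ^ n * (1 + t) ^ n * wint ?\<alpha> ?\<alpha> (\<lambda>s. (1 - s) ^ n * (1 + s) ^ n * 1))"
      unfolding disk_integral_def
    proof (rule wint_cong)
      fix t :: real assume t: "t \<in> {-1..1}"
      have "wint ?\<alpha> ?\<alpha> (\<lambda>s. (1 - (cmod (Complex t (sqrt (1 - t\<^sup>2) * s)))\<^sup>2) ^ n) =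
        wint ?\<alpha> ?\<alpha> (\<lambda>s. ((1 - t) ^ n * (1 + t) ^ n) * ((1 - s) ^ n * (1 + s) ^ n * 1))"
        by (simp only: e1[OF t] power_mult_distrib mult_1_right mult.assoc)
      then show "wint ?\<alpha> ?\<alpha> (\<lambda>s. (1 - (cmod (Complex t (sqrt (1 - t\<^sup>2) * s)))\<^sup>2) ^ n) =
        (1 - t) ^ n * (1 + t) ^ n * wint ?\<alpha> ?\<alpha> (\<lambda>s. (1 - s) ^ n * (1 + s) ^ n * 1)"
        by (simp only: wint_cmult)
    qed
    also have "\<dots> = wint (\<mu> + n) (\<mu> + n) (\<lambda>_. 1) * wint (?\<alpha> + n) (?\<alpha> + n) (\<lambda>_. 1)"
      unfolding wint_shift
      using wint_cmult_right[of "\<mu> + n" "\<mu> + n" "\<lambda>_. 1" "wint (?\<alpha> + n) (?\<alpha> + n) (\<lambda>_. 1)"]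
      by (simp only: mult_1_left)
    also have "\<dots> = pi / (\<mu> + n + 1/2)"
    proof -
      have "?\<alpha> + n = \<mu> + n - 1/2" by simp
      then show ?thesis using wint_same_product[of "\<mu> + n"] mu by (simp only:)
    qed
    finally have 1: "disk_integral \<mu> (\<lambda>z. (1 - (cmod z)\<^sup>2) ^ n) = pi / (\<mu> + n + 1/2)" .
    have "wint ?\<alpha> 0 (\<lambda>t. (1 - (1 + t) / 2) ^ n) = wint ?\<alpha> 0 (\<lambda>t. (1 / 2 ^ n) * ((1 - t) ^ n * (1 + t) ^ 0 * 1))"
    proof (rule wint_cong)
      fix t :: real
      have "1 - (1 + t) / 2 = (1 - t) / 2" by (simp add: field_simps)
      then show "(1 - (1 + t) / 2) ^ n = (1 / 2 ^ n) * ((1 - t) ^ n * (1 + t) ^ 0 * 1)"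
        by (simp only: power_divide) simp
    qed
    also have "\<dots> = 1 / 2 ^ n * wint (?\<alpha> + n) 0 (\<lambda>_. 1)"
      unfolding wint_cmult wint_shift by simp
    also have "wint (?\<alpha> + n) 0 (\<lambda>_. 1) = 2 powr (\<mu> + 1/2 + n) / (\<mu> + n + 1/2)"
    proof -
      have "Gamma (\<mu> + n + 1/2 + 1) = (\<mu> + n + 1/2) * Gamma (\<mu> + n + 1/2)"
        by (rule Gamma_plus1) (use mu in \<open>auto dest!: nonpos_Ints_nonpos\<close>)
      moreover have "Gamma (\<mu> + n + 1/2) > 0" using mu by (intro Gamma_real_pos) auto
      ultimately have "Beta (\<mu> + n + 1/2) 1 = 1 / (\<mu> + n + 1/2)"
        by (simp add: Beta_def)
      then show ?thesis using mu wint_one[of "?\<alpha> + n" 0] by (simp add: algebra_simps)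
    qed
    also have "2 powr (\<mu> + 1/2 + n) = 2 powr (\<mu> + 1/2) * 2 ^ n"
      by (simp add: powr_add powr_realpow)
    finally have 2: "wint ?\<alpha> 0 (\<lambda>t. (1 - (1 + t) / 2) ^ n) = 2 powr (\<mu> + 1/2) / (\<mu> + n + 1/2)" by simp
    show ?thesis unfolding 1 2 by simp
  qed
  have "disk_integral \<mu> (\<lambda>z. poly p ((cmod z)\<^sup>2)) = (\<Sum>n\<le>degree q. coeff q n * disk_integral \<mu> (\<lambda>z. (1 - (cmod z)\<^sup>2) ^ n))"
    unfolding q disk_integral_cmult[symmetric] by (rule disk_integral_sum[OF mu]) (intro continuous_intros)
  also have "\<dots> = pi / 2 powr (\<mu> + 1/2) * (\<Sum>n\<le>degree q. coeff q n * wint ?\<alpha> 0 (\<lambda>t. (1 - (1 + t) / 2) ^ n))"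
    unfolding mom by (simp add: sum_distrib_left mult_ac)
  also have "(\<Sum>n\<le>degree q. coeff q n * wint ?\<alpha> 0 (\<lambda>t. (1 - (1 + t) / 2) ^ n)) = wint ?\<alpha> 0 (\<lambda>t. poly p ((1 + t) / 2))"
    unfolding q wint_cmult[symmetric]
    by (rule wint_sum[symmetric]) (use mu in \<open>auto intro!: continuous_intros\<close>)
  finally show ?thesis .
qed

section \<open>Disk polynomials and harmonic decomposition\<close>

definition jacobi_shift :: "real \<Rightarrow> nat \<Rightarrow> nat \<Rightarrow> real poly" where
  "jacobi_shift \<mu> j i = pcompose (jacobi_poly (\<mu> - 1/2) (real j) i) [:-1, 2:]"

text \<open>
  The homogenization of \<open>disk_P\<close>, which is the case \<open>s = 1\<close>.  With \<open>s = 1 - x\<^sub>3\<^sup>2\<close> it is the polynomial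
  \<open>(1 - x\<^sub>3\<^sup>2)\<^sup>k\<^sup>/\<^sup>2 P(x\<^sub>1 / (1 - x\<^sub>3\<^sup>2)\<^sup>1\<^sup>/\<^sup>2, x\<^sub>2 / (1 - x\<^sub>3\<^sup>2)\<^sup>1\<^sup>/\<^sup>2)\<close>.
\<close>

definition disk_hom :: "real \<Rightarrow> nat \<Rightarrow> nat \<Rightarrow> nat \<Rightarrow> real \<Rightarrow> complex \<Rightarrow> real" where
  "disk_hom \<mu> k i \<epsilon> s z = disk_h \<mu> i k *
     (\<Sum>m\<le>i. coeff (jacobi_shift \<mu> (k - 2 * i) i) m * cmod z ^ (2 * m) * s ^ (i - m)) * harm (k - 2 * i) \<epsilon> z"

lemma jacobi_shift_facts:
  assumes mu: "\<mu> \<ge> 0"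
  shows "degree (jacobi_shift \<mu> j i) = i" "jacobi_shift \<mu> j i \<noteq> 0" "poly (jacobi_shift \<mu> j i) ((1 + t) / 2) = poly (jacobi_poly (\<mu> - 1/2) (real j) i) t"
proof -
  have "\<mu> - 1/2 > -1" "real j > -1" "\<mu> - 1/2 + real j + 1 > 0" using mu by auto
  note J = jacobi_poly_facts(1,2)[OF this, of i]
  then show "degree (jacobi_shift \<mu> j i) = i" "jacobi_shift \<mu> j i \<noteq> 0"
    using J by (auto simp: jacobi_shift_def degree_pcompose pcompose_eq_0_iff)
  show "poly (jacobi_shift \<mu> j i) ((1 + t) / 2) = poly (jacobi_poly (\<mu> - 1/2) (real j) i) t"
    by (simp add: jacobi_shift_def poly_pcompose add_divide_distrib)
qed

lemma disk_hom_1: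
  assumes "\<mu> \<ge> 0"
  shows "disk_hom \<mu> k i \<epsilon> 1 z = disk_h \<mu> i k * poly (jacobi_shift \<mu> (k - 2 * i) i) ((cmod z)\<^sup>2) * harm (k - 2 * i) \<epsilon> z"
  using jacobi_shift_facts(1)[OF assms, of "k - 2 * i" i]
  by (simp add: disk_hom_def poly_altdef power_mult)

text \<open>Weight 1 for \<open>z\<close> and weight 2 for \<open>s\<close> give all terms the same
  degree. It is used with \<open>r = sqrt (1 - w\<^sup>2)\<close> to pass from a slice to the unit
  disk, and with \<open>r = -1\<close> for parity.\<close>

lemma disk_hom_scale:
  assumes "2 * i \<le> k"
  shows "disk_hom \<mu> k i \<epsilon> (r\<^sup>2 * s) (of_real r * z) = r ^ k * disk_hom \<mu> k i \<epsilon> s z"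
proof -
  have e: "cmod (of_real r * z) ^ (2 * m) * (r\<^sup>2 * s) ^ (i - m) = r ^ (2 * i) * (cmod z ^ (2 * m) * s ^ (i - m))"
    if "m \<le> i" for m
  proof -
    have "r ^ (2 * i) = r ^ (2 * m) * r ^ (2 * (i - m))" using that by (simp flip: power_add distrib_left)
    then show ?thesis by (simp add: norm_mult power_mult_distrib power_even_abs power_mult[symmetric])
  qed
  have "(\<Sum>m\<le>i. coeff (jacobi_shift \<mu> (k - 2 * i) i) m * cmod (of_real r * z) ^ (2 * m) * (r\<^sup>2 * s) ^ (i - m)) =
      r ^ (2 * i) * (\<Sum>m\<le>i. coeff (jacobi_shift \<mu> (k - 2 * i) i) m * cmod z ^ (2 * m) * s ^ (i - m))"
    unfolding sum_distrib_left by (rule sum.cong) (auto simp: mult.assoc e mult.left_commute[of "r ^ (2 * i)"])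
  moreover have "r ^ k = r ^ (2 * i) * r ^ (k - 2 * i)" using assms by (simp flip: power_add)
  ultimately show ?thesis by (simp only: disk_hom_def harm_scale) (simp only: mult_ac)
qed

lemma continuous_disk_hom [continuous_intros]:
  "continuous_on A f \<Longrightarrow> continuous_on A g \<Longrightarrow> continuous_on A (\<lambda>x. disk_hom \<mu> k i \<epsilon> (f x) (g x))"
  unfolding disk_hom_def by (intro continuous_intros)

text \<open>Harmonic decomposition: \<open>harm_span d\<close> contains all homogeneous polynomials of degree \<open>d\<close>.\<close>

inductive harm_span :: "nat \<Rightarrow> (complex \<Rightarrow> real) \<Rightarrow> bool" where
  base: "2 * i + j = d \<Longrightarrow> \<epsilon> < 2 \<Longrightarrow> harm_span d (\<lambda>z. c * (cmod z ^ (2 * i) * harm j \<epsilon> z))"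
| add: "harm_span d F \<Longrightarrow> harm_span d G \<Longrightarrow> harm_span d (\<lambda>z. F z + G z)"

lemma harm_span_continuous: "harm_span d F \<Longrightarrow> continuous_on A F"
  by (induction rule: harm_span.induct) (auto intro!: continuous_intros)

text \<open>Angular orthogonality removes all but the same harmonic, \<open>j' = k - 2 * i\<close>.
  Then \<open>2 * i' + j' < k\<close> forces \<open>i' < i\<close>, and the radial integral pairs a
  Jacobi polynomial of degree \<open>i\<close> with a polynomial of lower degree.\<close>

lemma disk_hom_orth_base:
  assumes mu: "\<mu> \<ge> 0" and k: "2 * i \<le> k" "\<epsilon> < 2" "\<epsilon>' < 2" and l: "2 * i' + j' < k"
  shows "disk_integral \<mu> (\<lambda>z. disk_hom \<mu> k i \<epsilon> 1 z * (cmod z ^ (2 * i') * harm j' \<epsilon>' z)) = 0"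
proof -
  let ?\<alpha> = "\<mu> - 1/2"
  define j where "j = k - 2 * i"
  let ?q = "jacobi_shift \<mu> j i"
  have "disk_integral \<mu> (\<lambda>z. disk_hom \<mu> k i \<epsilon> 1 z * (cmod z ^ (2 * i') * harm j' \<epsilon>' z)) =
     disk_integral \<mu> (\<lambda>z. \<Sum>m\<le>i. disk_h \<mu> i k * coeff ?q m * (cmod z ^ (2 * (m + i')) * (harm j \<epsilon> z * harm j' \<epsilon>' z)))"
    by (simp add: disk_hom_def j_def sum_distrib_left sum_distrib_right power_add mult_ac distrib_left)
  also have "\<dots> = (\<Sum>m\<le>i. disk_h \<mu> i k * coeff ?q m * disk_integral \<mu> (\<lambda>z. cmod z ^ (2 * (m + i')) * (harm j \<epsilon> z * harm j' \<epsilon>' z)))"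
    unfolding disk_integral_cmult[symmetric] by (rule disk_integral_sum[OF mu]) (intro continuous_intros)
  also have "\<dots> = 0"
  proof (cases "j = j' \<and> \<epsilon> = \<epsilon>'")
    case False
    then show ?thesis unfolding disk_integral_harm_orth[OF mu k(2,3)] by (simp only: if_False mult_zero_right sum.neutral_const)
  next
    case True
    then have i': "i' < i" using l k by (auto simp: j_def)
    have "(\<Sum>m\<le>i. disk_h \<mu> i k * coeff ?q m * disk_integral \<mu> (\<lambda>z. cmod z ^ (2 * (m + i')) * (harm j \<epsilon> z * harm j' \<epsilon>' z))) =
       disk_h \<mu> i k * harm_mean j \<epsilon> * (\<Sum>m\<le>i. coeff ?q m * disk_integral \<mu> (\<lambda>z. cmod z ^ (2 * (m + i' + j))))"
      unfolding disk_integral_harm_orth[OF mu k(2,3)] using True by (simp add: sum_distrib_left mult_ac)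
    also have "(\<Sum>m\<le>i. coeff ?q m * disk_integral \<mu> (\<lambda>z. cmod z ^ (2 * (m + i' + j)))) =
        disk_integral \<mu> (\<lambda>z. \<Sum>m\<le>i. coeff ?q m * cmod z ^ (2 * (m + i' + j)))"
      unfolding disk_integral_cmult[symmetric] by (rule disk_integral_sum[OF mu, symmetric]) (intro continuous_intros)
    also have "(\<lambda>z. \<Sum>m\<le>i. coeff ?q m * cmod z ^ (2 * (m + i' + j))) =
        (\<lambda>z. poly (?q * [:0, 1:] ^ (i' + j)) ((cmod z)\<^sup>2))"
    proof
      fix z
      have e: "cmod z ^ (2 * n) = ((cmod z)\<^sup>2) ^ n" for n by (rule power_mult)
      show "(\<Sum>m\<le>i. coeff ?q m * cmod z ^ (2 * (m + i' + j))) = poly (?q * [:0, 1:] ^ (i' + j)) ((cmod z)\<^sup>2)"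
        unfolding e poly_mult poly_power poly_altdef[of ?q] jacobi_shift_facts(1)[OF mu] sum_distrib_right
        by (simp only: power_add mult.assoc) simp
    qed
    also have "disk_integral \<mu> \<dots> = pi / 2 powr (\<mu> + 1/2) * wint ?\<alpha> 0 (\<lambda>t. poly (?q * [:0, 1:] ^ (i' + j)) ((1 + t) / 2))"
      by (rule disk_integral_radial[OF mu])
    \<comment> \<open>Of the \<open>i' + j\<close> factors \<open>(cmod z)\<^sup>2\<close>, the
      \<open>j\<close> that come from the two harmonics raise the second Jacobi parameter from 0 to
      \<open>j\<close>; the other \<open>i'\<close> form the test polynomial.\<close>
    also have "(\<lambda>t. poly (?q * [:0, 1:] ^ (i' + j)) ((1 + t) / 2)) =
        (\<lambda>t. 1 / 2 ^ (i' + j) * ((1 - t) ^ 0 * (1 + t) ^ j * poly (jacobi_poly ?\<alpha> (real j) i * [:1, 1:] ^ i') t))"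
      by (rule ext, simp only: poly_mult poly_power jacobi_shift_facts(3)[OF mu])
         (simp add: power_divide power_add mult_ac)
    also have "wint ?\<alpha> 0 \<dots> = 1 / 2 ^ (i' + j) * wpoly ?\<alpha> j (jacobi_poly ?\<alpha> (real j) i * [:1, 1:] ^ i')"
      unfolding wint_cmult wint_shift by (simp add: poly_ops)
    also have "wpoly ?\<alpha> j (jacobi_poly ?\<alpha> (real j) i * [:1, 1:] ^ i') = 0"
      by (rule jacobi_poly_facts(3)) (use mu i' in \<open>auto simp: degree_power_eq\<close>)
    finally show ?thesis by simp
  qed
  finally show ?thesis .
qed

lemma disk_hom_orth:
  assumes mu: "\<mu> \<ge> 0" and k: "2 * i \<le> k" "\<epsilon> < 2" and F: "harm_span d F" "d < k"
  shows "disk_integral \<mu> (\<lambda>z. disk_hom \<mu> k i \<epsilon> 1 z * F z) = 0"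
  using F
proof (induction rule: harm_span.induct)
  case (base i' j' d \<epsilon>' c)
  then have "c * disk_integral \<mu> (\<lambda>z. disk_hom \<mu> k i \<epsilon> 1 z * (cmod z ^ (2 * i') * harm j' \<epsilon>' z)) = 0"
    using disk_hom_orth_base[OF mu k, of \<epsilon>' i' j'] by auto
  then show ?case unfolding disk_integral_cmult[symmetric] by (simp add: mult_ac)
next
  case (add d F G)
  then have "disk_integral \<mu> (\<lambda>z. disk_hom \<mu> k i \<epsilon> 1 z * F z + disk_hom \<mu> k i \<epsilon> 1 z * G z) = 0"
    using harm_span_continuous[OF add.hyps(1)] harm_span_continuous[OF add.hyps(2)]
    by (subst disk_integral_add[OF mu]) (auto intro!: continuous_intros)
  then show ?case by (simp add: distrib_left)
qed

lemma harm_span_scale: "harm_span d F \<Longrightarrow> harm_span d (\<lambda>z. c * F z)"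
proof (induction rule: harm_span.induct)
  case (base i j d \<epsilon> c')
  then show ?case using harm_span.base[of i j d \<epsilon> "c * c'"] by (simp add: mult.assoc)
next
  case (add d F G)
  then show ?case using harm_span.add[of d "\<lambda>z. c * F z" "\<lambda>z. c * G z"] by (simp add: distrib_left)
qed

text \<open>From \<open>2 * Re z = z + cnj z\<close> and its analogue for \<open>Im z\<close>: one
  summand raises the frequency, the other lowers it and contributes
  \<open>(cmod z)\<^sup>2\<close>.\<close>

lemma harm_Re_Im_Suc:
  assumes "\<epsilon> < 2"
  shows "Re z * harm (Suc j) \<epsilon> z = (harm (Suc (Suc j)) \<epsilon> z + (cmod z)\<^sup>2 * harm j \<epsilon> z) / 2"
    and "Im z * harm (Suc j) 0 z = (harm (Suc (Suc j)) 1 z - (cmod z)\<^sup>2 * harm j 1 z) / 2"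
    and "Im z * harm (Suc j) 1 z = ((cmod z)\<^sup>2 * harm j 0 z - harm (Suc (Suc j)) 0 z) / 2"
proof -
  have "\<epsilon> = 0 \<or> \<epsilon> = 1" using assms by auto
  then show "Re z * harm (Suc j) \<epsilon> z = (harm (Suc (Suc j)) \<epsilon> z + (cmod z)\<^sup>2 * harm j \<epsilon> z) / 2"
    unfolding harm_def cmod_power2 by (elim disjE) (simp_all add: power2_eq_square algebra_simps)
  show "Im z * harm (Suc j) 0 z = (harm (Suc (Suc j)) 1 z - (cmod z)\<^sup>2 * harm j 1 z) / 2"
    "Im z * harm (Suc j) 1 z = ((cmod z)\<^sup>2 * harm j 0 z - harm (Suc (Suc j)) 0 z) / 2"
    unfolding harm_def cmod_power2 by (simp_all add: power2_eq_square algebra_simps)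
qed

lemma harm_span_zero: "harm_span d (\<lambda>z. 0)"
  using harm_span.base[of 0 d d 0 0] by simp

lemma harm_span_lincomb:
  assumes "harm_span d F" "harm_span d G" shows "harm_span d (\<lambda>z. a * F z + b * G z)"
  by (intro harm_span.add harm_span_scale assms)

lemma harm_span_base1: "2 * i + j = d \<Longrightarrow> \<epsilon> < 2 \<Longrightarrow> harm_span d (\<lambda>z. cmod z ^ (2 * i) * harm j \<epsilon> z)"
  using harm_span.base[of i j d \<epsilon> 1] by simp

lemma harm_span_Re: "harm_span d F \<Longrightarrow> harm_span (Suc d) (\<lambda>z. Re z * F z)"
proof (induction rule: harm_span.induct)
  case (base i j d \<epsilon> c)
  show ?case
  proof (cases j)
    case 0
    show ?thesis
    proof (cases "\<epsilon> = 0")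
      case True
      then have "(\<lambda>z. Re z * (c * (cmod z ^ (2 * i) * harm j \<epsilon> z))) = (\<lambda>z. c * (cmod z ^ (2 * i) * harm 1 0 z))"
        using 0 by (auto simp: harm_def)
      then show ?thesis using harm_span.base[of i 1 "Suc d" 0 c] base 0 by simp
    next
      case False
      then show ?thesis using 0 harm_span_zero by simp
    qed
  next
    case (Suc j')
    have "(\<lambda>z. Re z * (c * (cmod z ^ (2 * i) * harm j \<epsilon> z))) = (\<lambda>z. c / 2 * (cmod z ^ (2 * i) * harm (Suc j) \<epsilon> z) +
        c / 2 * (cmod z ^ (2 * (i + 1)) * harm j' \<epsilon> z))"
    proof
      fix z
      have "Re z * (c * (cmod z ^ (2 * i) * harm j \<epsilon> z)) = c * (cmod z ^ (2 * i) * (Re z * harm (Suc j') \<epsilon> z))"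
        by (simp add: Suc mult_ac)
      then show "Re z * (c * (cmod z ^ (2 * i) * harm j \<epsilon> z)) = c / 2 * (cmod z ^ (2 * i) * harm (Suc j) \<epsilon> z) +
        c / 2 * (cmod z ^ (2 * (i + 1)) * harm j' \<epsilon> z)"
        unfolding harm_Re_Im_Suc(1)[OF base(2)] by (simp add: Suc power2_eq_square algebra_simps)
    qed
    moreover have "harm_span (Suc d) (\<lambda>z. c / 2 * (cmod z ^ (2 * i) * harm (Suc j) \<epsilon> z) +
        c / 2 * (cmod z ^ (2 * (i + 1)) * harm j' \<epsilon> z))"
      by (intro harm_span_lincomb harm_span_base1) (use base Suc in auto)
    ultimately show ?thesis by simp
  qed
next
  case (add d F G)
  then show ?case using harm_span.add[of "Suc d" "\<lambda>z. Re z * F z" "\<lambda>z. Re z * G z"] by (simp add: distrib_left)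
qed

lemma harm_span_Im: "harm_span d F \<Longrightarrow> harm_span (Suc d) (\<lambda>z. Im z * F z)"
proof (induction rule: harm_span.induct)
  case (base i j d \<epsilon> c)
  then have e: "\<epsilon> = 0 \<or> \<epsilon> = 1" by auto
  show ?case
  proof (cases j)
    case 0
    show ?thesis
    proof (cases "\<epsilon> = 0")
      case True
      then have "(\<lambda>z. Im z * (c * (cmod z ^ (2 * i) * harm j \<epsilon> z))) = (\<lambda>z. c * (cmod z ^ (2 * i) * harm 1 1 z))"
        using 0 by (auto simp: harm_def)
      then show ?thesis using harm_span.base[of i 1 "Suc d" 1 c] base 0 by simp
    next
      case False
      then show ?thesis using 0 harm_span_zero by simp
    qed
  next
    case (Suc j')
    define s where "s = (if \<epsilon> = 0 then c / 2 else - c / 2)"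
    have "(\<lambda>z. Im z * (c * (cmod z ^ (2 * i) * harm j \<epsilon> z))) = (\<lambda>z. s * (cmod z ^ (2 * i) * harm (Suc j) (1 - \<epsilon>) z) +
        (- s) * (cmod z ^ (2 * (i + 1)) * harm j' (1 - \<epsilon>) z))"
    proof
      fix z
      have "Im z * (c * (cmod z ^ (2 * i) * harm j \<epsilon> z)) = c * (cmod z ^ (2 * i) * (Im z * harm (Suc j') \<epsilon> z))"
        by (simp add: Suc mult_ac)
      also have "Im z * harm (Suc j') \<epsilon> z = (if \<epsilon> = 0 then 1 else -1) * (harm (Suc (Suc j')) (1 - \<epsilon>) z - (cmod z)\<^sup>2 * harm j' (1 - \<epsilon>) z) / 2"
        using e harm_Re_Im_Suc(2,3)[of 0 z j'] by (elim disjE) auto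
      finally show "Im z * (c * (cmod z ^ (2 * i) * harm j \<epsilon> z)) = s * (cmod z ^ (2 * i) * harm (Suc j) (1 - \<epsilon>) z) +
        (- s) * (cmod z ^ (2 * (i + 1)) * harm j' (1 - \<epsilon>) z)"
        using e by (elim disjE) (simp_all add: s_def Suc power2_eq_square algebra_simps)
    qed
    moreover have "harm_span (Suc d) (\<lambda>z. s * (cmod z ^ (2 * i) * harm (Suc j) (1 - \<epsilon>) z) +
        (- s) * (cmod z ^ (2 * (i + 1)) * harm j' (1 - \<epsilon>) z))"
      by (intro harm_span_lincomb harm_span_base1) (use base Suc in auto)
    ultimately show ?thesis by simp
  qed
next
  case (add d F G)
  then show ?case using harm_span.add[of "Suc d" "\<lambda>z. Im z * F z" "\<lambda>z. Im z * G z"] by (simp add: distrib_left)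
qed

lemma harm_span_monomial: "harm_span (a + b) (\<lambda>z. Re z ^ a * Im z ^ b)"
proof (induction a)
  case 0
  show ?case
  proof (induction b)
    case 0
    then show ?case using harm_span.base[of 0 0 0 0 1] by (simp add: harm_def)
  next
    case (Suc b)
    from harm_span_Im[OF this] show ?case by simp
  qed
next
  case (Suc a)
  from harm_span_Re[OF this] show ?case by (simp add: mult.assoc)
qed

section \<open>Polynomials in the plane and their chord integrals\<close>

text \<open>Generated by monomials and sums, so that linear statements reduce to monomials by
  induction. Its index bounds the degree, whereas that of \<open>harm_span\<close> is the degree of
  homogeneity.\<close>

inductive planar_poly :: "nat \<Rightarrow> (complex \<Rightarrow> real) \<Rightarrow> bool" where
  mono: "a + b \<le> d \<Longrightarrow> planar_poly d (\<lambda>z. c * (Re z ^ a * Im z ^ b))"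
| add: "planar_poly d F \<Longrightarrow> planar_poly d G \<Longrightarrow> planar_poly d (\<lambda>z. F z + G z)"

lemma planar_poly_le: "planar_poly d F \<Longrightarrow> d \<le> e \<Longrightarrow> planar_poly e F"
  by (induction rule: planar_poly.induct) (auto intro: planar_poly.intros)

lemma planar_poly_mult_mono: "planar_poly d F \<Longrightarrow> a + b \<le> e \<Longrightarrow> planar_poly (d + e) (\<lambda>z. c * (Re z ^ a * Im z ^ b) * F z)"
proof (induction rule: planar_poly.induct)
  case (mono a' b' d c')
  then have "planar_poly (d + e) (\<lambda>z. (c * c') * (Re z ^ (a + a') * Im z ^ (b + b')))" by (intro planar_poly.mono) auto
  then show ?case by (simp add: power_add mult_ac)
next
  case (add d F G)
  then have "planar_poly (d + e) (\<lambda>z. c * (Re z ^ a * Im z ^ b) * F z + c * (Re z ^ a * Im z ^ b) * G z)" by (intro planar_poly.add) auto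
  then show ?case by (simp add: distrib_left)
qed

lemma planar_poly_mult: "planar_poly e G \<Longrightarrow> planar_poly d F \<Longrightarrow> planar_poly (d + e) (\<lambda>z. G z * F z)"
proof (induction rule: planar_poly.induct)
  case (mono a b e c)
  then show ?case by (intro planar_poly_mult_mono)
next
  case (add e G H)
  then have "planar_poly (d + e) (\<lambda>z. G z * F z + H z * F z)" by (intro planar_poly.add) auto
  then show ?case by (simp add: distrib_right)
qed

lemma planar_poly_const: "planar_poly d (\<lambda>z. c)"
  using planar_poly.mono[of 0 0 d c] by simp

lemma planar_poly_scale: "planar_poly d F \<Longrightarrow> planar_poly d (\<lambda>z. c * F z)"
  using planar_poly_mult[OF planar_poly_const[of 0 c], of d F] by simp

lemma planar_poly_Re: "planar_poly 1 Re" and planar_poly_Im: "planar_poly 1 Im"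
  using planar_poly.mono[of 1 0 1 1] planar_poly.mono[of 0 1 1 1] by simp_all

lemma planar_poly_sum: "(\<And>i. i \<in> A \<Longrightarrow> planar_poly d (F i)) \<Longrightarrow> planar_poly d (\<lambda>z. \<Sum>i\<in>A. F i z)"
  by (induction A rule: infinite_finite_induct) (auto intro: planar_poly.add planar_poly_const)

lemma planar_poly_power: "planar_poly d F \<Longrightarrow> planar_poly (d * n) (\<lambda>z. F z ^ n)"
proof (induction n)
  case 0
  then show ?case using planar_poly_const by simp
next
  case (Suc n)
  then show ?case using planar_poly_mult[of d F "d * n" "\<lambda>z. F z ^ n"] by (simp add: add.commute)
qed

lemma planar_poly_harm: "\<epsilon> < 2 \<Longrightarrow> planar_poly j (harm j \<epsilon>)"
proof (induction j arbitrary: \<epsilon>)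
  case 0
  have "harm 0 \<epsilon> = (\<lambda>z. if \<epsilon> = 0 then 1 else 0)" by (auto simp: harm_def)
  then show ?case using planar_poly_const[of 0 "if \<epsilon> = 0 then 1 else 0"] by simp
next
  case (Suc j)
  have c: "planar_poly (j + 1) (\<lambda>z. Re z * harm j e z)" "planar_poly (j + 1) (\<lambda>z. Im z * harm j e z)" if "e < 2" for e
    using planar_poly_mult[OF planar_poly_Re Suc.IH[OF that]] planar_poly_mult[OF planar_poly_Im Suc.IH[OF that]] by auto
  show ?case
  proof (cases "\<epsilon> = 0")
    case True
    have "harm (Suc j) \<epsilon> = (\<lambda>z. Re z * harm j 0 z + - 1 * (Im z * harm j 1 z))"
      using True by (auto simp: harm_def)
    moreover have "planar_poly (j + 1) (\<lambda>z. Re z * harm j 0 z + - 1 * (Im z * harm j 1 z))"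
      by (intro planar_poly.add planar_poly_scale c) auto
    ultimately show ?thesis by simp
  next
    case False
    have "harm (Suc j) \<epsilon> = (\<lambda>z. Re z * harm j 1 z + Im z * harm j 0 z)"
      using False by (auto simp: harm_def)
    moreover have "planar_poly (j + 1) (\<lambda>z. Re z * harm j 1 z + Im z * harm j 0 z)"
      by (intro planar_poly.add c) auto
    ultimately show ?thesis by simp
  qed
qed

lemma planar_poly_cmod_sq: "planar_poly 2 (\<lambda>z. (cmod z)\<^sup>2)"
proof -
  have "planar_poly 2 (\<lambda>z. 1 * (Re z ^ 2 * Im z ^ 0) + 1 * (Re z ^ 0 * Im z ^ 2))"
    by (intro planar_poly.add planar_poly.mono) auto
  then show ?thesis by (simp add: cmod_power2)
qed

lemma planar_poly_disk_hom:
  assumes k: "2 * i \<le> k" "\<epsilon> < 2"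
  shows "planar_poly k (disk_hom \<mu> k i \<epsilon> 1)"
proof -
  have "planar_poly (2 * i) (\<lambda>z. \<Sum>m\<le>i. coeff (jacobi_shift \<mu> (k - 2 * i) i) m * ((cmod z)\<^sup>2) ^ m)"
    by (intro planar_poly_sum planar_poly_scale) (auto intro: planar_poly_le[OF planar_poly_power[OF planar_poly_cmod_sq]])
  from planar_poly_mult[OF this planar_poly_harm[OF k(2), of "k - 2 * i"]]
  have "planar_poly k (\<lambda>z. (\<Sum>m\<le>i. coeff (jacobi_shift \<mu> (k - 2 * i) i) m * ((cmod z)\<^sup>2) ^ m) * harm (k - 2 * i) \<epsilon> z)"
    using k by simp
  from planar_poly_scale[OF this, of "disk_h \<mu> i k"] show ?thesis
    by (simp add: disk_hom_def[abs_def] power_mult mult.assoc)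
qed

lemma wint_odd:
  assumes "odd b"
  shows "wint a a (\<lambda>s. s ^ b) = 0"
proof -
  have "wint a a (\<lambda>s. s ^ b) = wint a a (\<lambda>s. (- s) ^ b)" by (rule wint_reflect[symmetric])
  also have "\<dots> = wint a a (\<lambda>s. - 1 * s ^ b)" using assms by simp
  also have "\<dots> = - 1 * wint a a (\<lambda>s. s ^ b)" by (rule wint_cmult)
  finally show ?thesis by simp
qed

definition chord_integral :: "real \<Rightarrow> (complex \<Rightarrow> real) \<Rightarrow> real \<Rightarrow> real" where
  "chord_integral \<mu> F t = wint (\<mu> - 1/2) (\<mu> - 1/2) (\<lambda>\<sigma>. F (Complex t (sqrt (1 - t\<^sup>2) * \<sigma>)))"

lemma planar_poly_continuous: "planar_poly d F \<Longrightarrow> continuous_on A F"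
  by (induction rule: planar_poly.induct) (auto intro!: continuous_intros)

text \<open>Odd powers of \<open>Im z\<close> integrate to 0 by symmetry of the weight, and even
  ones contribute integral powers of \<open>1 - t\<^sup>2\<close>. So the square root disappears and
  the degree does not grow.\<close>

lemma inner_integral_poly:
  assumes mu: "\<mu> \<ge> 0" and F: "planar_poly d F"
  shows "\<exists>A. degree A \<le> d \<and> (\<forall>t\<in>{-1..1}. chord_integral \<mu> F t = poly A t)"
  using F
proof (induction rule: planar_poly.induct)
  case (mono a b d c)
  have e: "chord_integral \<mu> (\<lambda>z. c * (Re z ^ a * Im z ^ b)) t =
      c * (t ^ a * sqrt (1 - t\<^sup>2) ^ b * wint (\<mu> - 1/2) (\<mu> - 1/2) (\<lambda>s. s ^ b))" for t
    unfolding chord_integral_def wint_cmult[symmetric] by (simp add: power_mult_distrib mult_ac)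
  show ?case
  proof (cases "even b")
    case False
    then have "chord_integral \<mu> (\<lambda>z. c * (Re z ^ a * Im z ^ b)) t = poly 0 t" for t
      unfolding e wint_odd[OF False] by simp
    then show ?thesis by (intro exI[of _ 0]) simp
  next
    case True
    then obtain b' where b: "b = 2 * b'" by auto
    let ?W = "wint (\<mu> - 1/2) (\<mu> - 1/2) (\<lambda>s. s ^ b)"
    let ?A = "smult (c * ?W) ([:0, 1:] ^ a * [:1, 0, -1:] ^ b')"
    have "degree ?A \<le> a + 2 * b'"
      by (intro order_trans[OF degree_smult_le] order_trans[OF degree_mult_le] add_mono
          order_trans[OF degree_power_le]) auto
    moreover have "chord_integral \<mu> (\<lambda>z. c * (Re z ^ a * Im z ^ b)) t = poly ?A t" if "t \<in> {-1..1}" for t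
    proof -
      have "(sqrt (1 - t\<^sup>2))\<^sup>2 = 1 - t\<^sup>2" using that by (auto simp: abs_square_le_1 abs_le_iff)
      then have "sqrt (1 - t\<^sup>2) ^ b = (1 - t\<^sup>2) ^ b'" by (simp add: b power_mult)
      then show ?thesis unfolding e by (simp add: poly_power power2_eq_square mult_ac)
    qed
    ultimately show ?thesis using mono b by (intro exI[of _ ?A]) auto
  qed
next
  case (add d F G)
  then obtain A B where AB: "degree A \<le> d" "\<forall>t\<in>{-1..1}. chord_integral \<mu> F t = poly A t"
    "degree B \<le> d" "\<forall>t\<in>{-1..1}. chord_integral \<mu> G t = poly B t" by blast
  have "chord_integral \<mu> (\<lambda>z. F z + G z) t = chord_integral \<mu> F t + chord_integral \<mu> G t" for t
    unfolding chord_integral_def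
    by (rule wint_add) (use mu in \<open>auto intro!: disk_integral_inner_continuous(1)[OF mu planar_poly_continuous] add.hyps\<close>)
  then show ?case using AB by (intro exI[of _ "A + B"]) (auto intro: degree_add_le)
qed

lemma disk_hom_orth_planar_poly:
  assumes mu: "\<mu> \<ge> 0" and k: "2 * i \<le> k" "\<epsilon> < 2" and F: "planar_poly d F" "d < k"
  shows "disk_integral \<mu> (\<lambda>z. disk_hom \<mu> k i \<epsilon> 1 z * F z) = 0"
  using F
proof (induction rule: planar_poly.induct)
  case (mono a b d c)
  have "disk_integral \<mu> (\<lambda>z. disk_hom \<mu> k i \<epsilon> 1 z * (c * (Re z ^ a * Im z ^ b))) = 0"
    by (rule disk_hom_orth[OF mu k harm_span_scale[OF harm_span_monomial]]) (use mono in auto)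
  then show ?case .
next
  case (add d F G)
  then have "disk_integral \<mu> (\<lambda>z. disk_hom \<mu> k i \<epsilon> 1 z * F z + disk_hom \<mu> k i \<epsilon> 1 z * G z) = 0"
    using planar_poly_continuous[OF add.hyps(1)] planar_poly_continuous[OF add.hyps(2)]
    by (subst disk_integral_add[OF mu]) (auto intro!: continuous_intros)
  then show ?case by (simp add: distrib_left)
qed

text \<open>The addition theorem for \<open>cos\<close> and \<open>sin\<close>. It expresses a
  rotated disk polynomial by the two unrotated ones with the same \<open>k\<close> and
  \<open>i\<close>, so degree and orthogonality survive rotation.\<close>

lemma harm_rotate:
  "\<epsilon> < 2 \<Longrightarrow> harm j \<epsilon> (cis \<theta> * z) = harm j \<epsilon> (cis \<theta>) * harm j 0 z + harm j (1 - \<epsilon>) (cis \<theta>) * (if \<epsilon> = 0 then - harm j 1 z else harm j 1 z)"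
  by (auto simp: harm_def power_mult_distrib)

lemma disk_hom_rotate:
  assumes "\<epsilon> < 2"
  shows "disk_hom \<mu> k i \<epsilon> s (cis \<theta> * z) = harm (k - 2 * i) \<epsilon> (cis \<theta>) * disk_hom \<mu> k i 0 s z +
    (if \<epsilon> = 0 then - 1 else 1) * harm (k - 2 * i) (1 - \<epsilon>) (cis \<theta>) * disk_hom \<mu> k i 1 s z"
  unfolding disk_hom_def harm_rotate[OF assms] by (simp add: norm_mult algebra_simps)

lemma planar_poly_disk_hom_rotate:
  assumes k: "2 * i \<le> k" "\<epsilon> < 2"
  shows "planar_poly k (\<lambda>z. disk_hom \<mu> k i \<epsilon> 1 (cis \<theta> * z))"
  unfolding disk_hom_rotate[OF k(2)] by (intro planar_poly.add planar_poly_scale planar_poly_disk_hom k) auto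

lemma disk_hom_rotate_orth_planar_poly:
  assumes mu: "\<mu> \<ge> 0" and k: "2 * i \<le> k" "\<epsilon> < 2" and F: "planar_poly d F" "d < k"
  shows "disk_integral \<mu> (\<lambda>z. disk_hom \<mu> k i \<epsilon> 1 (cis \<theta> * z) * F z) = 0"
proof -
  have c: "continuous_on UNIV (\<lambda>z. a * (disk_hom \<mu> k i e 1 z * F z))" for a e
    by (intro continuous_intros planar_poly_continuous[OF F(1)])
  have "disk_integral \<mu> (\<lambda>z. disk_hom \<mu> k i \<epsilon> 1 (cis \<theta> * z) * F z) =
     disk_integral \<mu> (\<lambda>z. harm (k - 2 * i) \<epsilon> (cis \<theta>) * (disk_hom \<mu> k i 0 1 z * F z) +
    ((if \<epsilon> = 0 then - 1 else 1) * harm (k - 2 * i) (1 - \<epsilon>) (cis \<theta>)) * (disk_hom \<mu> k i 1 1 z * F z))"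
    unfolding disk_hom_rotate[OF k(2)] by (simp only: distrib_right mult.assoc)
  also have "\<dots> = 0"
    unfolding disk_integral_add[OF mu c c] disk_integral_cmult using disk_hom_orth_planar_poly[OF mu k(1) _ F] by simp
  finally show ?thesis .
qed

lemma wpoly_zero: "wpoly a b 0 = 0"
  using wpoly_smult[of a b 0 0] by simp

text \<open>The rotation is put on the disk polynomial, so that the ridge factor depends on
  \<open>Re z\<close> alone and leaves the chord integral. The squared norm of the Gegenbauer
  polynomial over its value at 1 is \<open>(\<mu> + 1/2) / (real k + \<mu> + 1/2)\<close> times a
  mass, and the two masses multiply to \<open>pi / (\<mu> + 1/2)\<close>.\<close>

lemma disk_hom_ridge:
  assumes mu: "\<mu> \<ge> 0" and k: "2 * i \<le> k" "\<epsilon> < 2"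
  shows "disk_integral \<mu> (\<lambda>z. disk_hom \<mu> k i \<epsilon> 1 (cis \<theta> * z) * gegenbauer k' (\<mu> + 1/2) (Re z)) =
    (if k = k' then pi / (real k + \<mu> + 1/2) * disk_hom \<mu> k i \<epsilon> 1 (cis \<theta>) else 0)"
proof -
  let ?F = "\<lambda>z. disk_hom \<mu> k i \<epsilon> 1 (cis \<theta> * z)"
  let ?lam = "\<mu> + 1/2"
  have lam: "?lam > 0" "\<mu> > -1" and l: "?lam - 1/2 = \<mu>" using mu by auto
  note C = gegenbauer_poly_facts[OF lam(1), unfolded l]
  obtain A where A: "degree A \<le> k" "\<And>t. t \<in> {-1..1} \<Longrightarrow> chord_integral \<mu> ?F t = poly A t"
    using inner_integral_poly[OF mu planar_poly_disk_hom_rotate[OF k]] by blast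
  have red: "disk_integral \<mu> (\<lambda>z. ?F z * poly q (Re z)) = wpoly \<mu> \<mu> (A * q)" for q
    unfolding disk_integral_def poly_ops
  proof (rule wint_cong)
    fix t :: real assume "t \<in> {-1..1}"
    then have "chord_integral \<mu> ?F t * poly q t = poly A t * poly q t" by (simp only: A(2))
    then show "wint (\<mu> - 1/2) (\<mu> - 1/2) (\<lambda>\<sigma>. ?F (Complex t (sqrt (1 - t\<^sup>2) * \<sigma>)) *
        poly q (Re (Complex t (sqrt (1 - t\<^sup>2) * \<sigma>)))) = poly A t * poly q t"
      unfolding chord_integral_def complex.sel wint_cmult_right .
  qed
  have A1: "poly A 1 = disk_hom \<mu> k i \<epsilon> 1 (cis \<theta>) * wint (\<mu> - 1/2) (\<mu> - 1/2) (\<lambda>_. 1)"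
  proof -
    have "poly A 1 = wint (\<mu> - 1/2) (\<mu> - 1/2) (\<lambda>_. disk_hom \<mu> k i \<epsilon> 1 (cis \<theta>) * 1)"
      unfolding A(2)[of 1, simplified, symmetric] chord_integral_def by (simp add: Complex_eq)
    then show ?thesis by (simp only: wint_cmult)
  qed
  have orth: "wpoly \<mu> \<mu> (A * q) = 0" if q: "q = 0 \<or> degree q < k" for q
  proof (cases "q = 0")
    case False
    then have d: "degree q < k" using q by auto
    have "planar_poly (degree q) (\<lambda>z. poly q (Re z))"
      unfolding poly_altdef by (intro planar_poly_sum planar_poly_scale) (auto intro: planar_poly_le[OF planar_poly_power[OF planar_poly_Re]])
    from disk_hom_rotate_orth_planar_poly[OF mu k this d, of \<theta>] show ?thesis unfolding red .
  qed (simp add: wpoly_zero)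
  let ?C = "gegenbauer_poly ?lam"
  define c where "c = coeff A k / lead_coeff (?C k)"
  \<comment> \<open>A priori \<open>A\<close> may have degree below \<open>k\<close> or be 0, where
    \<open>orth_unique_scaling\<close> does not apply; \<open>c = 0\<close> is allowed here. The
    remainder is again orthogonal to itself.\<close>
  have Ac: "A = smult c (?C k)"
  proof -
    define r where "r = A - smult c (?C k)"
    have "degree r \<le> k" unfolding r_def
      by (rule order_trans[OF degree_diff_le_max]) (use A C(1) in \<open>auto simp: degree_smult_le\<close>)
    moreover have "coeff r k = 0"
      using C(1)[of k] C(2)[of k] by (simp add: r_def c_def) (metis leading_coeff_0_iff)
    ultimately have r: "r = 0 \<or> degree r < k"
      by (metis leading_coeff_0_iff le_neq_implies_less)
    have "r * r = A * r - smult c (?C k * r)" by (subst (1) r_def) (simp add: left_diff_distrib)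
    then have "wpoly \<mu> \<mu> (r * r) = 0"
      using orth[OF r] C(3)[OF r] lam by (simp only: wpoly_diff wpoly_smult)
    then have "r = 0" using wpoly_sq_eq_0[OF lam(2) lam(2)] by blast
    then show ?thesis by (simp add: r_def)
  qed
  have C1: "poly (?C k) 1 \<noteq> 0"
    unfolding C(4) using lam by (intro less_imp_neq[symmetric] divide_pos_pos pochhammer_pos) auto
  have g: "gegenbauer k' ?lam s = poly (?C k') s" for s by (simp add: gegenbauer_def)
  show ?thesis
  proof (cases "k = k'")
    case False
    have "wpoly \<mu> \<mu> (?C k * ?C k') = 0"
    proof (cases "k' < k")
      case True
      then show ?thesis using C(3)[of "?C k'" k] C(1) by auto
    next
      case False
      then show ?thesis using C(3)[of "?C k" k'] C(1) \<open>k \<noteq> k'\<close> by (auto simp: mult.commute)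
    qed
    then show ?thesis unfolding g red Ac mult_smult_left wpoly_smult using False by simp
  next
    case True
    have "poly A 1 = c * poly (?C k) 1" by (simp add: Ac)
    then have c: "c = disk_hom \<mu> k i \<epsilon> 1 (cis \<theta>) * wint (\<mu> - 1/2) (\<mu> - 1/2) (\<lambda>_. 1) / poly (?C k) 1"
      using C1 by (simp only: A1) simp
    have p: "pochhammer (2 * ?lam) k > 0" using lam by (intro pochhammer_pos) auto
    have "wpoly \<mu> \<mu> (A * ?C k') = c * (?lam * pochhammer (2 * ?lam) k / ((real k + ?lam) * fact k) * wint \<mu> \<mu> (\<lambda>_. 1))"
      unfolding Ac mult_smult_left wpoly_smult True[symmetric] C(5) ..
    also have "\<dots> = disk_hom \<mu> k i \<epsilon> 1 (cis \<theta>) * (?lam / (real k + ?lam)) *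
        (wint \<mu> \<mu> (\<lambda>_. 1) * wint (\<mu> - 1/2) (\<mu> - 1/2) (\<lambda>_. 1))"
      unfolding c C(4)
    proof -
      fix X Y Z P F K L :: real
      show "X * Y / (pochhammer (2 * ?lam) k / fact k) * (?lam * pochhammer (2 * ?lam) k / ((real k + ?lam) * fact k) * Z) =
         X * (?lam / (real k + ?lam)) * (Z * Y)"
      proof -
        have "x * y / (P / F) * (L * P / (K * F) * Z) = x * (L / K) * (Z * y)" if "P \<noteq> 0" "F \<noteq> 0"
          for x y P F K L :: real using that by simp
        from this[of "pochhammer (2 * ?lam) k" "fact k"] p show ?thesis by simp
      qed
    qed
    also have "\<dots> = disk_hom \<mu> k i \<epsilon> 1 (cis \<theta>) * (?lam / (real k + ?lam)) * (pi / ?lam)"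
      using wint_same_product[of \<mu>] mu by (simp only:)
    also have "\<dots> = pi / (real k + \<mu> + 1/2) * disk_hom \<mu> k i \<epsilon> 1 (cis \<theta>)"
      using lam by (simp add: add_ac)
    finally show ?thesis unfolding g red using True by simp
  qed
qed

section \<open>Orthogonal projection in the ball\<close>

abbreviation exponents :: "nat \<Rightarrow> ('n::finite \<Rightarrow> nat) set" where
  "exponents N \<equiv> {e. (\<Sum>i\<in>UNIV. e i) \<le> N}"

definition mono_fun :: "('n::finite \<Rightarrow> nat) \<Rightarrow> real^'n \<Rightarrow> real" where
  "mono_fun e x = (\<Prod>i\<in>UNIV. (x $ i) ^ e i)"

lemma finite_exponents: "finite (exponents N :: ('n::finite \<Rightarrow> nat) set)"
proof (rule finite_subset)
  show "(exponents N :: ('n \<Rightarrow> nat) set) \<subseteq> PiE UNIV (\<lambda>_. {..N})"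
  proof
    fix e :: "'n \<Rightarrow> nat" assume e: "e \<in> exponents N"
    have "e i \<le> N" for i
      using member_le_sum[of i UNIV e] e by simp
    then show "e \<in> PiE UNIV (\<lambda>_. {..N})" by (auto simp: PiE_def)
  qed
  show "finite (PiE (UNIV :: 'n set) (\<lambda>_. {..N}))" by (intro finite_PiE) auto
qed

lemma polys_le_iff: "p \<in> polys_le N \<longleftrightarrow> (\<exists>c. p = (\<lambda>x. \<Sum>e\<in>exponents N. c e * mono_fun e x))"
  unfolding polys_le_def mono_fun_def mem_Collect_eq ..

lemma polys_le_add: "p \<in> polys_le N \<Longrightarrow> q \<in> polys_le N \<Longrightarrow> (\<lambda>x. p x + q x) \<in> polys_le N"
  unfolding polys_le_iff
proof (elim exE)
  fix c d assume "p = (\<lambda>x. \<Sum>e\<in>exponents N. c e * mono_fun e x)" "q = (\<lambda>x. \<Sum>e\<in>exponents N. d e * mono_fun e x)"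
  then have "(\<lambda>x. p x + q x) = (\<lambda>x. \<Sum>e\<in>exponents N. (c e + d e) * mono_fun e x)"
    by (simp add: distrib_right sum.distrib)
  then show "\<exists>c. (\<lambda>x. p x + q x) = (\<lambda>x. \<Sum>e\<in>exponents N. c e * mono_fun e x)"
    by (intro exI[of _ "\<lambda>e. c e + d e"])
qed

lemma polys_le_scale: "p \<in> polys_le N \<Longrightarrow> (\<lambda>x. c * p x) \<in> polys_le N"
  unfolding polys_le_iff
proof (elim exE)
  fix d assume "p = (\<lambda>x. \<Sum>e\<in>exponents N. d e * mono_fun e x)"
  then have "(\<lambda>x. c * p x) = (\<lambda>x. \<Sum>e\<in>exponents N. (c * d e) * mono_fun e x)"
    by (simp add: sum_distrib_left mult.assoc)
  then show "\<exists>d. (\<lambda>x. c * p x) = (\<lambda>x. \<Sum>e\<in>exponents N. d e * mono_fun e x)"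
    by (intro exI[of _ "\<lambda>e. c * d e"])
qed

lemma polys_le_diff: "p \<in> polys_le N \<Longrightarrow> q \<in> polys_le N \<Longrightarrow> (\<lambda>x. p x - q x) \<in> polys_le N"
  using polys_le_add[of p N "\<lambda>x. (-1) * q x"] polys_le_scale[of q N "-1"] by simp

lemma polys_le_mono_fun: "e \<in> exponents N \<Longrightarrow> mono_fun e \<in> polys_le N"
  unfolding polys_le_iff
proof (intro exI[of _ "\<lambda>e'. if e' = e then 1 else 0"] ext)
  fix x :: "real^'a" assume e: "e \<in> exponents N"
  have "(\<Sum>e'\<in>exponents N. (if e' = e then 1 else 0) * mono_fun e' x) = (\<Sum>e'\<in>exponents N. if e' = e then mono_fun e' x else 0)"
    by (rule sum.cong) auto
  also have "\<dots> = mono_fun e x" using e finite_exponents[of N] by (subst sum.delta) auto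
  finally show "mono_fun e x = (\<Sum>e'\<in>exponents N. (if e' = e then 1 else 0) * mono_fun e' x)" by simp
qed

lemma polys_le_zero: "(\<lambda>x. 0) \<in> polys_le N"
  unfolding polys_le_iff by (intro exI[of _ "\<lambda>_. 0"]) simp

lemma polys_le_sum: "(\<And>i. i \<in> A \<Longrightarrow> p i \<in> polys_le N) \<Longrightarrow> (\<lambda>x. \<Sum>i\<in>A. p i x) \<in> polys_le N"
  by (induction A rule: infinite_finite_induct) (auto intro: polys_le_zero polys_le_add)

lemma polys_le_mono: "p \<in> polys_le N \<Longrightarrow> N \<le> M \<Longrightarrow> p \<in> polys_le M"
proof -
  assume "p \<in> polys_le N" "N \<le> M"
  then obtain c where p: "p = (\<lambda>x. \<Sum>e\<in>exponents N. c e * mono_fun e x)" unfolding polys_le_iff by blast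
  show ?thesis unfolding p
    by (intro polys_le_sum polys_le_scale polys_le_mono_fun) (use \<open>N \<le> M\<close> in auto)
qed

lemma mono_fun_mult: "mono_fun e x * mono_fun e' x = mono_fun (\<lambda>i. e i + e' i) x"
  by (simp add: mono_fun_def power_add prod.distrib)

lemma polys_le_mult: "p \<in> polys_le N \<Longrightarrow> q \<in> polys_le M \<Longrightarrow> (\<lambda>x. p x * q x) \<in> polys_le (N + M)"
proof -
  assume "p \<in> polys_le N" "q \<in> polys_le M"
  then obtain c d where p: "p = (\<lambda>x. \<Sum>e\<in>exponents N. c e * mono_fun e x)" and q: "q = (\<lambda>x. \<Sum>e\<in>exponents M. d e * mono_fun e x)"
    unfolding polys_le_iff by blast
  have "(\<lambda>x. p x * q x) = (\<lambda>x. \<Sum>e\<in>exponents N. \<Sum>e'\<in>exponents M. (c e * d e') * mono_fun (\<lambda>i. e i + e' i) x)"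
    unfolding p q sum_product by (simp add: mono_fun_mult[symmetric] mult_ac)
  also have "\<dots> \<in> polys_le (N + M)"
    by (intro polys_le_sum polys_le_scale polys_le_mono_fun) (auto simp: sum.distrib intro: add_mono)
  finally show ?thesis .
qed

lemma polys_le_const: "(\<lambda>x. c) \<in> polys_le N"
proof -
  have "mono_fun (\<lambda>_. 0) \<in> polys_le N" by (rule polys_le_mono_fun) simp
  from polys_le_scale[OF this, of c] show ?thesis by (simp add: mono_fun_def)
qed

lemma polys_le_coord: "(\<lambda>x. x $ i) \<in> polys_le 1"
proof -
  have "mono_fun (\<lambda>j. if j = i then 1 else 0) \<in> polys_le 1" by (rule polys_le_mono_fun) simp
  moreover have "mono_fun (\<lambda>j. if j = i then 1 else 0) = (\<lambda>x. x $ i)"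
  proof
    fix x :: "real^'a"
    have "mono_fun (\<lambda>j. if j = i then 1 else 0) x = (\<Prod>j\<in>UNIV. if j = i then x $ j else 1)"
      unfolding mono_fun_def by (rule prod.cong) auto
    then show "mono_fun (\<lambda>j. if j = i then 1 else 0) x = x $ i" by simp
  qed
  ultimately show ?thesis by simp
qed

lemma polys_le_power: "p \<in> polys_le N \<Longrightarrow> (\<lambda>x. p x ^ n) \<in> polys_le (N * n)"
proof (induction n)
  case 0
  then show ?case using polys_le_const by simp
next
  case (Suc n)
  then show ?case using polys_le_mult[of p N "\<lambda>x. p x ^ n" "N * n"] by simp
qed

lemma polys_le_poly: "p \<in> polys_le 1 \<Longrightarrow> degree q \<le> n \<Longrightarrow> (\<lambda>x. poly q (p x)) \<in> polys_le n"
proof -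
  assume p: "p \<in> polys_le 1" and d: "degree q \<le> n"
  have "(\<lambda>x. p x ^ i) \<in> polys_le n" if "i \<le> degree q" for i
    using polys_le_mono[OF polys_le_power[OF p, of i], of n] that d by simp
  then show ?thesis unfolding poly_altdef by (intro polys_le_sum polys_le_scale) auto
qed

lemma polys_le_real_polynomial:
  assumes "p \<in> polys_le N" shows "real_polynomial_function p"
proof -
  obtain c where p: "p = (\<lambda>x. \<Sum>e\<in>exponents N. c e * mono_fun e x)" using assms unfolding polys_le_iff by blast
  have "real_polynomial_function (\<lambda>x :: real^'a. x $ i)" for i
    by (rule real_polynomial_function.intros(1)) (rule bounded_linear_vec_nth)
  then show ?thesis unfolding p mono_fun_def
    by (intro real_polynomial_function_sum finite_exponents real_polynomial_function.intros(2,4) real_polynomial_function_prod real_polynomial_function_power) auto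
qed

lemma polys_le_continuous: "p \<in> polys_le N \<Longrightarrow> continuous_on A p"
  by (intro continuous_on_polymonial_function, fold real_polynomial_function_eq)
     (rule polys_le_real_polynomial)

text \<open>On each line through the origin the restriction is a univariate polynomial with
  infinitely many zeros.\<close>

lemma real_polynomial_zero:
  fixes p :: "'a::euclidean_space \<Rightarrow> real"
  assumes p: "real_polynomial_function p" and 0: "\<And>y. norm y < 1 \<Longrightarrow> p y = 0"
  shows "p x = 0"
proof -
  have "polynomial_function (\<lambda>t::real. t *\<^sub>R x)"
    by (intro polynomial_function_bounded_linear bounded_linear_scaleR_left)
  then have "real_polynomial_function (p \<circ> (\<lambda>t::real. t *\<^sub>R x))"
    using p by (rule real_polynomial_function_compose)
  then obtain a n where a: "p \<circ> (\<lambda>t::real. t *\<^sub>R x) = (\<lambda>t. \<Sum>i\<le>n. a i * t ^ i)"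
    using real_polynomial_function_iff_sum by metis
  define q where "q = (\<Sum>i\<le>n. monom (a i) i)"
  have q: "poly q t = p (t *\<^sub>R x)" for t
    using fun_cong[OF a, of t] by (simp add: q_def poly_sum poly_monom)
  have "q = 0"
  proof (rule ccontr)
    assume "q \<noteq> 0"
    then have "finite {t. poly q t = 0}" by (rule poly_roots_finite)
    \<comment> \<open>Adding 1 to the norm covers \<open>x = 0\<close>.\<close>
    moreover have "{0<..<1 / (norm x + 1)} \<subseteq> {t. poly q t = 0}"
    proof
      fix t assume t: "t \<in> {0<..<1 / (norm x + 1)}"
      have "norm (t *\<^sub>R x) \<le> t * (norm x + 1)" using t by (simp add: algebra_simps)
      also have "\<dots> < 1" using t by (simp add: pos_less_divide_eq add_nonneg_pos)
      finally show "t \<in> {t. poly q t = 0}" using 0 by (simp add: q)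
    qed
    ultimately have "finite {0<..<1 / (norm x + 1)}" by (rule rev_finite_subset)
    moreover have "0 < 1 / (norm x + 1)" by (simp add: add_nonneg_pos)
    ultimately show False using infinite_Ioo by blast
  qed
  then show ?thesis using q[of 1] by simp
qed

section \<open>The weighted inner product\<close>

lemma continuous_ball_L2:
  assumes mu: "\<mu> \<ge> 0" and g: "continuous_on UNIV g"
  shows "g \<in> ball_L2 \<mu>"
proof -
  have gm: "g \<in> borel_measurable borel" by (rule borel_measurable_continuous_onI[OF g])
  have "(\<lambda>x. indicator (cball 0 1) x *\<^sub>R g x) \<in> borel_measurable lborel"
    using gm by (intro borel_measurable_scaleR borel_measurable_indicator) auto
  then have 1: "set_borel_measurable lebesgue (cball 0 1) g"
    unfolding set_borel_measurable_def by (rule measurable_completion)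
  have g2: "continuous_on UNIV (\<lambda>x. (g x)\<^sup>2)" by (intro continuous_intros g)
  have "integrable lborel (\<lambda>x. indicator (cball 0 1) x * ((g x)\<^sup>2 * ball_weight \<mu> x))"
    by (rule bounded_times_weight_integrable[OF mu g2])
  then have "set_integrable lebesgue (cball 0 1) (\<lambda>x. (g x)\<^sup>2 * ball_weight \<mu> x)"
    unfolding set_integrable_def real_scaleR_def
    by (subst integrable_completion) auto
  with 1 show ?thesis by (simp add: ball_L2_def)
qed

lemma L2_times_continuous_integrable:
  assumes mu: "\<mu> \<ge> 0" and f: "f \<in> ball_L2 \<mu>" and g: "continuous_on UNIV g"
  shows "set_integrable lebesgue (cball 0 1) (\<lambda>x. f x * g x * ball_weight \<mu> x)"
proof -
  obtain f' where f': "AE x in lborel. indicator (cball 0 1) x * f x = f' x"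
    "integrable lborel (\<lambda>x. indicator (cball 0 1) x * (f' x * g x * ball_weight \<mu> x))"
    by (rule ball_L2_borel_version[OF mu f g])
  have i: "integrable lebesgue (\<lambda>x. indicator (cball 0 1) x * (f' x * g x * ball_weight \<mu> x))"
    using f'(2) by (subst integrable_completion) auto
  have ae: "AE x in lebesgue. indicator (cball 0 1) x * (f' x * g x * ball_weight \<mu> x) =
      indicator (cball 0 1) x * (f x * g x * ball_weight \<mu> x)"
    by (rule AE_completion) (use f'(1) in eventually_elim, auto simp: indicator_def)
  show ?thesis unfolding set_integrable_def real_scaleR_def
    by (rule integrable_cong_AE_imp[OF i borel_measurable_AE[OF borel_measurable_integrable[OF i] ae] ae])
qed

lemma ball_inner_ball_integral: "ball_inner \<mu> f g = ball_const \<mu> * ball_integral \<mu> (\<lambda>x. f x * g x)"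
  by (simp add: ball_inner_def ball_integral_def)

lemma ball_integral_cmult: "ball_integral \<mu> (\<lambda>x. c * g x) = c * ball_integral \<mu> g"
  by (simp add: ball_integral_def mult.assoc)

lemma inner_cmult_left: "ball_inner \<mu> (\<lambda>x. c * f x) g = c * ball_inner \<mu> f g"
  unfolding ball_inner_ball_integral using ball_integral_cmult[of \<mu> c "\<lambda>x. f x * g x"] by (simp add: mult.assoc)

lemma inner_commute: "ball_inner \<mu> f g = ball_inner \<mu> g f"
  by (simp add: ball_inner_def mult.commute)

lemma inner_cmult_right: "ball_inner \<mu> f (\<lambda>x. c * g x) = c * ball_inner \<mu> f g"
  using inner_cmult_left[of \<mu> c g f] by (simp add: inner_commute)

lemma inner_add_right:
  assumes mu: "\<mu> \<ge> 0" and f: "f \<in> ball_L2 \<mu>" and g: "continuous_on UNIV g" and h: "continuous_on UNIV h"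
  shows "ball_inner \<mu> f (\<lambda>x. g x + h x) = ball_inner \<mu> f g + ball_inner \<mu> f h"
  using set_integral_add(2)[OF L2_times_continuous_integrable[OF mu f g] L2_times_continuous_integrable[OF mu f h]]
  by (simp add: ball_inner_def algebra_simps)

lemma inner_zero_right [simp]: "ball_inner \<mu> f (\<lambda>x. 0) = 0"
  by (simp add: ball_inner_def)

lemma inner_sum_right:
  assumes mu: "\<mu> \<ge> 0" and f: "f \<in> ball_L2 \<mu>" and "\<And>i. i \<in> A \<Longrightarrow> continuous_on UNIV (g i)"
  shows "ball_inner \<mu> f (\<lambda>x. \<Sum>i\<in>A. g i x) = (\<Sum>i\<in>A. ball_inner \<mu> f (g i))"
  using assms(3)
proof (induction A rule: infinite_finite_induct)
  case (insert i A)
  then have "ball_inner \<mu> f (\<lambda>x. g i x + (\<Sum>i\<in>A. g i x)) = ball_inner \<mu> f (g i) + ball_inner \<mu> f (\<lambda>x. \<Sum>i\<in>A. g i x)"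
    by (intro inner_add_right mu f continuous_on_sum insert.prems) auto
  with insert show ?case by simp
qed simp_all

lemma inner_diff_right:
  assumes mu: "\<mu> \<ge> 0" and f: "f \<in> ball_L2 \<mu>" and g: "continuous_on UNIV g" and h: "continuous_on UNIV h"
  shows "ball_inner \<mu> f (\<lambda>x. g x - h x) = ball_inner \<mu> f g - ball_inner \<mu> f h"
proof -
  have "ball_inner \<mu> f (\<lambda>x. g x + (-1) * h x) = ball_inner \<mu> f g + ball_inner \<mu> f (\<lambda>x. (-1) * h x)"
    by (intro inner_add_right mu f g continuous_on_mult h continuous_on_const)
  then show ?thesis unfolding inner_cmult_right by simp
qed

lemma inner_diff_left:
  assumes mu: "\<mu> \<ge> 0" and f: "f \<in> ball_L2 \<mu>" and p: "continuous_on UNIV p" and q: "continuous_on UNIV q"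
  shows "ball_inner \<mu> (\<lambda>x. f x - p x) q = ball_inner \<mu> f q - ball_inner \<mu> p q"
  using set_integral_diff(2)[OF L2_times_continuous_integrable[OF mu f q]
      L2_times_continuous_integrable[OF mu continuous_ball_L2[OF mu p] q]]
  by (simp add: ball_inner_def left_diff_distrib) (simp add: right_diff_distrib)

lemma ball_const_pos: "\<mu> \<ge> 0 \<Longrightarrow> ball_const \<mu> > 0"
  unfolding ball_const_def by (intro divide_pos_pos mult_pos_pos Gamma_real_pos) auto

text \<open>The weight is positive in the open ball, so \<open>p\<close> vanishes almost everywhere
  and, by continuity, everywhere there. Polynomials are compared as functions on the whole space,
  hence the final appeal to \<open>real_polynomial_zero\<close>.\<close>

lemma inner_self_eq_0:
  assumes mu: "\<mu> \<ge> 0" and p: "p \<in> polys_le N" and 0: "ball_inner \<mu> p p = 0"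
  shows "p = (\<lambda>x. 0)"
proof -
  have pc: "continuous_on UNIV p" by (rule polys_le_continuous[OF p])
  have pm: "p \<in> borel_measurable borel" by (rule borel_measurable_continuous_onI[OF pc])
  let ?g = "\<lambda>x. indicator (cball 0 1) x * (p x * p x * ball_weight \<mu> x)"
  have "ball_integral \<mu> (\<lambda>x. p x * p x) = 0" using 0 ball_const_pos[OF mu] by (simp add: ball_inner_ball_integral)
  moreover have "ball_integral \<mu> (\<lambda>x. p x * p x) = integral\<^sup>L lborel ?g"
    by (rule ball_integral_lborel) (use pm in measurable)
  moreover have "integrable lborel ?g"
    by (rule bounded_times_weight_integrable[OF mu]) (intro continuous_intros pc)
  moreover have "AE x in lborel. 0 \<le> ?g x" by (auto simp: ball_weight_def)
  ultimately have ae: "AE x in lborel. ?g x = 0" by (simp add: integral_nonneg_eq_0_iff_AE)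
  have "p y = 0" if y: "norm y < 1" for y
  proof (rule ccontr)
    assume "p y \<noteq> 0"
    let ?U = "{x. p x \<noteq> 0} \<inter> ball 0 1"
    have "open ?U"
      by (intro open_Int open_ball open_Collect_neq pc continuous_on_const)
    moreover have "?U \<noteq> {}" using \<open>p y \<noteq> 0\<close> y by auto
    ultimately have "\<not> negligible ?U" by (rule open_not_negligible)
    moreover have "AE x in lborel. x \<notin> ?U"
      using ae
    proof eventually_elim
      case (elim x)
      show ?case
      proof
        assume x: "x \<in> ?U"
        then have "1 - (norm x)\<^sup>2 > 0" by (auto intro: one_minus_sq_pos[of "norm x", simplified])
        then have "ball_weight \<mu> x > 0" by (simp add: ball_weight_def)
        then show False using x elim by auto
      qed
    qed
    then have "AE x in lebesgue. x \<notin> ?U" by (rule AE_completion)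
    then have "negligible ?U"
      by (simp add: negligible_iff_null_sets completion.null_sets_iff_AE)
    ultimately show False by simp
  qed
  then show ?thesis
    using real_polynomial_zero[OF polys_le_real_polynomial[OF p]] by blast
qed

section \<open>The orthogonal spaces and the projection\<close>

text \<open>The separate zero function covers \<open>l = 0\<close>, where no \<open>m < l\<close>
  exists.\<close>

definition lower_poly :: "nat \<Rightarrow> (real^3 \<Rightarrow> real) \<Rightarrow> bool" where
  "lower_poly l r \<longleftrightarrow> r = (\<lambda>x. 0) \<or> (\<exists>m<l. r \<in> polys_le m)"

lemma lower_poly_add: "lower_poly l r \<Longrightarrow> lower_poly l s \<Longrightarrow> lower_poly l (\<lambda>x. r x + s x)"
proof -
  assume r: "lower_poly l r" and s: "lower_poly l s"
  show ?thesis
  proof (cases "r = (\<lambda>x. 0) \<or> s = (\<lambda>x. 0)")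
    case True
    then show ?thesis using r s by auto
  next
    case False
    then obtain m m' where m: "m < l" "r \<in> polys_le m" "m' < l" "s \<in> polys_le m'"
      using r s unfolding lower_poly_def by blast
    then have "(\<lambda>x. r x + s x) \<in> polys_le (max m m')"
      by (intro polys_le_add) (auto intro: polys_le_mono)
    then show ?thesis unfolding lower_poly_def using m by (intro disjI2 exI[of _ "max m m'"]) auto
  qed
qed

lemma lower_poly_scale: "lower_poly l r \<Longrightarrow> lower_poly l (\<lambda>x. c * r x)"
  unfolding lower_poly_def using polys_le_scale by fastforce

lemma lower_poly_polys_le: "lower_poly l r \<Longrightarrow> r \<in> polys_le l"
  unfolding lower_poly_def using polys_le_zero polys_le_mono by (metis less_imp_le)

text \<open>A polynomial of degree below \<open>l\<close> that is orthogonal to lower degrees is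
  orthogonal to itself, hence 0. This replaces the exact-degree clause of \<open>ball_V\<close>,
  which is not linear, by a linear condition.\<close>

lemma ball_V_iff:
  assumes mu: "\<mu> \<ge> 0"
  shows "p \<in> ball_V \<mu> l \<longleftrightarrow> p \<in> polys_le l \<and> (\<forall>r. lower_poly l r \<longrightarrow> ball_inner \<mu> p r = 0)"
proof
  assume "p \<in> ball_V \<mu> l"
  then show "p \<in> polys_le l \<and> (\<forall>r. lower_poly l r \<longrightarrow> ball_inner \<mu> p r = 0)"
    unfolding ball_V_def polys_deg_def lower_poly_def by (auto intro: polys_le_zero)
next
  assume p: "p \<in> polys_le l \<and> (\<forall>r. lower_poly l r \<longrightarrow> ball_inner \<mu> p r = 0)"
  have "p = (\<lambda>x. 0)" if "m < l" "p \<in> polys_le m" for m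
    using p that inner_self_eq_0[OF mu that(2)] by (auto simp: lower_poly_def)
  then show "p \<in> ball_V \<mu> l"
    using p unfolding ball_V_def polys_deg_def lower_poly_def by blast
qed

lemma ball_V_continuous: "\<mu> \<ge> 0 \<Longrightarrow> p \<in> ball_V \<mu> l \<Longrightarrow> continuous_on A p"
  using polys_le_continuous by (auto simp: ball_V_iff)

lemma ball_V_add:
  assumes mu: "\<mu> \<ge> 0" and pq: "p \<in> ball_V \<mu> l" "q \<in> ball_V \<mu> l"
  shows "(\<lambda>x. p x + q x) \<in> ball_V \<mu> l"
  unfolding ball_V_iff[OF mu]
proof (intro conjI allI impI)
  show "(\<lambda>x. p x + q x) \<in> polys_le l" using pq by (auto simp: ball_V_iff[OF mu] intro: polys_le_add)
  fix r assume r: "lower_poly l r"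
  have rL: "r \<in> ball_L2 \<mu>"
    by (rule continuous_ball_L2[OF mu polys_le_continuous[OF lower_poly_polys_le[OF r]]])
  have "ball_inner \<mu> r (\<lambda>x. p x + q x) = ball_inner \<mu> r p + ball_inner \<mu> r q"
    by (rule inner_add_right[OF mu rL]) (use pq ball_V_continuous[OF mu] in auto)
  moreover have "ball_inner \<mu> r p = 0" "ball_inner \<mu> r q = 0"
    using pq r by (simp_all add: inner_commute[of \<mu> r] ball_V_iff[OF mu])
  ultimately show "ball_inner \<mu> (\<lambda>x. p x + q x) r = 0"
    by (simp add: inner_commute)
qed

lemma ball_V_scale:
  assumes mu: "\<mu> \<ge> 0" and p: "p \<in> ball_V \<mu> l"
  shows "(\<lambda>x. c * p x) \<in> ball_V \<mu> l"
  using p by (auto simp: ball_V_iff[OF mu] inner_cmult_left intro: polys_le_scale)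

lemma ball_V_zero: "\<mu> \<ge> 0 \<Longrightarrow> (\<lambda>x. 0) \<in> ball_V \<mu> l"
  by (simp add: ball_V_iff polys_le_zero ball_inner_def)

lemma ball_V_sum:
  "\<mu> \<ge> 0 \<Longrightarrow> (\<And>i. i \<in> A \<Longrightarrow> p i \<in> ball_V \<mu> l) \<Longrightarrow> (\<lambda>x. \<Sum>i\<in>A. p i x) \<in> ball_V \<mu> l"
  by (induction A rule: infinite_finite_induct) (auto intro: ball_V_zero ball_V_add)

lemma ball_V_diff:
  "\<mu> \<ge> 0 \<Longrightarrow> p \<in> ball_V \<mu> l \<Longrightarrow> q \<in> ball_V \<mu> l \<Longrightarrow> (\<lambda>x. p x - q x) \<in> ball_V \<mu> l"
  using ball_V_add[of \<mu> p l "\<lambda>x. (-1) * q x"] ball_V_scale[of \<mu> q l "-1"] by simp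

text \<open>Resolves the definite description: the difference of two solutions lies in the space and
  is orthogonal to all of it, in particular to itself.\<close>

lemma ball_proj_eqI:
  assumes mu: "\<mu> \<ge> 0" and f: "f \<in> ball_L2 \<mu>" and p: "p \<in> ball_V \<mu> l"
    and o: "\<And>q. q \<in> ball_V \<mu> l \<Longrightarrow> ball_inner \<mu> p q = ball_inner \<mu> f q"
  shows "ball_proj \<mu> l f = p"
  unfolding ball_proj_def
proof (rule the_equality)
  note c = ball_V_continuous[OF mu]
  show "p \<in> ball_V \<mu> l \<and> (\<forall>q\<in>ball_V \<mu> l. ball_inner \<mu> (\<lambda>x. f x - p x) q = 0)"
    using p o by (auto simp: inner_diff_left[OF mu f c[OF p] c])
  fix p' assume p': "p' \<in> ball_V \<mu> l \<and> (\<forall>q\<in>ball_V \<mu> l. ball_inner \<mu> (\<lambda>x. f x - p' x) q = 0)"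
  then have p'V: "p' \<in> ball_V \<mu> l" by blast
  have o': "ball_inner \<mu> p' q = ball_inner \<mu> f q" if q: "q \<in> ball_V \<mu> l" for q
    using p' q by (auto simp: inner_diff_left[OF mu f c[OF p'V] c[OF q]])
  let ?d = "\<lambda>x. p' x - p x"
  have d: "?d \<in> ball_V \<mu> l" by (rule ball_V_diff[OF mu p'V p])
  have "ball_inner \<mu> ?d ?d = 0"
    using inner_diff_left[OF mu continuous_ball_L2[OF mu c[OF p'V]] c[OF p] c[OF d]] o[OF d] o'[OF d] by simp
  then have "?d = (\<lambda>x. 0)" using inner_self_eq_0[OF mu, of ?d l] d by (simp add: ball_V_iff[OF mu])
  then show "p' = p" by (auto simp: fun_eq_iff)
qed

text \<open>
  Biorthogonality makes \<open>q = \<Sum>\<^sub>j \<langle>q, Y\<^sub>j\<rangle> X\<^sub>j\<close> for every \<open>q\<close> in the space, since the difference of the two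
  sides is orthogonal to all \<open>Y\<^sub>j\<close>.
\<close>

lemma biorthogonal_projection:
  assumes mu: "\<mu> \<ge> 0" and fin: "finite J" and f: "f \<in> ball_L2 \<mu>"
    and Y: "\<And>j. j \<in> J \<Longrightarrow> Y j \<in> ball_V \<mu> l" and X: "\<And>j. j \<in> J \<Longrightarrow> X j \<in> ball_V \<mu> l"
    and bi: "\<And>j j'. j \<in> J \<Longrightarrow> j' \<in> J \<Longrightarrow> ball_inner \<mu> (Y j) (X j') = (if j = j' then 1 else 0)"
    and span: "\<And>q. q \<in> ball_V \<mu> l \<Longrightarrow> \<exists>b. q = (\<lambda>x. \<Sum>j\<in>J. b j * Y j x)"
  shows "ball_proj \<mu> l f = (\<lambda>x. \<Sum>j\<in>J. ball_inner \<mu> f (X j) * Y j x)"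
proof (rule ball_proj_eqI[OF mu f])
  note c = ball_V_continuous[OF mu]
  note L2 = continuous_ball_L2[OF mu]
  note cm = continuous_on_mult[OF continuous_on_const]
  show V: "(\<lambda>x. \<Sum>j\<in>J. ball_inner \<mu> f (X j) * Y j x) \<in> ball_V \<mu> l"
    by (intro ball_V_sum ball_V_scale mu Y)
  fix q assume q: "q \<in> ball_V \<mu> l"
  define T where "T = (\<lambda>x. \<Sum>j\<in>J. ball_inner \<mu> q (Y j) * X j x)"
  have TV: "T \<in> ball_V \<mu> l" unfolding T_def by (intro ball_V_sum ball_V_scale mu X)
  have gT: "ball_inner \<mu> g T = (\<Sum>j\<in>J. ball_inner \<mu> q (Y j) * ball_inner \<mu> g (X j))" if g: "g \<in> ball_L2 \<mu>" for g
    unfolding T_def by (subst inner_sum_right[OF mu g])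
      (auto simp: inner_cmult_right intro!: cm c[OF X])
  have YT: "ball_inner \<mu> (Y j) T = ball_inner \<mu> (Y j) q" if j: "j \<in> J" for j
  proof -
    have "ball_inner \<mu> (Y j) T = (\<Sum>j'\<in>J. ball_inner \<mu> q (Y j') * (if j = j' then 1 else 0))"
      unfolding gT[OF L2[OF c[OF Y[OF j]]]] by (rule sum.cong) (auto simp: bi j)
    also have "\<dots> = (\<Sum>j'\<in>J. if j = j' then ball_inner \<mu> q (Y j') else 0)" by (rule sum.cong) auto
    also have "\<dots> = ball_inner \<mu> q (Y j)" using fin j by simp
    finally show ?thesis by (simp add: inner_commute)
  qed
  let ?d = "\<lambda>x. T x - q x"
  have d: "?d \<in> ball_V \<mu> l" by (rule ball_V_diff[OF mu TV q])
  obtain b where b: "?d = (\<lambda>x. \<Sum>j\<in>J. b j * Y j x)" using span[OF d] by blast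
  have "ball_inner \<mu> ?d ?d = (\<Sum>j\<in>J. b j * ball_inner \<mu> ?d (Y j))"
    by (subst (2) b, subst inner_sum_right[OF mu L2[OF c[OF d]]])
       (auto simp: inner_cmult_right intro!: cm c[OF Y])
  also have "\<dots> = 0"
  proof (intro sum.neutral ballI)
    fix j assume j: "j \<in> J"
    have "ball_inner \<mu> (Y j) ?d = ball_inner \<mu> (Y j) T - ball_inner \<mu> (Y j) q"
      by (rule inner_diff_right[OF mu L2[OF c[OF Y[OF j]]] c[OF TV] c[OF q]])
    then show "b j * ball_inner \<mu> ?d (Y j) = 0"
      using YT[OF j] inner_commute[of \<mu> ?d "Y j"] by simp
  qed
  finally have "?d = (\<lambda>x. 0)" using inner_self_eq_0[OF mu, of ?d l] d by (simp add: ball_V_iff[OF mu])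
  then have Tq: "T = q" by (auto simp: fun_eq_iff)
  \<comment> \<open>\<open>gT\<close> holds for every \<open>g\<close> in \<open>ball_L2\<close>, so
    the expansion \<open>T = q\<close> also evaluates the pairing with \<open>f\<close>.\<close>
  have "ball_inner \<mu> q (\<lambda>x. \<Sum>j\<in>J. ball_inner \<mu> f (X j) * Y j x) =
      (\<Sum>j\<in>J. ball_inner \<mu> f (X j) * ball_inner \<mu> q (Y j))"
    by (subst inner_sum_right[OF mu L2[OF c[OF q]]])
       (auto simp: inner_cmult_right intro!: cm c[OF Y])
  also have "\<dots> = ball_inner \<mu> f q" using gT[OF f] Tq by (simp add: mult.commute)
  finally show "ball_inner \<mu> (\<lambda>x. \<Sum>j\<in>J. ball_inner \<mu> f (X j) * Y j x) q = ball_inner \<mu> f q"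
    by (simp add: inner_commute)
qed

section \<open>The basis and its dual\<close>

text \<open>\<open>gegenbauer_on\<close> as an element of \<open>real poly\<close>, so that degree
  arguments apply.\<close>

definition axial_poly :: "real \<Rightarrow> nat \<Rightarrow> nat \<Rightarrow> real poly" where
  "axial_poly \<mu> l k = (let m = l - k; lam = real k + \<mu> + 1 in
     smult (1 / sqrt (lam * pochhammer (2 * lam) m / ((real m + lam) * fact m))) (gegenbauer_poly lam m))"

lemma poly_axial_poly: "poly (axial_poly \<mu> l k) w = gegenbauer_on (l - k) (real k + \<mu> + 1) w"
  by (simp add: axial_poly_def gegenbauer_on_def gegenbauer_def Let_def)

lemma axial_poly_facts:
  assumes mu: "\<mu> \<ge> 0"
  shows "degree (axial_poly \<mu> l k) = l - k" "axial_poly \<mu> l k \<noteq> 0"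
    and "q = 0 \<or> degree q < l - k \<Longrightarrow> wpoly (\<mu> + 1/2 + real k) (\<mu> + 1/2 + real k) (axial_poly \<mu> l k * q) = 0"
    and "wpoly (\<mu> + 1/2 + real k) (\<mu> + 1/2 + real k) (axial_poly \<mu> l k * axial_poly \<mu> l k) =
      wint (\<mu> + 1/2 + real k) (\<mu> + 1/2 + real k) (\<lambda>_. 1)"
proof -
  define m where "m = l - k"
  define lam where "lam = real k + \<mu> + 1"
  define N where "N = lam * pochhammer (2 * lam) m / ((real m + lam) * fact m)"
  have lam: "lam > 0" using mu by (simp add: lam_def)
  have e: "lam - 1/2 = \<mu> + 1/2 + real k" by (simp add: lam_def)
  have N: "N > 0" unfolding N_def using lam
    by (intro divide_pos_pos mult_pos_pos pochhammer_pos) auto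
  have axial_poly: "axial_poly \<mu> l k = smult (1 / sqrt N) (gegenbauer_poly lam m)"
    by (simp add: axial_poly_def m_def lam_def N_def Let_def)
  note C = gegenbauer_poly_facts[OF lam, where n = m, unfolded e]
  show "degree (axial_poly \<mu> l k) = l - k" "axial_poly \<mu> l k \<noteq> 0"
    using C(1,2) N by (auto simp: axial_poly m_def)
  show "wpoly (\<mu> + 1/2 + real k) (\<mu> + 1/2 + real k) (axial_poly \<mu> l k * q) = 0" if "q = 0 \<or> degree q < l - k"
    using gegenbauer_poly_facts(3)[OF lam, of q m, unfolded e] that
    unfolding axial_poly mult_smult_left wpoly_smult by (simp only: m_def[symmetric] mult_zero_right)
  have "wpoly (\<mu> + 1/2 + real k) (\<mu> + 1/2 + real k) (axial_poly \<mu> l k * axial_poly \<mu> l k) =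
     (1 / sqrt N) * (1 / sqrt N) * (N * wint (\<mu> + 1/2 + real k) (\<mu> + 1/2 + real k) (\<lambda>_. 1))"
    unfolding axial_poly mult_smult_left mult_smult_right wpoly_smult
      gegenbauer_poly_facts(5)[OF lam, where n = m, unfolded e N_def[symmetric]] by (simp only: mult.assoc)
  also have "(1 / sqrt N) * (1 / sqrt N) * (N * W) = W" for W
    using N by simp
  finally show "wpoly (\<mu> + 1/2 + real k) (\<mu> + 1/2 + real k) (axial_poly \<mu> l k * axial_poly \<mu> l k) =
      wint (\<mu> + 1/2 + real k) (\<mu> + 1/2 + real k) (\<lambda>_. 1)" .
qed

text \<open>Two slice factors of degree \<open>k\<close> contribute
  \<open>sqrt (1 - w\<^sup>2) ^ (2 * k)\<close>, which raises the exponent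
  \<open>\<mu> + 1/2\<close> by \<open>k\<close>. Hence the parameter \<open>k + \<mu> + 1\<close>
  of the axial polynomials.\<close>

lemma wint_sqrt_shift:
  "wint a a (\<lambda>w. g w * sqrt (1 - w\<^sup>2) ^ (2 * n)) = wint (a + real n) (a + real n) g"
proof -
  have "wint a a (\<lambda>w. g w * sqrt (1 - w\<^sup>2) ^ (2 * n)) = wint a a (\<lambda>w. (1 - w) ^ n * (1 + w) ^ n * g w)"
  proof (rule wint_cong)
    fix w :: real assume "w \<in> {-1..1}"
    then have "(sqrt (1 - w\<^sup>2))\<^sup>2 = 1 - w\<^sup>2" by (auto simp: abs_square_le_1 abs_le_iff)
    also have "1 - w\<^sup>2 = (1 - w) * (1 + w)" by (simp add: power2_eq_square algebra_simps)
    finally show "g w * sqrt (1 - w\<^sup>2) ^ (2 * n) = (1 - w) ^ n * (1 + w) ^ n * g w"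
      by (simp add: power_mult power_mult_distrib)
  qed
  then show ?thesis by (simp only: wint_shift)
qed

lemma planar_poly_polys_le: "planar_poly d F \<Longrightarrow> (\<lambda>x. F (planar_part x)) \<in> polys_le d"
proof (induction rule: planar_poly.induct)
  case (mono a b d c)
  have "(\<lambda>x::real^3. c * ((x $ 1) ^ a * (x $ 2) ^ b)) \<in> polys_le (1 * a + 1 * b)"
    by (intro polys_le_scale polys_le_mult polys_le_power polys_le_coord)
  then show ?case using mono by (auto simp: planar_part_def intro: polys_le_mono)
next
  case (add d F G)
  then show ?case by (intro polys_le_add)
qed

lemma mono_fun_3: "mono_fun e x = (x $ 1) ^ e 1 * (x $ 2) ^ e 2 * (x $ 3) ^ e 3" for e :: "3 \<Rightarrow> nat"
  unfolding mono_fun_def UNIV_3 by simp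

text \<open>Reversing both chord coordinates is the point reflection. Unlike
  \<open>disk_integral_rotate\<close> it reaches inhomogeneous integrands such as products with
  ridge functions.\<close>

lemma disk_integral_reflect: "disk_integral \<mu> (\<lambda>z. F (- z)) = disk_integral \<mu> F"
proof -
  have "disk_integral \<mu> (\<lambda>z. F (- z)) = wint \<mu> \<mu> (\<lambda>t. wint (\<mu> - 1/2) (\<mu> - 1/2)
      (\<lambda>\<sigma>. F (Complex (- t) (sqrt (1 - (- t)\<^sup>2) * (- \<sigma>)))))"
    by (simp add: disk_integral_def Complex_eq)
  also have "\<dots> = wint \<mu> \<mu> (\<lambda>t. wint (\<mu> - 1/2) (\<mu> - 1/2)
      (\<lambda>\<sigma>. F (Complex (- t) (sqrt (1 - (- t)\<^sup>2) * \<sigma>))))"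
    by (subst wint_reflect[of _ "\<lambda>\<sigma>. F (Complex (- t) (sqrt (1 - (- t)\<^sup>2) * \<sigma>))" for t]) (rule refl)
  also have "\<dots> = disk_integral \<mu> F"
    unfolding disk_integral_def by (rule wint_reflect)
  finally show ?thesis .
qed

lemma planar_poly_linear: "planar_poly 1 (\<lambda>z. Re (c * z))" "planar_poly 1 (\<lambda>z. Im (c * z))"
proof -
  have "planar_poly 1 (\<lambda>z. Re c * Re z + (- Im c) * Im z)" "planar_poly 1 (\<lambda>z. Re c * Im z + Im c * Re z)"
    by (intro planar_poly.add planar_poly_scale planar_poly_Re planar_poly_Im)+
  then show "planar_poly 1 (\<lambda>z. Re (c * z))" "planar_poly 1 (\<lambda>z. Im (c * z))" by simp_all
qed

lemma sqrt_one_minus_nonneg: "w \<in> {-1..1} \<Longrightarrow> sqrt (1 - w\<^sup>2) \<ge> 0 \<and> (sqrt (1 - w\<^sup>2))\<^sup>2 = 1 - w\<^sup>2" for w :: real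
  by (auto simp: abs_square_le_1 abs_le_iff)

text \<open>Common to \<open>ball_basis\<close> and the ridge polynomials, whose slices differ in
  \<open>F\<close> and \<open>\<theta>\<close>. A monomial of planar degree
  \<open>d = e 1 + e 2\<close> is killed by the disk integral if \<open>d < k\<close>, by point
  reflection if \<open>k + d\<close> is odd, and otherwise, with \<open>d = k + 2 * m\<close>, by
  the axial polynomial.\<close>

lemma slice_product_in_V:
  fixes Q :: "real^3 \<Rightarrow> real" and F :: "complex \<Rightarrow> real"
  assumes mu: "\<mu> \<ge> 0" and kl: "k \<le> l" and Q: "Q \<in> polys_le k"
    and Qb: "\<And>w t \<sigma>. w \<in> {-1..1} \<Longrightarrow> Q (ball_pt \<theta> w t \<sigma>) = sqrt (1 - w\<^sup>2) ^ k * F (Complex t (sqrt (1 - t\<^sup>2) * \<sigma>))"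
    and orth: "\<And>d G. planar_poly d G \<Longrightarrow> d < k \<Longrightarrow> disk_integral \<mu> (\<lambda>z. F z * G z) = 0"
    and par: "\<And>z. F (- z) = (-1) ^ k * F z"
  shows "(\<lambda>x. poly (axial_poly \<mu> l k) (x $ 3) * Q x) \<in> ball_V \<mu> l"
proof -
  let ?Y = "\<lambda>x. poly (axial_poly \<mu> l k) (x $ 3) * Q x"
  have YP: "?Y \<in> polys_le l"
  proof -
    have "?Y \<in> polys_le ((l - k) + k)"
      by (intro polys_le_mult Q polys_le_poly polys_le_coord) (simp add: axial_poly_facts[OF mu])
    then show ?thesis using kl by simp
  qed
  have Yc: "continuous_on UNIV ?Y" by (rule polys_le_continuous[OF YP])
  have mono: "ball_inner \<mu> ?Y (mono_fun e) = 0" if e: "e 1 + e 2 + e 3 < l" for e :: "3 \<Rightarrow> nat"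
  proof -
    define G where "G = (\<lambda>z. Re (cis \<theta> * z) ^ e 1 * Im (cis \<theta> * z) ^ e 2)"
    have cG: "planar_poly (e 1 + e 2) G"
      using planar_poly_mult[OF planar_poly_power[OF planar_poly_linear(1)[of "cis \<theta>"], of "e 1"] planar_poly_power[OF planar_poly_linear(2)[of "cis \<theta>"], of "e 2"]]
      by (simp add: G_def add.commute)
    have c: "continuous_on UNIV (\<lambda>x. ?Y x * mono_fun e x)"
      by (intro continuous_on_mult Yc) (auto simp: mono_fun_3[abs_def] intro!: continuous_intros)
    let ?g = "\<lambda>w. poly (axial_poly \<mu> l k) w * w ^ e 3"
    have "ball_integral \<mu> (\<lambda>x. ?Y x * mono_fun e x) = wint (\<mu> + 1/2) (\<mu> + 1/2)
        (\<lambda>w. (?g w * sqrt (1 - w\<^sup>2) ^ (k + e 1 + e 2)) * disk_integral \<mu> (\<lambda>z. F z * G z))"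
      unfolding ball_integral_iterated[OF mu c, of \<theta>]
    proof (rule wint_cong)
      fix w :: real assume w: "w \<in> {-1..1}"
      let ?s = "sqrt (1 - w\<^sup>2)"
      have pt: "?Y (ball_pt \<theta> w t \<sigma>) * mono_fun e (ball_pt \<theta> w t \<sigma>) = (?g w * ?s ^ (k + e 1 + e 2)) *
          (F (Complex t (sqrt (1 - t\<^sup>2) * \<sigma>)) * G (Complex t (sqrt (1 - t\<^sup>2) * \<sigma>)))" for t \<sigma>
      proof -
        let ?z = "Complex t (sqrt (1 - t\<^sup>2) * \<sigma>)"
        have z: "planar_part (ball_pt \<theta> w t \<sigma>) = of_real ?s * (cis \<theta> * ?z)" by (rule ball_pt_parts)
        have 1: "ball_pt \<theta> w t \<sigma> $ 1 = ?s * Re (cis \<theta> * ?z)"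
          using arg_cong[OF z, of Re] unfolding planar_part_def complex.sel by simp
        have 2: "ball_pt \<theta> w t \<sigma> $ 2 = ?s * Im (cis \<theta> * ?z)"
          using arg_cong[OF z, of Im] unfolding planar_part_def complex.sel by simp
        show ?thesis
          unfolding mono_fun_3 1 2 ball_pt_parts(1) Qb[OF w] G_def
          by (simp only: power_mult_distrib power_add mult_ac)
      qed
      show "wint \<mu> \<mu> (\<lambda>t. wint (\<mu> - 1/2) (\<mu> - 1/2) (\<lambda>\<sigma>. ?Y (ball_pt \<theta> w t \<sigma>) * mono_fun e (ball_pt \<theta> w t \<sigma>))) =
        (?g w * ?s ^ (k + e 1 + e 2)) * disk_integral \<mu> (\<lambda>z. F z * G z)"
        unfolding pt wint_cmult disk_integral_def ..
    qed
    then have bi: "ball_integral \<mu> (\<lambda>x. ?Y x * mono_fun e x) =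
        wint (\<mu> + 1/2) (\<mu> + 1/2) (\<lambda>w. ?g w * sqrt (1 - w\<^sup>2) ^ (k + e 1 + e 2)) * disk_integral \<mu> (\<lambda>z. F z * G z)"
      by (simp only: wint_cmult_right)
    have "ball_integral \<mu> (\<lambda>x. ?Y x * mono_fun e x) = 0"
    proof (cases "e 1 + e 2 < k")
      case True
      then show ?thesis unfolding bi orth[OF cG True] by simp
    next
      case ge: False
      show ?thesis
      proof (cases "even (k + e 1 + e 2)")
        case False
        have "(\<lambda>z. F (- z) * G (- z)) = (\<lambda>z. (-1) ^ (k + e 1 + e 2) * (F z * G z))"
        proof
          fix z
          have "Re (cis \<theta> * - z) = - 1 * Re (cis \<theta> * z)" "Im (cis \<theta> * - z) = - 1 * Im (cis \<theta> * z)" by simp_all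
          then show "F (- z) * G (- z) = (-1) ^ (k + e 1 + e 2) * (F z * G z)"
            unfolding par G_def by (simp only: power_mult_distrib power_add mult_ac)
        qed
        then have "disk_integral \<mu> (\<lambda>z. F z * G z) = (-1) ^ (k + e 1 + e 2) * disk_integral \<mu> (\<lambda>z. F z * G z)"
          using disk_integral_reflect[of \<mu> "\<lambda>z. F z * G z"] by (simp only: disk_integral_cmult)
        then have "disk_integral \<mu> (\<lambda>z. F z * G z) = 0" using False by simp
        then show ?thesis unfolding bi by simp
      next
        case True
        with ge obtain m where m: "e 1 + e 2 = k + 2 * m"
          by (metis add.assoc even_add even_diff_nat dvd_def le_add_diff_inverse not_less)
        have k2: "k + e 1 + e 2 = 2 * (k + m)" using m by simp
        let ?q = "[:1, 0, -1:] ^ m * [:0, 1:] ^ e 3 :: real poly"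
        have "wint (\<mu> + 1/2) (\<mu> + 1/2) (\<lambda>w. ?g w * sqrt (1 - w\<^sup>2) ^ (k + e 1 + e 2)) =
          wint (\<mu> + 1/2) (\<mu> + 1/2) (\<lambda>w. (?g w * (1 - w\<^sup>2) ^ m) * sqrt (1 - w\<^sup>2) ^ (2 * k))"
        proof (rule wint_cong)
          fix w :: real assume w: "w \<in> {-1..1}"
          have "sqrt (1 - w\<^sup>2) ^ (2 * (k + m)) = sqrt (1 - w\<^sup>2) ^ (2 * k) * ((sqrt (1 - w\<^sup>2))\<^sup>2) ^ m"
            by (simp add: distrib_left power_add power_mult)
          then show "?g w * sqrt (1 - w\<^sup>2) ^ (k + e 1 + e 2) = (?g w * (1 - w\<^sup>2) ^ m) * sqrt (1 - w\<^sup>2) ^ (2 * k)"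
            using sqrt_one_minus_nonneg[OF w] unfolding k2 by (simp add: mult_ac)
        qed
        also have "\<dots> = wint (\<mu> + 1/2 + real k) (\<mu> + 1/2 + real k) (\<lambda>w. ?g w * (1 - w\<^sup>2) ^ m)"
          by (rule wint_sqrt_shift)
        also have "(\<lambda>w. ?g w * (1 - w\<^sup>2) ^ m) = poly (axial_poly \<mu> l k * ?q)"
          by (simp add: poly_ops power2_eq_square fun_eq_iff mult_ac)
        also have "wint (\<mu> + 1/2 + real k) (\<mu> + 1/2 + real k) \<dots> = 0"
        proof (rule axial_poly_facts(3)[OF mu], rule disjI2)
          \<comment> \<open>\<open>e 1 + e 2 + e 3 < l\<close> and
            \<open>e 1 + e 2 = k + 2 * m\<close> leave \<open>2 * m + e 3 < l - k\<close>.\<close>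
          have "degree ?q \<le> 2 * m + e 3"
            by (intro order_trans[OF degree_mult_le] add_mono order_trans[OF degree_power_le]) auto
          then show "degree ?q < l - k" using m e by simp
        qed
        finally show ?thesis unfolding bi by simp
      qed
    qed
    then show ?thesis by (simp add: ball_inner_ball_integral)
  qed
  show ?thesis unfolding ball_V_iff[OF mu]
  proof (intro conjI allI impI YP)
    fix r assume r: "lower_poly l r"
    show "ball_inner \<mu> ?Y r = 0"
    proof (cases "r = (\<lambda>x. 0)")
      case True
      then show ?thesis by simp
    next
      case False
      then obtain m c where m: "m < l" and rc: "r = (\<lambda>x. \<Sum>e\<in>exponents m. c e * mono_fun e x)"
        using r unfolding lower_poly_def polys_le_iff by blast
      have "ball_inner \<mu> ?Y r = (\<Sum>e\<in>exponents m. ball_inner \<mu> ?Y (\<lambda>x. c e * mono_fun e x))"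
        unfolding rc
        by (rule inner_sum_right[OF mu continuous_ball_L2[OF mu Yc]])
           (auto simp: mono_fun_3[abs_def] intro!: continuous_intros)
      also have "\<dots> = 0"
      proof (intro sum.neutral ballI)
        fix e :: "3 \<Rightarrow> nat" assume "e \<in> exponents m"
        then have "e 1 + e 2 + e 3 < l" using m by (simp add: sum_3)
        then show "ball_inner \<mu> ?Y (\<lambda>x. c e * mono_fun e x) = 0"
          unfolding inner_cmult_right by (simp add: mono)
      qed
      finally show ?thesis .
    qed
  qed
qed

definition ball_basis :: "real \<Rightarrow> nat \<Rightarrow> nat \<times> nat \<times> nat \<Rightarrow> real^3 \<Rightarrow> real" where
  "ball_basis \<mu> l = (\<lambda>(k, i, \<epsilon>) x. poly (axial_poly \<mu> l k) (x $ 3) * disk_hom \<mu> k i \<epsilon> (1 - (x $ 3)\<^sup>2) (planar_part x))"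

definition ball_index :: "nat \<Rightarrow> (nat \<times> nat \<times> nat) set" where
  "ball_index l = {(k, i, \<epsilon>). k \<le> l \<and> \<epsilon> \<in> {0, 1} \<and> 2 * i + \<epsilon> \<le> k}"

lemma disk_hom_polys_le:
  assumes k: "2 * i \<le> k" "\<epsilon> < 2"
  shows "(\<lambda>x::real^3. disk_hom \<mu> k i \<epsilon> (1 - (x $ 3)\<^sup>2) (planar_part x)) \<in> polys_le k"
proof -
  have s: "(\<lambda>x::real^3. 1 - (x $ 3)\<^sup>2) \<in> polys_le 2"
    using polys_le_diff[OF polys_le_const polys_le_power[OF polys_le_coord, of 3 2]] by simp
  have z: "(\<lambda>x. (cmod (planar_part x))\<^sup>2) \<in> polys_le 2" by (rule planar_poly_polys_le[OF planar_poly_cmod_sq])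
  have "(\<lambda>x::real^3. coeff (jacobi_shift \<mu> (k - 2 * i) i) m * cmod (planar_part x) ^ (2 * m) * (1 - (x $ 3)\<^sup>2) ^ (i - m)) \<in> polys_le (2 * i)"
    if "m \<le> i" for m
  proof -
    have "(\<lambda>x::real^3. coeff (jacobi_shift \<mu> (k - 2 * i) i) m * (((cmod (planar_part x))\<^sup>2) ^ m * (1 - (x $ 3)\<^sup>2) ^ (i - m)))
        \<in> polys_le (2 * m + 2 * (i - m))"
      by (intro polys_le_scale polys_le_mult polys_le_power s z)
    moreover have "2 * m + 2 * (i - m) = 2 * i" using that by simp
    ultimately show ?thesis by (simp add: power_mult mult.assoc)
  qed
  then have "(\<lambda>x::real^3. \<Sum>m\<le>i. coeff (jacobi_shift \<mu> (k - 2 * i) i) m * cmod (planar_part x) ^ (2 * m) * (1 - (x $ 3)\<^sup>2) ^ (i - m)) \<in> polys_le (2 * i)"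
    by (intro polys_le_sum) auto
  from polys_le_mult[OF polys_le_scale[OF this, of "disk_h \<mu> i k"] planar_poly_polys_le[OF planar_poly_harm[OF k(2)], of "k - 2 * i"]]
  show ?thesis using k by (simp add: disk_hom_def)
qed

lemma disk_hom_ball_pt:
  assumes k: "2 * i \<le> k" and w: "w \<in> {-1..1}"
  shows "disk_hom \<mu> k i \<epsilon> (1 - (ball_pt \<theta> w t \<sigma> $ 3)\<^sup>2) (planar_part (ball_pt \<theta> w t \<sigma>)) =
    sqrt (1 - w\<^sup>2) ^ k * disk_hom \<mu> k i \<epsilon> 1 (cis \<theta> * Complex t (sqrt (1 - t\<^sup>2) * \<sigma>))"
  using disk_hom_scale[OF k, of \<mu> \<epsilon> "sqrt (1 - w\<^sup>2)" 1] sqrt_one_minus_nonneg[OF w]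
  unfolding ball_pt_parts by simp

lemma ball_basis_in_V:
  assumes mu: "\<mu> \<ge> 0" and j: "(k, i, \<epsilon>) \<in> ball_index l"
  shows "ball_basis \<mu> l (k, i, \<epsilon>) \<in> ball_V \<mu> l"
proof -
  have k: "k \<le> l" "2 * i \<le> k" "\<epsilon> < 2" using j by (auto simp: ball_index_def)
  have "(\<lambda>x. poly (axial_poly \<mu> l k) (x $ 3) * disk_hom \<mu> k i \<epsilon> (1 - (x $ 3)\<^sup>2) (planar_part x)) \<in> ball_V \<mu> l"
  proof (rule slice_product_in_V[OF mu k(1) disk_hom_polys_le[OF k(2,3)], where \<theta> = 0 and F = "disk_hom \<mu> k i \<epsilon> 1"])
    show "disk_hom \<mu> k i \<epsilon> (1 - (ball_pt 0 w t \<sigma> $ 3)\<^sup>2) (planar_part (ball_pt 0 w t \<sigma>)) =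
      sqrt (1 - w\<^sup>2) ^ k * disk_hom \<mu> k i \<epsilon> 1 (Complex t (sqrt (1 - t\<^sup>2) * \<sigma>))" if "w \<in> {-1..1}" for w t \<sigma>
      using disk_hom_ball_pt[OF k(2) that, of \<mu> \<epsilon> 0] by simp
    show "disk_integral \<mu> (\<lambda>z. disk_hom \<mu> k i \<epsilon> 1 z * G z) = 0" if "planar_poly d G" "d < k" for d G
      by (rule disk_hom_orth_planar_poly[OF mu k(2,3) that])
    show "disk_hom \<mu> k i \<epsilon> 1 (- z) = (-1) ^ k * disk_hom \<mu> k i \<epsilon> 1 z" for z
      using disk_hom_scale[OF k(2), of \<mu> \<epsilon> "-1" 1 z] by simp
  qed
  then show ?thesis by (simp add: ball_basis_def)
qed

text \<open>
  \<open>(1 - x\<^sub>3\<^sup>2)\<^sup>k\<^sup>/\<^sup>2 C\<^sub>k((x\<^sub>1 cos \<xi> + x\<^sub>2 sin \<xi>) / (1 - x\<^sub>3\<^sup>2)\<^sup>1\<^sup>/\<^sup>2)\<close> as a polynomial.  The truncating \<open>div\<close> is harmless: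
  for odd \<open>k - m\<close> the coefficient vanishes by parity.
\<close>

definition ridge_hom :: "real \<Rightarrow> nat \<Rightarrow> real \<Rightarrow> real^3 \<Rightarrow> real" where
  "ridge_hom \<mu> k \<xi> x = (\<Sum>m\<le>k. coeff (gegenbauer_poly (\<mu> + 1/2) k) m *
     (Re (cis (- \<xi>) * planar_part x) ^ m * (1 - (x $ 3)\<^sup>2) ^ ((k - m) div 2)))"

lemma gegenbauer_coeff_parity:
  assumes l: "lam > 0" and m: "odd (k + m)"
  shows "coeff (gegenbauer_poly lam k) m = 0"
proof -
  let ?C = "gegenbauer_poly lam k"
  have "poly (pcompose ?C [:0, -1:]) = poly (smult ((-1) ^ k) ?C)"
    using gegenbauer_parity[OF l, of k] by (auto simp: fun_eq_iff poly_pcompose)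
  then have "pcompose ?C [:0, -1:] = smult ((-1) ^ k) ?C" by (simp only: poly_eq_poly_eq_iff)
  then have "coeff (pcompose ?C [:0, -1:]) m = (-1) ^ k * coeff ?C m" by simp
  then have "(-1) ^ m * coeff ?C m = (-1) ^ k * coeff ?C m" by (simp add: coeff_pcompose_linear)
  then show ?thesis using m by (cases "even k"; cases "even m") auto
qed

text \<open>Free of division by \<open>s\<close>, so that the poles with \<open>s = 0\<close> are
  included. Terms of the wrong parity have coefficient 0; in the others \<open>s ^ m\<close> and
  \<open>s ^ (k - m)\<close> combine to \<open>s ^ k\<close>.\<close>

lemma ridge_hom_eq:
  assumes mu: "\<mu> \<ge> 0" and x: "1 - (x $ 3)\<^sup>2 = s\<^sup>2" and r: "Re (cis (- \<xi>) * planar_part x) = s * t"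
  shows "ridge_hom \<mu> k \<xi> x = s ^ k * gegenbauer k (\<mu> + 1/2) t"
proof -
  let ?C = "gegenbauer_poly (\<mu> + 1/2) k"
  have lam: "\<mu> + 1/2 > 0" using mu by simp
  have "ridge_hom \<mu> k \<xi> x = (\<Sum>m\<le>k. s ^ k * (coeff ?C m * t ^ m))"
    unfolding ridge_hom_def x r
  proof (rule sum.cong[OF refl])
    fix m assume "m \<in> {..k}"
    then have m: "m \<le> k" by simp
    show "coeff ?C m * ((s * t) ^ m * (s\<^sup>2) ^ ((k - m) div 2)) = s ^ k * (coeff ?C m * t ^ m)"
    proof (cases "even (k + m)")
      case True
      then have "2 * ((k - m) div 2) = k - m" using m by simp
      then have "(s\<^sup>2) ^ ((k - m) div 2) = s ^ (k - m)" by (simp flip: power_mult)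
      moreover have "s ^ k = s ^ m * s ^ (k - m)" using m by (simp flip: power_add)
      ultimately show ?thesis by (simp only: power_mult_distrib mult_ac)
    next
      case False
      then show ?thesis using gegenbauer_coeff_parity[OF lam, of k m] by simp
    qed
  qed
  also have "\<dots> = s ^ k * gegenbauer k (\<mu> + 1/2) t"
    using gegenbauer_poly_facts(1)[OF lam, of k]
    by (simp add: gegenbauer_def poly_altdef sum_distrib_left)
  finally show ?thesis .
qed

lemma ridge_hom_ball_pt:
  assumes mu: "\<mu> \<ge> 0" and w: "w \<in> {-1..1}"
  shows "ridge_hom \<mu> k \<xi> (ball_pt \<xi> w t \<sigma>) = sqrt (1 - w\<^sup>2) ^ k * gegenbauer k (\<mu> + 1/2) t"
proof (rule ridge_hom_eq[OF mu])
  show "1 - (ball_pt \<xi> w t \<sigma> $ 3)\<^sup>2 = (sqrt (1 - w\<^sup>2))\<^sup>2"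
    using sqrt_one_minus_nonneg[OF w] by (simp add: ball_pt_parts)
  have "cis (- \<xi>) * planar_part (ball_pt \<xi> w t \<sigma>) = (cis (- \<xi>) * cis \<xi>) * (of_real (sqrt (1 - w\<^sup>2)) * Complex t (sqrt (1 - t\<^sup>2) * \<sigma>))"
    unfolding ball_pt_parts by (simp only: mult_ac)
  also have "cis (- \<xi>) * cis \<xi> = 1" by (simp add: cis_mult)
  finally show "Re (cis (- \<xi>) * planar_part (ball_pt \<xi> w t \<sigma>)) = sqrt (1 - w\<^sup>2) * t" by simp
qed

lemma ridge_hom_polys_le: "ridge_hom \<mu> k \<xi> \<in> polys_le k"
proof -
  have s: "(\<lambda>x::real^3. 1 - (x $ 3)\<^sup>2) \<in> polys_le 2"
    using polys_le_diff[OF polys_le_const polys_le_power[OF polys_le_coord, of 3 2]] by simp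
  have "(\<lambda>x. coeff (gegenbauer_poly (\<mu> + 1/2) k) m *
     (Re (cis (- \<xi>) * planar_part x) ^ m * (1 - (x $ 3)\<^sup>2) ^ ((k - m) div 2))) \<in> polys_le k" if "m \<le> k" for m
  proof -
    have "(\<lambda>x. Re (cis (- \<xi>) * planar_part x) ^ m * (1 - (x $ 3)\<^sup>2) ^ ((k - m) div 2)) \<in> polys_le (1 * m + 2 * ((k - m) div 2))"
      by (intro polys_le_mult polys_le_power s planar_poly_polys_le planar_poly_linear)
    moreover have "1 * m + 2 * ((k - m) div 2) \<le> k" using that by linarith
    ultimately show ?thesis by (intro polys_le_scale) (rule polys_le_mono)
  qed
  then show ?thesis unfolding ridge_hom_def[abs_def] by (intro polys_le_sum) auto
qed

text \<open>Integration along chords comes first: the chord integral of \<open>G\<close> is a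
  polynomial in \<open>t\<close> of degree below \<open>k\<close>, and the weight in
  \<open>t\<close> is the one of the Gegenbauer polynomial.\<close>

lemma gegenbauer_orth_planar_poly:
  assumes mu: "\<mu> \<ge> 0" and G: "planar_poly d G" "d < k"
  shows "disk_integral \<mu> (\<lambda>z. gegenbauer k (\<mu> + 1/2) (Re z) * G z) = 0"
proof -
  have lam: "\<mu> + 1/2 > 0" using mu by simp
  obtain A where A: "degree A \<le> d" "\<And>t. t \<in> {-1..1} \<Longrightarrow> chord_integral \<mu> G t = poly A t"
    using inner_integral_poly[OF mu G(1)] by blast
  have "disk_integral \<mu> (\<lambda>z. gegenbauer k (\<mu> + 1/2) (Re z) * G z) = wpoly \<mu> \<mu> (gegenbauer_poly (\<mu> + 1/2) k * A)"
    unfolding disk_integral_def poly_ops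
  proof (rule wint_cong)
    fix t :: real assume "t \<in> {-1..1}"
    then have "gegenbauer k (\<mu> + 1/2) t * chord_integral \<mu> G t = poly (gegenbauer_poly (\<mu> + 1/2) k) t * poly A t"
      by (simp only: A(2) gegenbauer_def)
    then show "wint (\<mu> - 1/2) (\<mu> - 1/2) (\<lambda>\<sigma>. gegenbauer k (\<mu> + 1/2) (Re (Complex t (sqrt (1 - t\<^sup>2) * \<sigma>))) *
        G (Complex t (sqrt (1 - t\<^sup>2) * \<sigma>))) = poly (gegenbauer_poly (\<mu> + 1/2) k) t * poly A t"
      unfolding chord_integral_def complex.sel wint_cmult .
  qed
  also have "\<dots> = 0"
    using gegenbauer_poly_facts(3)[OF lam, of A k] A(1) G(2) by simp
  finally show ?thesis .
qed

lemma ridge_hom_in_V: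
  assumes mu: "\<mu> \<ge> 0" and k: "k \<le> l"
  shows "(\<lambda>x. poly (axial_poly \<mu> l k) (x $ 3) * ridge_hom \<mu> k \<xi> x) \<in> ball_V \<mu> l"
proof (rule slice_product_in_V[OF mu k ridge_hom_polys_le, where \<theta> = \<xi> and F = "\<lambda>z. gegenbauer k (\<mu> + 1/2) (Re z)"])
  show "ridge_hom \<mu> k \<xi> (ball_pt \<xi> w t \<sigma>) = sqrt (1 - w\<^sup>2) ^ k * gegenbauer k (\<mu> + 1/2) (Re (Complex t (sqrt (1 - t\<^sup>2) * \<sigma>)))"
    if "w \<in> {-1..1}" for w t \<sigma> using ridge_hom_ball_pt[OF mu that] by simp
  show "disk_integral \<mu> (\<lambda>z. gegenbauer k (\<mu> + 1/2) (Re z) * G z) = 0" if "planar_poly d G" "d < k" for d G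
    by (rule gegenbauer_orth_planar_poly[OF mu that])
  show "gegenbauer k (\<mu> + 1/2) (Re (- z)) = (-1) ^ k * gegenbauer k (\<mu> + 1/2) (Re z)" for z
    using gegenbauer_parity[of "\<mu> + 1/2" k "Re z"] mu by (simp add: gegenbauer_def)
qed

section \<open>Pairing the basis with ridge polynomials\<close>

text \<open>The origin of \<open>hsq\<close>: it is the axial mass for \<open>k = 0\<close> divided
  by the one for \<open>k\<close>. The former, together with \<open>pi\<close>, cancels
  \<open>ball_const\<close> up to the factor \<open>\<mu> + 1/2\<close>.\<close>

lemma normalization_constant:
  assumes mu: "\<mu> \<ge> 0"
  shows "ball_const \<mu> * (wint (\<mu> + 1/2 + real k) (\<mu> + 1/2 + real k) (\<lambda>_. 1) * pi) = (\<mu> + 1/2) / hsq \<mu> k"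
proof -
  have w: "wint (\<mu> + 1/2 + real k) (\<mu> + 1/2 + real k) (\<lambda>_. 1) = sqrt pi * Gamma (\<mu> + 3/2 + real k) / Gamma (\<mu> + 2 + real k)"
  proof -
    have e: "\<mu> + 1/2 + real k + 1 = \<mu> + 3/2 + real k" "\<mu> + 1/2 + real k + 3/2 = \<mu> + 2 + real k" by simp_all
    have "\<mu> + 1/2 + real k > -1" using mu by simp
    from wint_same_one[OF this] show ?thesis unfolding e .
  qed
  have nz: "\<mu> + 3/2 \<notin> \<int>\<^sub>\<le>\<^sub>0" "\<mu> + 2 \<notin> \<int>\<^sub>\<le>\<^sub>0" "\<mu> + 1/2 \<notin> \<int>\<^sub>\<le>\<^sub>0"
    using mu by (auto dest!: nonpos_Ints_nonpos)
  have G: "Gamma (\<mu> + 3/2) > 0" "Gamma (\<mu> + 2) > 0" "Gamma (\<mu> + 1/2) > 0" using mu by (auto intro!: Gamma_real_pos)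
  have P: "pochhammer (\<mu> + 3/2) k > 0" "pochhammer (\<mu> + 2) k > 0" using mu by (auto intro!: pochhammer_pos)
  have g1: "Gamma (\<mu> + 3/2 + real k) = pochhammer (\<mu> + 3/2) k * Gamma (\<mu> + 3/2)"
    using pochhammer_Gamma[OF nz(1), of k] G(1) by (simp add: field_simps)
  have g2: "Gamma (\<mu> + 2 + real k) = pochhammer (\<mu> + 2) k * Gamma (\<mu> + 2)"
    using pochhammer_Gamma[OF nz(2), of k] G(2) by (simp add: field_simps)
  have g3: "Gamma (\<mu> + 3/2) = (\<mu> + 1/2) * Gamma (\<mu> + 1/2)"
    using Gamma_plus1[OF nz(3)] by (simp add: add.commute)
  have pp: "pi powr (3/2) = pi * sqrt pi"
  proof -
    have "pi powr (3/2) = pi powr (1 + 1/2)" by simp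
    then show ?thesis by (simp only: powr_add) (simp add: powr_half_sqrt)
  qed
  have "(a / (p * s * b)) * (s * (c * (m * b)) / (d * a) * p) = m / (d / c)"
    if "a \<noteq> 0" "b \<noteq> 0" "c \<noteq> 0" "d \<noteq> 0" "p \<noteq> 0" "s \<noteq> 0" for a b c d m p s :: real
    using that by simp
  from this[of "Gamma (\<mu> + 2)" "Gamma (\<mu> + 1/2)" "pochhammer (\<mu> + 3/2) k" "pochhammer (\<mu> + 2) k" pi "sqrt pi" "\<mu> + 1/2"]
  show ?thesis
    unfolding w ball_const_def hsq_def g1 g2 g3 pp using G P by auto
qed

text \<open>Chord coordinates in the direction \<open>\<xi>\<close> make the ridge polynomial a
  function of \<open>w\<close> and \<open>t\<close>, so the integral is an axial integral times
  \<open>disk_hom_ridge\<close>. The latter separates different \<open>k\<close>; for equal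
  \<open>k\<close> the axial integral is the norm of \<open>axial_poly\<close>.\<close>

lemma ball_basis_ridge_hom_inner:
  assumes mu: "\<mu> \<ge> 0" and j: "(k', i', \<epsilon>') \<in> ball_index l" and k: "k \<le> l"
  shows "ball_inner \<mu> (ball_basis \<mu> l (k', i', \<epsilon>')) (\<lambda>x. poly (axial_poly \<mu> l k) (x $ 3) * ridge_hom \<mu> k \<xi> x) =
    (if k = k' then (\<mu> + 1/2) / (real k + \<mu> + 1/2) / hsq \<mu> k * disk_hom \<mu> k i' \<epsilon>' 1 (cis \<xi>) else 0)"
proof -
  have k': "k' \<le> l" "2 * i' \<le> k'" "\<epsilon>' < 2" using j by (auto simp: ball_index_def)
  let ?Y = "ball_basis \<mu> l (k', i', \<epsilon>')" and ?Z = "\<lambda>x. poly (axial_poly \<mu> l k) (x $ 3) * ridge_hom \<mu> k \<xi> x"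
  have c: "continuous_on UNIV (\<lambda>x. ?Y x * ?Z x)"
    by (intro continuous_on_mult ball_V_continuous[OF mu ball_basis_in_V[OF mu j]] polys_le_continuous[OF ridge_hom_polys_le])
       (intro continuous_intros)
  let ?I = "disk_integral \<mu> (\<lambda>z. disk_hom \<mu> k' i' \<epsilon>' 1 (cis \<xi> * z) * gegenbauer k (\<mu> + 1/2) (Re z))"
  have "ball_integral \<mu> (\<lambda>x. ?Y x * ?Z x) = wint (\<mu> + 1/2) (\<mu> + 1/2)
     (\<lambda>w. (poly (axial_poly \<mu> l k' * axial_poly \<mu> l k) w * sqrt (1 - w\<^sup>2) ^ (k' + k)) * ?I)"
    unfolding ball_integral_iterated[OF mu c, of \<xi>]
  proof (rule wint_cong)
    fix w :: real assume w: "w \<in> {-1..1}"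
    have pt: "?Y (ball_pt \<xi> w t \<sigma>) * ?Z (ball_pt \<xi> w t \<sigma>) = (poly (axial_poly \<mu> l k' * axial_poly \<mu> l k) w * sqrt (1 - w\<^sup>2) ^ (k' + k)) *
      (disk_hom \<mu> k' i' \<epsilon>' 1 (cis \<xi> * Complex t (sqrt (1 - t\<^sup>2) * \<sigma>)) * gegenbauer k (\<mu> + 1/2) (Re (Complex t (sqrt (1 - t\<^sup>2) * \<sigma>))))"
      for t \<sigma>
      unfolding ball_basis_def case_prod_conv ball_pt_parts(1) disk_hom_ball_pt[OF k'(2) w, unfolded ball_pt_parts(1)] ridge_hom_ball_pt[OF mu w] complex.sel
      by (simp add: power_add mult_ac)
    show "wint \<mu> \<mu> (\<lambda>t. wint (\<mu> - 1/2) (\<mu> - 1/2) (\<lambda>\<sigma>. ?Y (ball_pt \<xi> w t \<sigma>) * ?Z (ball_pt \<xi> w t \<sigma>))) =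
       (poly (axial_poly \<mu> l k' * axial_poly \<mu> l k) w * sqrt (1 - w\<^sup>2) ^ (k' + k)) * ?I"
      unfolding pt wint_cmult disk_integral_def ..
  qed
  then have bi: "ball_integral \<mu> (\<lambda>x. ?Y x * ?Z x) = wint (\<mu> + 1/2) (\<mu> + 1/2)
     (\<lambda>w. poly (axial_poly \<mu> l k' * axial_poly \<mu> l k) w * sqrt (1 - w\<^sup>2) ^ (k' + k)) * ?I"
    by (simp only: wint_cmult_right)
  show ?thesis
  proof (cases "k = k'")
    case False
    then show ?thesis unfolding ball_inner_ball_integral bi disk_hom_ridge[OF mu k'(2,3)] by auto
  next
    case True
    have "wint (\<mu> + 1/2) (\<mu> + 1/2) (\<lambda>w. poly (axial_poly \<mu> l k * axial_poly \<mu> l k) w * sqrt (1 - w\<^sup>2) ^ (2 * k)) =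
        wint (\<mu> + 1/2 + real k) (\<mu> + 1/2 + real k) (\<lambda>_. 1)"
      unfolding wint_sqrt_shift axial_poly_facts(4)[OF mu] ..
    then have "ball_integral \<mu> (\<lambda>x. ?Y x * ?Z x) = wint (\<mu> + 1/2 + real k) (\<mu> + 1/2 + real k) (\<lambda>_. 1) *
        (pi / (real k + \<mu> + 1/2) * disk_hom \<mu> k i' \<epsilon>' 1 (cis \<xi>))"
      unfolding bi disk_hom_ridge[OF mu k'(2,3)] using True by (simp add: mult_2[symmetric])
    then have "ball_inner \<mu> ?Y ?Z = (ball_const \<mu> * (wint (\<mu> + 1/2 + real k) (\<mu> + 1/2 + real k) (\<lambda>_. 1) * pi)) *
        (disk_hom \<mu> k i' \<epsilon>' 1 (cis \<xi>) / (real k + \<mu> + 1/2))"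
      unfolding ball_inner_ball_integral by simp
    then show ?thesis unfolding normalization_constant[OF mu] using True by simp
  qed
qed

section \<open>The basis spans the space\<close>

lemma finite_ball_index: "finite (ball_index l)"
  by (rule finite_subset[of _ "{..l} \<times> {..l} \<times> {0, 1}"]) (auto simp: ball_index_def)

text \<open>Working modulo lower degrees leaves only leading terms to be matched;
  \<open>V_span\<close> removes the remainder by orthogonality.\<close>

definition spanned :: "real \<Rightarrow> nat \<Rightarrow> (real^3 \<Rightarrow> real) \<Rightarrow> bool" where
  "spanned \<mu> l q \<longleftrightarrow> (\<exists>c r. q = (\<lambda>x. (\<Sum>j\<in>ball_index l. c j * ball_basis \<mu> l j x) + r x) \<and> lower_poly l r)"

lemma spanned_I: "q = (\<lambda>x. (\<Sum>j\<in>ball_index l. c j * ball_basis \<mu> l j x) + r x) \<Longrightarrow> lower_poly l r \<Longrightarrow> spanned \<mu> l q"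
  unfolding spanned_def by blast

lemma spanned_add: "spanned \<mu> l p \<Longrightarrow> spanned \<mu> l q \<Longrightarrow> spanned \<mu> l (\<lambda>x. p x + q x)"
proof -
  assume "spanned \<mu> l p" "spanned \<mu> l q"
  then obtain c r d s where p: "p = (\<lambda>x. (\<Sum>j\<in>ball_index l. c j * ball_basis \<mu> l j x) + r x)" "lower_poly l r"
    and q: "q = (\<lambda>x. (\<Sum>j\<in>ball_index l. d j * ball_basis \<mu> l j x) + s x)" "lower_poly l s" unfolding spanned_def by blast
  show ?thesis
  proof (rule spanned_I)
    show "(\<lambda>x. p x + q x) = (\<lambda>x. (\<Sum>j\<in>ball_index l. (c j + d j) * ball_basis \<mu> l j x) + (r x + s x))"
      unfolding p(1) q(1) by (simp add: fun_eq_iff distrib_right sum.distrib)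
    show "lower_poly l (\<lambda>x. r x + s x)" by (rule lower_poly_add[OF p(2) q(2)])
  qed
qed

lemma spanned_scale: "spanned \<mu> l p \<Longrightarrow> spanned \<mu> l (\<lambda>x. a * p x)"
proof -
  assume "spanned \<mu> l p"
  then obtain c r where p: "p = (\<lambda>x. (\<Sum>j\<in>ball_index l. c j * ball_basis \<mu> l j x) + r x)" "lower_poly l r" unfolding spanned_def by blast
  show ?thesis
  proof (rule spanned_I)
    show "(\<lambda>x. a * p x) = (\<lambda>x. (\<Sum>j\<in>ball_index l. (a * c j) * ball_basis \<mu> l j x) + a * r x)"
      unfolding p(1) by (simp add: fun_eq_iff distrib_left sum_distrib_left mult.assoc)
    show "lower_poly l (\<lambda>x. a * r x)" by (rule lower_poly_scale[OF p(2)])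
  qed
qed

lemma spanned_low: "lower_poly l r \<Longrightarrow> spanned \<mu> l r"
  by (rule spanned_I[where c = "\<lambda>_. 0"]) auto

lemma spanned_sum: "(\<And>i. i \<in> A \<Longrightarrow> spanned \<mu> l (p i)) \<Longrightarrow> spanned \<mu> l (\<lambda>x. \<Sum>i\<in>A. p i x)"
  by (induction A rule: infinite_finite_induct) (auto intro: spanned_add spanned_low simp: lower_poly_def)

lemma spanned_ball_basis: "j \<in> ball_index l \<Longrightarrow> spanned \<mu> l (ball_basis \<mu> l j)"
proof (rule spanned_I)
  assume j: "j \<in> ball_index l"
  show "ball_basis \<mu> l j = (\<lambda>x. (\<Sum>j'\<in>ball_index l. (if j' = j then 1 else 0) * ball_basis \<mu> l j' x) + (\<lambda>_. 0) x)"
  proof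
    fix x
    have "(\<Sum>j'\<in>ball_index l. (if j' = j then 1 else 0) * ball_basis \<mu> l j' x) = (\<Sum>j'\<in>ball_index l. if j' = j then ball_basis \<mu> l j' x else 0)"
      by (rule sum.cong) auto
    then show "ball_basis \<mu> l j x = (\<Sum>j'\<in>ball_index l. (if j' = j then 1 else 0) * ball_basis \<mu> l j' x) + (\<lambda>_. 0) x"
      using j finite_ball_index by simp
  qed
qed (simp add: lower_poly_def)

lemma disk_h_pos: "\<mu> \<ge> 0 \<Longrightarrow> disk_h \<mu> i k > 0"
  unfolding disk_h_def disk_d_def real_sqrt_gt_0_iff
  by (intro mult_pos_pos divide_pos_pos Gamma_real_pos) auto

definition cyl_monomial :: "nat \<Rightarrow> nat \<Rightarrow> nat \<Rightarrow> nat \<Rightarrow> real^3 \<Rightarrow> real" where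
  "cyl_monomial m j \<epsilon> e x = cmod (planar_part x) ^ (2 * m) * harm j \<epsilon> (planar_part x) * (x $ 3) ^ e"

lemma cyl_monomial_polys_le: "\<epsilon> < 2 \<Longrightarrow> cyl_monomial m j \<epsilon> e \<in> polys_le (2 * m + j + e)"
proof -
  assume e: "\<epsilon> < 2"
  have "(\<lambda>x::real^3. ((cmod (planar_part x))\<^sup>2) ^ m * harm j \<epsilon> (planar_part x) * (x $ 3) ^ e) \<in> polys_le (2 * m + j + 1 * e)"
    by (intro polys_le_mult polys_le_power planar_poly_polys_le[OF planar_poly_cmod_sq] planar_poly_polys_le[OF planar_poly_harm[OF e]] polys_le_coord)
  then show ?thesis by (simp add: cyl_monomial_def[abs_def] power_mult)
qed

lemma cyl_monomial_low: "\<epsilon> < 2 \<Longrightarrow> 2 * m + j + e < l \<Longrightarrow> lower_poly l (cyl_monomial m j \<epsilon> e)"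
  unfolding lower_poly_def using cyl_monomial_polys_le by blast

text \<open>Triangularity in \<open>i\<close>. The basis function with \<open>k = 2 * i + j\<close>
  contains \<open>cyl_monomial i j \<epsilon> c\<close> with a nonzero coefficient; every other term
  has a smaller power of \<open>cmod z\<close>, treated by induction, or total degree below
  \<open>l\<close>.\<close>

lemma spanned_cyl_monomial:
  assumes mu: "\<mu> \<ge> 0"
  shows "2 * i + j + c = l \<Longrightarrow> \<epsilon> < 2 \<Longrightarrow> spanned \<mu> l (cyl_monomial i j \<epsilon> c)"
proof (induction i arbitrary: c rule: less_induct)
  case (less i)
  show ?case
  proof (cases "j = 0 \<and> \<epsilon> \<noteq> 0")
    \<comment> \<open>The sine of frequency 0 vanishes, and \<open>ball_index\<close> has no entry
      for it.\<close>
    case True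
    then have "cyl_monomial i j \<epsilon> c = (\<lambda>x. 0)" by (simp add: cyl_monomial_def[abs_def])
    then show ?thesis by (simp add: spanned_low lower_poly_def)
  next
    case False
    define k where "k = 2 * i + j"
    have k: "k - 2 * i = j" "l - k = c" "k \<le> l" using less.prems by (auto simp: k_def)
    have idx: "(k, i, \<epsilon>) \<in> ball_index l" using False less.prems by (auto simp: ball_index_def k_def)
    define p where "p m = axial_poly \<mu> l k * [:1, 0, -1:] ^ (i - m)" for m
    let ?q = "jacobi_shift \<mu> j i"
    let ?h = "disk_h \<mu> i k"
    have dp: "degree (p m) \<le> c + 2 * (i - m)" for m
      unfolding p_def by (intro order_trans[OF degree_mult_le] add_mono order_trans[OF degree_power_le])
        (auto simp: axial_poly_facts[OF mu] k)
    have exp: "(\<Sum>e\<le>c + 2 * (i - m). coeff (p m) e * cyl_monomial m j \<epsilon> e x) =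
        cmod (planar_part x) ^ (2 * m) * harm j \<epsilon> (planar_part x) * (poly (axial_poly \<mu> l k) (x $ 3) * (1 - (x $ 3)\<^sup>2) ^ (i - m))" for m x
    proof -
      have "(\<Sum>e\<le>c + 2 * (i - m). coeff (p m) e * (x $ 3) ^ e) = (\<Sum>e\<le>degree (p m). coeff (p m) e * (x $ 3) ^ e)"
        by (rule sum.mono_neutral_right) (use dp[of m] in \<open>auto intro: coeff_eq_0\<close>)
      also have "\<dots> = poly (p m) (x $ 3)" by (simp only: poly_altdef)
      also have "\<dots> = poly (axial_poly \<mu> l k) (x $ 3) * (1 - (x $ 3)\<^sup>2) ^ (i - m)"
        by (simp add: p_def poly_power power2_eq_square)
      finally show ?thesis unfolding cyl_monomial_def
        by (simp only: sum_distrib_left[symmetric] mult.left_commute[of "coeff _ _"])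
    qed
    have Yexp: "ball_basis \<mu> l (k, i, \<epsilon>) x = (\<Sum>m\<le>i. (?h * coeff ?q m) * (\<Sum>e\<le>c + 2 * (i - m). coeff (p m) e * cyl_monomial m j \<epsilon> e x))" for x
      unfolding exp ball_basis_def case_prod_conv disk_hom_def k(1) sum_distrib_left sum_distrib_right
      by (simp only: mult_ac)
    define R where "R = (\<lambda>x. (\<Sum>m<i. (?h * coeff ?q m) * (\<Sum>e\<le>c + 2 * (i - m). coeff (p m) e * cyl_monomial m j \<epsilon> e x)) +
       (?h * coeff ?q i) * (\<Sum>e<c. coeff (p i) e * cyl_monomial i j \<epsilon> e x))"
    have split: "ball_basis \<mu> l (k, i, \<epsilon>) x = R x + (?h * coeff ?q i * coeff (p i) c) * cyl_monomial i j \<epsilon> c x" for x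
    proof -
      have "(\<Sum>m\<le>i. A m) = (\<Sum>m<i. A m) + A i" for A :: "nat \<Rightarrow> real"
        by (metis lessThan_Suc_atMost sum.lessThan_Suc)
      moreover have "(\<Sum>e\<le>c. A e) = (\<Sum>e<c. A e) + A c" for A :: "nat \<Rightarrow> real"
        by (metis lessThan_Suc_atMost sum.lessThan_Suc)
      ultimately show ?thesis unfolding Yexp R_def by (simp add: distrib_left mult.assoc)
    qed
    have RS: "spanned \<mu> l R" unfolding R_def
    proof (intro spanned_add spanned_sum spanned_scale)
      fix m e assume m: "m \<in> {..<i}" and e: "e \<in> {..c + 2 * (i - m)}"
      show "spanned \<mu> l (cyl_monomial m j \<epsilon> e)"
      proof (cases "2 * m + j + e = l")
        case True
        then show ?thesis using less.IH[of m e] m less.prems by auto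
      next
        case False
        then have "2 * m + j + e < l" using m e less.prems by auto
        then show ?thesis by (intro spanned_low cyl_monomial_low less.prems)
      qed
    next
      fix e assume "e \<in> {..<c}"
      then show "spanned \<mu> l (cyl_monomial i j \<epsilon> e)" using less.prems by (intro spanned_low cyl_monomial_low) auto
    qed
    define a where "a = ?h * coeff ?q i * coeff (p i) c"
    \<comment> \<open>The factors are the positive \<open>disk_h\<close> and the leading
      coefficients of the Jacobi and the axial polynomial.\<close>
    have a: "a \<noteq> 0"
    proof -
      have "coeff ?q i \<noteq> 0" using jacobi_shift_facts(1,2)[OF mu, of j i] by (metis leading_coeff_0_iff)
      moreover have "coeff (p i) c \<noteq> 0"
        using axial_poly_facts(1,2)[OF mu, of l k] k by (simp add: p_def) (metis leading_coeff_0_iff)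
      ultimately show ?thesis using disk_h_pos[OF mu, of i k] by (simp add: a_def)
    qed
    have "cyl_monomial i j \<epsilon> c = (\<lambda>x. (1 / a) * (ball_basis \<mu> l (k, i, \<epsilon>) x + (-1) * R x))"
      unfolding split a_def[symmetric] using a by (simp add: fun_eq_iff)
    moreover have "spanned \<mu> l (\<lambda>x. (1 / a) * (ball_basis \<mu> l (k, i, \<epsilon>) x + (-1) * R x))"
      by (intro spanned_scale spanned_add spanned_ball_basis idx RS)
    ultimately show ?thesis by simp
  qed
qed

lemma spanned_harm_span:
  assumes mu: "\<mu> \<ge> 0"
  shows "harm_span d F \<Longrightarrow> d + c = l \<Longrightarrow> spanned \<mu> l (\<lambda>x. F (planar_part x) * (x $ 3) ^ c)"
proof (induction rule: harm_span.induct)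
  case (base i j d \<epsilon> b)
  have "spanned \<mu> l (\<lambda>x. b * cyl_monomial i j \<epsilon> c x)" by (intro spanned_scale spanned_cyl_monomial[OF mu]) (use base in auto)
  then show ?case by (simp add: cyl_monomial_def mult.assoc)
next
  case (add d F G)
  then have "spanned \<mu> l (\<lambda>x. F (planar_part x) * (x $ 3) ^ c + G (planar_part x) * (x $ 3) ^ c)" by (intro spanned_add) auto
  then show ?case by (simp add: distrib_right)
qed

lemma spanned_polys_le:
  assumes mu: "\<mu> \<ge> 0" and q: "q \<in> polys_le l"
  shows "spanned \<mu> l q"
proof -
  obtain c where qc: "q = (\<lambda>x. \<Sum>e\<in>exponents l. c e * mono_fun e x)" using q unfolding polys_le_iff by blast
  have "spanned \<mu> l (mono_fun e)" if e: "e \<in> exponents l" for e :: "3 \<Rightarrow> nat"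
  proof (cases "e 1 + e 2 + e 3 = l")
    case True
    from spanned_harm_span[OF mu harm_span_monomial True]
    have "spanned \<mu> l (\<lambda>x. Re (planar_part x) ^ e 1 * Im (planar_part x) ^ e 2 * (x $ 3) ^ e 3)" .
    then show ?thesis by (simp add: planar_part_def mono_fun_3[abs_def])
  next
    case False
    then have "(\<Sum>i\<in>UNIV. e i) < l" using e by (simp add: sum_3)
    moreover have "mono_fun e \<in> polys_le (\<Sum>i\<in>UNIV. e i)" by (rule polys_le_mono_fun) simp
    ultimately show ?thesis by (intro spanned_low) (auto simp: lower_poly_def)
  qed
  then show ?thesis unfolding qc by (intro spanned_sum spanned_scale) auto
qed

text \<open>The remainder left by \<open>spanned_polys_le\<close> is a difference of two elements of
  the space and has lower degree, so it is orthogonal to itself.\<close>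

lemma V_span:
  assumes mu: "\<mu> \<ge> 0" and q: "q \<in> ball_V \<mu> l"
  shows "\<exists>b. q = (\<lambda>x. \<Sum>j\<in>ball_index l. b j * ball_basis \<mu> l j x)"
proof -
  have "spanned \<mu> l q" using q by (intro spanned_polys_le[OF mu]) (simp add: ball_V_iff[OF mu])
  then obtain c r where qc: "q = (\<lambda>x. (\<Sum>j\<in>ball_index l. c j * ball_basis \<mu> l j x) + r x)" and r: "lower_poly l r"
    unfolding spanned_def by blast
  let ?S = "\<lambda>x. \<Sum>j\<in>ball_index l. c j * ball_basis \<mu> l j x"
  have S: "?S \<in> ball_V \<mu> l"
  proof (intro ball_V_sum ball_V_scale mu)
    fix j assume "j \<in> ball_index l"
    then show "ball_basis \<mu> l j \<in> ball_V \<mu> l" by (cases j) (auto intro: ball_basis_in_V[OF mu])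
  qed
  have "(\<lambda>x. q x - ?S x) \<in> ball_V \<mu> l" by (rule ball_V_diff[OF mu q S])
  moreover have "(\<lambda>x. q x - ?S x) = r" by (auto simp: qc)
  ultimately have rV: "r \<in> ball_V \<mu> l" by simp
  then have "ball_inner \<mu> r r = 0" using r by (simp add: ball_V_iff[OF mu])
  then have "r = (\<lambda>x. 0)" using inner_self_eq_0[OF mu lower_poly_polys_le[OF r]] by blast
  then have "q = ?S" using qc by simp
  then show ?thesis by blast
qed

section \<open>The kernel as a polynomial\<close>

text \<open>De Moivre's formula. At the origin the conventional argument is harmless:
  \<open>r ^ j\<close> vanishes for \<open>j > 0\<close>, and \<open>ang 0\<close> is
  constant.\<close>

lemma disk_P_disk_hom:
  assumes "\<mu> \<ge> 0"
  shows "disk_P \<mu> k i \<epsilon> x y = disk_hom \<mu> k i \<epsilon> 1 (Complex x y)"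
proof -
  let ?z = "Complex x y"
  have "?z = of_real (cmod ?z) * cis (Arg ?z)" using rcis_cmod_Arg[of ?z] by (simp add: rcis_def)
  then have "harm j \<epsilon> ?z = cmod ?z ^ j * ang j \<epsilon> (Arg ?z)" for j
    using harm_scale[of j \<epsilon> "cmod ?z" "cis (Arg ?z)"]
    by (simp add: harm_def ang_def Complex.DeMoivre)
  moreover have "poly (jacobi_shift \<mu> j i) s = poly (jacobi_poly (\<mu> - 1/2) (real j) i) (2 * s - 1)" for j s
    by (simp add: jacobi_shift_def poly_pcompose algebra_simps)
  ultimately show ?thesis
    unfolding disk_P_def Let_def disk_hom_1[OF assms] by (simp only: mult.assoc)
qed

abbreviation disk_index :: "nat \<Rightarrow> (nat \<times> nat) set" where
  "disk_index k \<equiv> {(i, \<epsilon>). \<epsilon> \<in> {0, 1} \<and> 2 * i + \<epsilon> \<le> k}"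

definition disk_D_hom :: "real \<Rightarrow> nat \<Rightarrow> real \<Rightarrow> real^3 \<Rightarrow> real" where
  "disk_D_hom \<mu> k \<xi> x = (\<Sum>(i, \<epsilon>)\<in>disk_index k. disk_lambda \<mu> i k * disk_hom \<mu> k i \<epsilon> 1 (cis \<xi>) *
      disk_hom \<mu> k i \<epsilon> (1 - (x $ 3)\<^sup>2) (planar_part x))"

lemma slice_expr_disk_D_hom:
  assumes mu: "\<mu> \<ge> 0" and x: "\<bar>x $ 3\<bar> < 1"
  shows "slice_expr \<mu> k \<xi> t x = (real k + \<mu> + 1/2) / (\<mu> + 1/2) * gegenbauer k (\<mu> + 1/2) t * disk_D_hom \<mu> k \<xi> x"
proof -
  define s where "s = sqrt (1 - (x $ 3)\<^sup>2)"
  have s: "s > 0" "s\<^sup>2 = 1 - (x $ 3)\<^sup>2" using one_minus_sq_pos[OF x] by (auto simp: s_def)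
  have z: "of_real s * Complex (x $ 1 / s) (x $ 2 / s) = planar_part x"
    using s by (simp add: planar_part_def complex_eq_iff)
  have c: "Complex (cos \<xi>) (sin \<xi>) = cis \<xi>" by (simp add: complex_eq_iff)
  have "s ^ k * disk_D \<mu> k \<xi> (x $ 1 / s) (x $ 2 / s) = disk_D_hom \<mu> k \<xi> x"
    unfolding disk_D_def disk_D_hom_def disk_P_disk_hom[OF mu] c sum_distrib_left
  proof (rule sum.cong[OF refl], clarify)
    fix i \<epsilon> assume "2 * i + \<epsilon> \<le> k"
    then have i: "2 * i \<le> k" by simp
    have "disk_hom \<mu> k i \<epsilon> (1 - (x $ 3)\<^sup>2) (planar_part x) = s ^ k * disk_hom \<mu> k i \<epsilon> 1 (Complex (x $ 1 / s) (x $ 2 / s))"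
      using disk_hom_scale[OF i, of \<mu> \<epsilon> s 1 "Complex (x $ 1 / s) (x $ 2 / s)"] by (simp only: z s(2) mult_1_right)
    then show "s ^ k * (disk_lambda \<mu> i k * disk_hom \<mu> k i \<epsilon> 1 (cis \<xi>) * disk_hom \<mu> k i \<epsilon> 1 (Complex (x $ 1 / s) (x $ 2 / s))) =
      disk_lambda \<mu> i k * disk_hom \<mu> k i \<epsilon> 1 (cis \<xi>) * disk_hom \<mu> k i \<epsilon> (1 - (x $ 3)\<^sup>2) (planar_part x)"
      by simp
  qed
  moreover have "slice_expr \<mu> k \<xi> t x = (real k + \<mu> + 1/2) / (\<mu> + 1/2) * gegenbauer k (\<mu> + 1/2) t *
      (s ^ k * disk_D \<mu> k \<xi> (x $ 1 / s) (x $ 2 / s))"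
    unfolding slice_expr_def ridge_D_def s_def[symmetric] by (simp only: mult_ac)
  ultimately show ?thesis by (simp only:)
qed

lemma disk_D_hom_polynomial: "real_polynomial_function (disk_D_hom \<mu> k \<xi>)"
proof -
  have "(\<lambda>x. disk_D_hom \<mu> k \<xi> x) \<in> polys_le k"
    unfolding disk_D_hom_def case_prod_beta
    by (intro polys_le_sum polys_le_scale disk_hom_polys_le) auto
  then show ?thesis by (rule polys_le_real_polynomial)
qed

text \<open>The slab contains the open unit ball, so \<open>real_polynomial_zero\<close> makes the
  polynomial in the definite description unique; one formula then covers slab and poles.\<close>

lemma slice_D_disk_D_hom:
  assumes mu: "\<mu> \<ge> 0"
  shows "slice_D \<mu> k \<xi> t x = (real k + \<mu> + 1/2) / (\<mu> + 1/2) * gegenbauer k (\<mu> + 1/2) t * disk_D_hom \<mu> k \<xi> x"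
proof -
  let ?p = "\<lambda>x. (real k + \<mu> + 1/2) / (\<mu> + 1/2) * gegenbauer k (\<mu> + 1/2) t * disk_D_hom \<mu> k \<xi> x"
  have rp: "real_polynomial_function ?p"
    by (intro real_polynomial_function.intros(2,4) disk_D_hom_polynomial)
  have "(THE p. real_polynomial_function p \<and> (\<forall>y. \<bar>y $ 3\<bar> < 1 \<longrightarrow> p y = slice_expr \<mu> k \<xi> t y)) = ?p"
  proof (rule the_equality)
    show "real_polynomial_function ?p \<and> (\<forall>y. \<bar>y $ 3\<bar> < 1 \<longrightarrow> ?p y = slice_expr \<mu> k \<xi> t y)"
      using rp slice_expr_disk_D_hom[OF mu] by simp
    fix p assume p: "real_polynomial_function p \<and> (\<forall>y. \<bar>y $ 3\<bar> < 1 \<longrightarrow> p y = slice_expr \<mu> k \<xi> t y)"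
    show "p = ?p"
    proof
      fix x
      have "p x - ?p x = 0"
      proof (rule real_polynomial_zero[of "\<lambda>x. p x - ?p x"])
        show "real_polynomial_function (\<lambda>x. p x - ?p x)" using p rp by (intro real_polynomial_function_diff) auto
        fix y :: "real^3" assume "norm y < 1"
        then have "\<bar>y $ 3\<bar> < 1" using component_le_norm_cart[of y 3] by simp
        then show "p y - ?p y = 0" using p slice_expr_disk_D_hom[OF mu] by simp
      qed
      then show "p x = ?p x" by simp
    qed
  qed
  then show ?thesis unfolding slice_D_def using slice_expr_disk_D_hom[OF mu, of x] by simp
qed

section \<open>The quadrature formula\<close>

text \<open>\<open>disk_lambda\<close> is the reciprocal of the mean of the squared disk polynomial
  over the unit circle, where the radial factor is constant. The orthonormal Jacobi polynomial at 1
  is known through \<open>jacobi_nu\<close>, since \<open>jacobi_F\<close> equals 1 there.\<close>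

lemma lambda_normalization:
  assumes mu: "\<mu> \<ge> 0" and k: "2 * i + \<epsilon> \<le> k" "\<epsilon> < 2"
  shows "disk_lambda \<mu> i k * ((disk_h \<mu> i k)\<^sup>2 * (poly (jacobi_poly (\<mu> - 1/2) (real (k - 2 * i)) i) 1)\<^sup>2) * harm_mean (k - 2 * i) \<epsilon> = 1"
proof -
  define j where "j = k - 2 * i"
  have kj: "k = 2 * i + j" and ki: "k - i = j + i" using k by (auto simp: j_def)
  have nz: "\<mu> + 3/2 \<notin> \<int>\<^sub>\<le>\<^sub>0" using mu by (auto dest!: nonpos_Ints_nonpos)
  have G: "Gamma (\<mu> + 3/2) > 0" using mu by (intro Gamma_real_pos) auto
  have g: "Gamma (real j + \<mu> + 3/2) = pochhammer (\<mu> + 3/2) j * Gamma (\<mu> + 3/2)"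
    using pochhammer_Gamma[OF nz, of j] G by (simp add: field_simps)
  have gf: "Gamma (real j + 1) = fact j" using Gamma_fact[of j, where 'a = real] by (simp add: add.commute)
  \<comment> \<open>\<open>2 * i = k\<close> forces \<open>\<epsilon> = 0\<close>, the only case in
    which the mean is 1.\<close>
  have d: "disk_d i k = harm_mean j \<epsilon>" using k by (auto simp: disk_d_def harm_mean_def j_def)
  have d0: "harm_mean j \<epsilon> > 0" using k by (auto simp: harm_mean_def j_def)
  have P: "pochhammer (\<mu> + 3/2) j > 0" using mu by (intro pochhammer_pos) auto
  have h2: "(disk_h \<mu> i k)\<^sup>2 = 1 / harm_mean j \<epsilon> * (pochhammer (\<mu> + 3/2) j / fact j)"
  proof -
    have "1 / harm_mean j \<epsilon> * (pochhammer (\<mu> + 3/2) j / fact j) \<ge> 0" using d0 P by (intro mult_nonneg_nonneg) auto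
    moreover have "disk_h \<mu> i k = sqrt (1 / harm_mean j \<epsilon> * (pochhammer (\<mu> + 3/2) j / fact j))"
      unfolding disk_h_def d j_def[symmetric] g gf using G by simp
    ultimately show ?thesis by (simp only: real_sqrt_pow2)
  qed
  have "\<mu> - 1/2 > -1" "real j > -1" "\<mu> - 1/2 + real j + 1 > 0" using mu by auto
  then have p2: "(poly (jacobi_poly (\<mu> - 1/2) (real j) i) 1)\<^sup>2 = 1 / jacobi_nu (\<mu> - 1/2) (real j) i"
    by (rule jacobi_poly_facts(4))
  have e: "\<mu> - 1/2 + 1 = \<mu> + 1/2" "\<mu> - 1/2 + real j + 1 = \<mu> + real j + 1/2" "\<mu> - 1/2 + real j + 2 = \<mu> + 3/2 + real j" by simp_all
  have nu: "jacobi_nu (\<mu> - 1/2) (real j) i = fact i * pochhammer (real j + 1) i * (\<mu> + real j + 1/2 + real i) /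
      (pochhammer (\<mu> + 1/2) i * pochhammer (\<mu> + 3/2 + real j) i * (\<mu> + real j + 1/2 + 2 * real i))"
    unfolding jacobi_nu_def e by simp
  have f1: "fact (k - i) = fact j * pochhammer (real j + 1) i"
    unfolding ki using pochhammer_product'[of "1::real" j i] by (simp add: pochhammer_fact[symmetric] add.commute)
  have f2: "pochhammer (\<mu> + 3/2) (k - i) = pochhammer (\<mu> + 3/2) j * pochhammer (\<mu> + 3/2 + real j) i"
    unfolding ki by (rule pochhammer_product')
  have l: "disk_lambda \<mu> i k = fact i * (fact j * pochhammer (real j + 1) i) * (\<mu> + real j + 1/2 + real i) /
      (pochhammer (\<mu> + 1/2) i * (pochhammer (\<mu> + 3/2) j * pochhammer (\<mu> + 3/2 + real j) i) * (\<mu> + real j + 1/2 + 2 * real i))"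
  proof -
    have "real (k - i) + \<mu> + 1/2 = \<mu> + real j + 1/2 + real i" "real k + \<mu> + 1/2 = \<mu> + real j + 1/2 + 2 * real i"
      unfolding ki kj by simp_all
    then show ?thesis unfolding disk_lambda_def f1 f2 by (simp only:)
  qed
  have pos: "pochhammer (real j + 1) i > 0" "pochhammer (\<mu> + 1/2) i > 0" "pochhammer (\<mu> + 3/2 + real j) i > 0"
    "\<mu> + real j + 1/2 + real i > 0" "\<mu> + real j + 1/2 + 2 * real i > 0"
    using mu by (auto intro!: pochhammer_pos)
  have alg: "fi * (fj * pj) * a / (ph * (P * Q) * b) * (1 / d * (P / fj) * (1 / (fi * pj * a / (ph * Q * b)))) * d = 1"
    if "fi \<noteq> 0" "fj \<noteq> 0" "pj \<noteq> 0" "a \<noteq> 0" "ph \<noteq> 0" "P \<noteq> 0" "Q \<noteq> 0" "b \<noteq> 0" "d \<noteq> 0"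
    for fi fj pj a ph P Q b d :: real
    using that by simp
  show ?thesis
    unfolding j_def[symmetric] l h2 p2 nu
    by (rule alg) (use pos P d0 in auto)
qed

lemma disk_hom_cis:
  assumes mu: "\<mu> \<ge> 0"
  shows "disk_hom \<mu> k i \<epsilon> 1 (cis \<xi>) = disk_h \<mu> i k * poly (jacobi_poly (\<mu> - 1/2) (real (k - 2 * i)) i) 1 * harm (k - 2 * i) \<epsilon> (cis \<xi>)"
  using jacobi_shift_facts(3)[OF mu, of "k - 2 * i" i 1] by (simp add: disk_hom_1[OF mu])

text \<open>By \<open>disk_hom_cis\<close> the node values are constants times \<open>cos\<close> or
  \<open>sin\<close> of multiples of the angle, so \<open>harm_sum_orth\<close> applies, and
  \<open>lambda_normalization\<close> gives the diagonal.\<close>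

lemma quadrature:
  assumes mu: "\<mu> \<ge> 0" and N: "N > 0"
    and g: "\<And>i i'. 2 * i \<le> k \<Longrightarrow> 2 * i' \<le> k \<Longrightarrow> good_nodes N \<xi> (k - 2 * i) (k - 2 * i')"
    and j: "2 * i + \<epsilon> \<le> k" "\<epsilon> < 2" and j': "2 * i' + \<epsilon>' \<le> k" "\<epsilon>' < 2"
  shows "disk_lambda \<mu> i k / real N * (\<Sum>\<nu><N. disk_hom \<mu> k i \<epsilon> 1 (cis (\<xi> \<nu>)) * disk_hom \<mu> k i' \<epsilon>' 1 (cis (\<xi> \<nu>))) =
    (if i = i' \<and> \<epsilon> = \<epsilon>' then 1 else 0)"
proof -
  let ?c = "\<lambda>i. disk_h \<mu> i k * poly (jacobi_poly (\<mu> - 1/2) (real (k - 2 * i)) i) 1"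
  have "(\<Sum>\<nu><N. disk_hom \<mu> k i \<epsilon> 1 (cis (\<xi> \<nu>)) * disk_hom \<mu> k i' \<epsilon>' 1 (cis (\<xi> \<nu>))) =
      ?c i * ?c i' * (\<Sum>\<nu><N. harm (k - 2 * i) \<epsilon> (cis (\<xi> \<nu>) * 1) * harm (k - 2 * i') \<epsilon>' (cis (\<xi> \<nu>) * 1))"
    unfolding disk_hom_cis[OF mu] sum_distrib_left by (simp add: mult_ac)
  also have "\<dots> = (if i = i' \<and> \<epsilon> = \<epsilon>' then real N * ((?c i)\<^sup>2 * harm_mean (k - 2 * i) \<epsilon>) else 0)"
    using j j' by (subst harm_sum_orth[OF g]) (auto simp: power2_eq_square)
  finally have s: "(\<Sum>\<nu><N. disk_hom \<mu> k i \<epsilon> 1 (cis (\<xi> \<nu>)) * disk_hom \<mu> k i' \<epsilon>' 1 (cis (\<xi> \<nu>))) =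
     (if i = i' \<and> \<epsilon> = \<epsilon>' then real N * ((?c i)\<^sup>2 * harm_mean (k - 2 * i) \<epsilon>) else 0)" .
  show ?thesis
  proof (cases "i = i' \<and> \<epsilon> = \<epsilon>'")
    case True
    have "disk_lambda \<mu> i k / real N * (real N * ((?c i)\<^sup>2 * harm_mean (k - 2 * i) \<epsilon>)) =
        disk_lambda \<mu> i k * ((disk_h \<mu> i k)\<^sup>2 * (poly (jacobi_poly (\<mu> - 1/2) (real (k - 2 * i)) i) 1)\<^sup>2) * harm_mean (k - 2 * i) \<epsilon>"
      using N by (simp add: power_mult_distrib)
    then show ?thesis unfolding s lambda_normalization[OF mu j] if_P[OF True] .
  qed (simp only: s if_False mult_zero_right)
qed

text \<open>The coefficients are read off from the kernel: multiplied by \<open>ball_basis\<close>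
  at \<open>x\<close> and summed over \<open>ball_index l\<close>, the \<open>\<nu>\<close>-th terms
  give the kernel for the node \<open>\<xi> \<nu>\<close> divided by \<open>ball_const\<close> and
  \<open>N\<close>.\<close>

definition dual_basis :: "real \<Rightarrow> nat \<Rightarrow> nat \<Rightarrow> (nat \<Rightarrow> real) \<Rightarrow> nat \<times> nat \<times> nat \<Rightarrow> real^3 \<Rightarrow> real" where
  "dual_basis \<mu> l N \<xi> = (\<lambda>(k, i, \<epsilon>) x. \<Sum>\<nu><N. (hsq \<mu> k * disk_lambda \<mu> i k * ((real k + \<mu> + 1/2) / (\<mu> + 1/2)) / real N *
      disk_hom \<mu> k i \<epsilon> 1 (cis (\<xi> \<nu>))) * (poly (axial_poly \<mu> l k) (x $ 3) * ridge_hom \<mu> k (\<xi> \<nu>) x))"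

lemma hsq_pos: "\<mu> \<ge> 0 \<Longrightarrow> hsq \<mu> k > 0"
  unfolding hsq_def by (intro divide_pos_pos pochhammer_pos) auto

lemma dual_basis_inner:
  assumes mu: "\<mu> \<ge> 0" and f: "f \<in> ball_L2 \<mu>"
  shows "ball_inner \<mu> f (dual_basis \<mu> l N \<xi> (k, i, \<epsilon>)) = (\<Sum>\<nu><N. (hsq \<mu> k * disk_lambda \<mu> i k * ((real k + \<mu> + 1/2) / (\<mu> + 1/2)) / real N *
      disk_hom \<mu> k i \<epsilon> 1 (cis (\<xi> \<nu>))) * ball_inner \<mu> f (\<lambda>x. poly (axial_poly \<mu> l k) (x $ 3) * ridge_hom \<mu> k (\<xi> \<nu>) x))"
proof -
  have c: "continuous_on UNIV (\<lambda>x. a * (poly (axial_poly \<mu> l k) (x $ 3) * ridge_hom \<mu> k (\<xi> \<nu>) x))" for a \<nu>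
    by (intro continuous_intros polys_le_continuous[OF ridge_hom_polys_le])
  show ?thesis unfolding dual_basis_def case_prod_conv
    by (subst inner_sum_right[OF mu f c]) (simp only: inner_cmult_right)
qed

text \<open>Each ridge polynomial already separates different \<open>k\<close>. For equal
  \<open>k\<close> the constants of \<open>dual_basis\<close> invert those of
  \<open>ball_basis_ridge_hom_inner\<close> except for \<open>disk_lambda\<close> and
  \<open>N\<close>, and what is left is \<open>quadrature\<close>.\<close>

lemma biorthogonal:
  assumes mu: "\<mu> \<ge> 0" and N: "N > 0"
    and g: "\<And>k i i'. k \<le> l \<Longrightarrow> 2 * i \<le> k \<Longrightarrow> 2 * i' \<le> k \<Longrightarrow> good_nodes N \<xi> (k - 2 * i) (k - 2 * i')"
    and j: "j \<in> ball_index l" and j': "j' \<in> ball_index l"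
  shows "ball_inner \<mu> (ball_basis \<mu> l j) (dual_basis \<mu> l N \<xi> j') = (if j = j' then 1 else 0)"
proof -
  obtain k i \<epsilon> k' i' \<epsilon>' where jj: "j = (k, i, \<epsilon>)" "j' = (k', i', \<epsilon>')" by (cases j, cases j') auto
  note J = j[unfolded jj] and J' = j'[unfolded jj]
  have k: "k \<le> l" "2 * i + \<epsilon> \<le> k" "\<epsilon> < 2" and k': "k' \<le> l" "2 * i' + \<epsilon>' \<le> k'" "\<epsilon>' < 2"
    using J J' by (auto simp: ball_index_def)
  have L2: "ball_basis \<mu> l (k, i, \<epsilon>) \<in> ball_L2 \<mu>"
    by (intro continuous_ball_L2[OF mu] ball_V_continuous[OF mu ball_basis_in_V[OF mu J]])
  show ?thesis
  proof (cases "k = k'")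
    case False
    then show ?thesis unfolding jj dual_basis_inner[OF mu L2] ball_basis_ridge_hom_inner[OF mu J k'(1)] by simp
  next
    case True
    have nz: "hsq \<mu> k \<noteq> 0" "real k + \<mu> + 1/2 \<noteq> 0" "\<mu> + 1/2 \<noteq> 0" using hsq_pos[OF mu, of k] mu by auto
    have "ball_inner \<mu> (ball_basis \<mu> l j) (dual_basis \<mu> l N \<xi> j') =
        (\<Sum>\<nu><N. disk_lambda \<mu> i' k / real N * (disk_hom \<mu> k i' \<epsilon>' 1 (cis (\<xi> \<nu>)) * disk_hom \<mu> k i \<epsilon> 1 (cis (\<xi> \<nu>))))"
      unfolding jj dual_basis_inner[OF mu L2] ball_basis_ridge_hom_inner[OF mu J k'(1)]
      unfolding True[symmetric]
    proof (rule sum.cong[OF refl])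
      fix \<nu>
      have alg: "(h * lm * (a / b) / n * p) * (b / a / h * q) = lm / n * (p * q)"
        if "h \<noteq> 0" "a \<noteq> 0" "b \<noteq> 0" for h lm a b n p q :: real using that by simp
      show "(hsq \<mu> k * disk_lambda \<mu> i' k * ((real k + \<mu> + 1/2) / (\<mu> + 1/2)) / real N * disk_hom \<mu> k i' \<epsilon>' 1 (cis (\<xi> \<nu>))) *
          (if k = k then (\<mu> + 1/2) / (real k + \<mu> + 1/2) / hsq \<mu> k * disk_hom \<mu> k i \<epsilon> 1 (cis (\<xi> \<nu>)) else 0) =
          disk_lambda \<mu> i' k / real N * (disk_hom \<mu> k i' \<epsilon>' 1 (cis (\<xi> \<nu>)) * disk_hom \<mu> k i \<epsilon> 1 (cis (\<xi> \<nu>)))"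
        unfolding if_P[OF refl] by (rule alg[OF nz])
    qed
    also have "\<dots> = disk_lambda \<mu> i' k / real N * (\<Sum>\<nu><N. disk_hom \<mu> k i' \<epsilon>' 1 (cis (\<xi> \<nu>)) * disk_hom \<mu> k i \<epsilon> 1 (cis (\<xi> \<nu>)))"
      by (simp only: sum_distrib_left)
    also have "\<dots> = (if i' = i \<and> \<epsilon>' = \<epsilon> then 1 else 0)"
      by (rule quadrature[OF mu N g[OF k(1)] k'(2)[folded True] k'(3) k(2,3)])
    finally show ?thesis using True jj by auto
  qed
qed

section \<open>From the kernel to the projection\<close>

text \<open>The parameter \<open>s\<close> occurs on the right only: as a polynomial in the point of
  the chord, the kernel is constant along the chord. This is the condition on \<open>G\<close> in
  \<open>radon_integral\<close>.\<close>

lemma G_kernel_chord: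
  assumes mu: "\<mu> \<ge> 0" and w: "\<bar>w\<bar> < 1"
  shows "G_kernel \<mu> l \<xi> t w x = ball_const \<mu> * (\<Sum>k\<le>l. (hsq \<mu> k * ((real k + \<mu> + 1/2) / (\<mu> + 1/2)) *
     disk_D_hom \<mu> k \<xi> x * poly (axial_poly \<mu> l k) (x $ 3)) * (poly (axial_poly \<mu> l k) (chord_pt \<xi> t w s $ 3) * ridge_hom \<mu> k \<xi> (chord_pt \<xi> t w s)))"
proof -
  have 3: "chord_pt \<xi> t w s $ 3 = w" by (simp add: chord_pt_def)
  have sq: "1 - (chord_pt \<xi> t w s $ 3)\<^sup>2 = (sqrt (1 - w\<^sup>2))\<^sup>2"
    using one_minus_sq_pos[OF w] by (simp add: 3)
  have "Re (cis (- \<xi>) * planar_part (chord_pt \<xi> t w s)) =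
      cos \<xi> * (t * sqrt (1 - w\<^sup>2) * cos \<xi> - s * sin \<xi>) + sin \<xi> * (t * sqrt (1 - w\<^sup>2) * sin \<xi> + s * cos \<xi>)"
    by (simp add: planar_part_def chord_pt_def)
  also have "\<dots> = sqrt (1 - w\<^sup>2) * t * ((sin \<xi>)\<^sup>2 + (cos \<xi>)\<^sup>2)"
    by (simp only: power2_eq_square) algebra
  finally have re: "Re (cis (- \<xi>) * planar_part (chord_pt \<xi> t w s)) = sqrt (1 - w\<^sup>2) * t" by simp
  show ?thesis
    unfolding G_kernel_def slice_D_disk_D_hom[OF mu] 3 ridge_hom_eq[OF mu sq re] poly_axial_poly atMost_atLeast0
    by (rule arg_cong[of _ _ "\<lambda>z. ball_const \<mu> * z"], rule sum.cong[OF refl]) (simp only: mult_ac)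
qed

lemma node_term:
  assumes mu: "\<mu> \<ge> 0" and f: "f \<in> ball_L2 \<mu>"
  shows "(LINT w:{-1<..<1}|lebesgue. (LINT t:{-1<..<1}|lebesgue. radon \<mu> f \<xi> t w * G_kernel \<mu> l \<xi> t w x) * sqrt (1 - w\<^sup>2)) =
    (\<Sum>k\<le>l. (hsq \<mu> k * ((real k + \<mu> + 1/2) / (\<mu> + 1/2)) * disk_D_hom \<mu> k \<xi> x * poly (axial_poly \<mu> l k) (x $ 3)) *
       ball_inner \<mu> f (\<lambda>y. poly (axial_poly \<mu> l k) (y $ 3) * ridge_hom \<mu> k \<xi> y))"
proof -
  let ?c = "\<lambda>k. hsq \<mu> k * ((real k + \<mu> + 1/2) / (\<mu> + 1/2)) * disk_D_hom \<mu> k \<xi> x * poly (axial_poly \<mu> l k) (x $ 3)"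
  let ?Z = "\<lambda>k y. poly (axial_poly \<mu> l k) (y $ 3) * ridge_hom \<mu> k \<xi> y"
  have c: "continuous_on UNIV (\<lambda>y. ?c k * ?Z k y)" for k
    by (intro continuous_intros polys_le_continuous[OF ridge_hom_polys_le])
  have c': "continuous_on UNIV (\<lambda>y. ball_const \<mu> * (\<Sum>k\<le>l. ?c k * ?Z k y))"
    by (intro continuous_on_mult continuous_on_const continuous_on_sum c)
  have "(LINT w:{-1<..<1}|lebesgue. (LINT t:{-1<..<1}|lebesgue. radon \<mu> f \<xi> t w * G_kernel \<mu> l \<xi> t w x) * sqrt (1 - w\<^sup>2)) =
     ball_integral \<mu> (\<lambda>y. f y * (ball_const \<mu> * (\<Sum>k\<le>l. ?c k * ?Z k y)))"
    by (rule radon_integral[OF mu f c']) (rule G_kernel_chord[OF mu])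
  also have "\<dots> = ball_inner \<mu> f (\<lambda>y. \<Sum>k\<le>l. ?c k * ?Z k y)"
    unfolding ball_inner_ball_integral ball_integral_cmult[symmetric] by (simp only: mult.left_commute[of "ball_const \<mu>"])
  also have "\<dots> = (\<Sum>k\<le>l. ?c k * ball_inner \<mu> f (?Z k))"
    by (subst inner_sum_right[OF mu f c]) (simp only: inner_cmult_right)
  finally show ?thesis .
qed

text \<open>Any nodes that are good for the occurring frequencies will do; both formulas of the
  theorem are instances.\<close>

lemma projection_formula:
  assumes mu: "\<mu> \<ge> 0" and N: "N > 0" and f: "f \<in> ball_L2 \<mu>"
    and g: "\<And>k i i'. k \<le> l \<Longrightarrow> 2 * i \<le> k \<Longrightarrow> 2 * i' \<le> k \<Longrightarrow> good_nodes N \<xi> (k - 2 * i) (k - 2 * i')"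
  shows "ball_proj \<mu> l f x = 1 / real N * (\<Sum>\<nu><N.
    LINT w:{-1<..<1}|lebesgue. (LINT t:{-1<..<1}|lebesgue. radon \<mu> f (\<xi> \<nu>) t w * G_kernel \<mu> l (\<xi> \<nu>) t w x) * sqrt (1 - w\<^sup>2))"
proof -
  have YV: "ball_basis \<mu> l j \<in> ball_V \<mu> l" if "j \<in> ball_index l" for j
    using that by (cases j) (auto intro: ball_basis_in_V[OF mu])
  have XV: "dual_basis \<mu> l N \<xi> j \<in> ball_V \<mu> l" if j: "j \<in> ball_index l" for j
  proof -
    obtain k i \<epsilon> where jj: "j = (k, i, \<epsilon>)" by (cases j) auto
    have "k \<le> l" using j jj by (auto simp: ball_index_def)
    then show ?thesis unfolding jj dual_basis_def case_prod_conv
      by (intro ball_V_sum ball_V_scale mu ridge_hom_in_V)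
  qed
  have proj: "ball_proj \<mu> l f = (\<lambda>x. \<Sum>j\<in>ball_index l. ball_inner \<mu> f (dual_basis \<mu> l N \<xi> j) * ball_basis \<mu> l j x)"
    by (rule biorthogonal_projection[OF mu finite_ball_index f YV XV biorthogonal[OF mu N g] V_span[OF mu]])
  let ?Z = "\<lambda>k \<nu> y. poly (axial_poly \<mu> l k) (y $ 3) * ridge_hom \<mu> k (\<xi> \<nu>) y"
  let ?a = "\<lambda>k. hsq \<mu> k * ((real k + \<mu> + 1/2) / (\<mu> + 1/2))"
  have fin: "finite (disk_index k)" for k by (rule finite_subset[of _ "{..k} \<times> {0, 1}"]) auto
  have J: "ball_index l = (SIGMA k:{..l}. disk_index k)" by (auto simp: ball_index_def)
  \<comment> \<open>One summand for each index and node; the rest interchanges finite sums and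
    collects \<open>(i, \<epsilon>)\<close> into \<open>disk_D_hom\<close>.\<close>
  define t where "t k i \<epsilon> \<nu> = 1 / real N * (?a k * (disk_lambda \<mu> i k * disk_hom \<mu> k i \<epsilon> 1 (cis (\<xi> \<nu>)) *
      disk_hom \<mu> k i \<epsilon> (1 - (x $ 3)\<^sup>2) (planar_part x)) * poly (axial_poly \<mu> l k) (x $ 3) * ball_inner \<mu> f (?Z k \<nu>))" for k i \<epsilon> \<nu>
  have "ball_proj \<mu> l f x = (\<Sum>(k, i, \<epsilon>)\<in>ball_index l. \<Sum>\<nu><N. t k i \<epsilon> \<nu>)"
    unfolding proj
  proof (rule sum.cong[OF refl], clarify)
    fix k i \<epsilon>
    show "ball_inner \<mu> f (dual_basis \<mu> l N \<xi> (k, i, \<epsilon>)) * ball_basis \<mu> l (k, i, \<epsilon>) x = (\<Sum>\<nu><N. t k i \<epsilon> \<nu>)"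
      unfolding dual_basis_inner[OF mu f] sum_distrib_right
      by (rule sum.cong) (simp_all add: t_def ball_basis_def mult_ac)
  qed
  also have "\<dots> = (\<Sum>k\<le>l. \<Sum>(i, \<epsilon>)\<in>disk_index k. \<Sum>\<nu><N. t k i \<epsilon> \<nu>)"
    unfolding J by (subst sum.Sigma) (simp, use fin in blast, rule refl)
  also have "\<dots> = (\<Sum>k\<le>l. \<Sum>\<nu><N. \<Sum>(i, \<epsilon>)\<in>disk_index k. t k i \<epsilon> \<nu>)"
    unfolding case_prod_beta by (subst sum.swap) (rule refl)
  also have "\<dots> = (\<Sum>\<nu><N. \<Sum>k\<le>l. \<Sum>(i, \<epsilon>)\<in>disk_index k. t k i \<epsilon> \<nu>)"
    by (rule sum.swap)
  also have "\<dots> = (\<Sum>\<nu><N. 1 / real N * (\<Sum>k\<le>l. (?a k * disk_D_hom \<mu> k (\<xi> \<nu>) x * poly (axial_poly \<mu> l k) (x $ 3)) * ball_inner \<mu> f (?Z k \<nu>)))"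
  proof (rule sum.cong[OF refl])
    fix \<nu>
    show "(\<Sum>k\<le>l. \<Sum>(i, \<epsilon>)\<in>disk_index k. t k i \<epsilon> \<nu>) =
      1 / real N * (\<Sum>k\<le>l. (?a k * disk_D_hom \<mu> k (\<xi> \<nu>) x * poly (axial_poly \<mu> l k) (x $ 3)) * ball_inner \<mu> f (?Z k \<nu>))"
      unfolding t_def disk_D_hom_def case_prod_beta sum_distrib_left sum_distrib_right ..
  qed
  finally show ?thesis unfolding node_term[OF mu f] sum_distrib_left .
qed

section \<open>The nodes of the theorem\<close>

text \<open>Both frequencies have the parity of \<open>k\<close>, so their sum and difference are
  even and at most \<open>2 * n\<close> in modulus.\<close>

lemma good_nodes_half_circle:
  assumes "N > 0" and h: "\<And>r::int. r \<noteq> 0 \<Longrightarrow> even r \<Longrightarrow> \<bar>r\<bar> \<le> 2 * int n \<Longrightarrow> (\<Sum>\<nu><N. cis (real_of_int r * \<xi> \<nu>)) = 0"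
    and k: "k \<le> n" "2 * i \<le> k" "2 * i' \<le> k"
  shows "good_nodes N \<xi> (k - 2 * i) (k - 2 * i')"
proof -
  let ?j = "k - 2 * i" and ?j' = "k - 2 * i'"
  have "?j + ?j' \<noteq> 0 \<Longrightarrow> (\<Sum>\<nu><N. cis (real_of_int (int ?j + int ?j') * \<xi> \<nu>)) = 0"
    by (rule h) (use k in \<open>auto simp: of_nat_diff\<close>)
  moreover have "?j \<noteq> ?j' \<Longrightarrow> (\<Sum>\<nu><N. cis (real_of_int (int ?j - int ?j') * \<xi> \<nu>)) = 0"
    by (rule h) (use k in \<open>auto simp: of_nat_diff\<close>)
  ultimately show ?thesis
    unfolding good_nodes_def cis_power_cnj by (simp add: Complex.DeMoivre)
qed

text \<open>For even \<open>r\<close> the step \<open>r * pi / (n + 1)\<close> is a multiple of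
  \<open>2 * pi / (n + 1)\<close>, and the bound on \<open>r\<close> keeps it from being a multiple
  of \<open>2 * pi\<close>. So a nontrivial root of unity is summed over a full period, or over two
  when \<open>N = 2 * n + 2\<close>.\<close>

lemma equidistant_cis_sum:
  fixes r :: int
  assumes r: "r \<noteq> 0" "even r" "\<bar>r\<bar> \<le> 2 * int n" and N: "N = n + 1 \<or> N = 2 * n + 2"
  shows "(\<Sum>\<nu><N. cis (real_of_int r * (real \<nu> * pi / real (n + 1)))) = 0"
proof -
  have "(\<Sum>\<nu><N. cis (real \<nu> * (real_of_int r * pi / real (n + 1)))) = 0"
  proof (rule cis_geometric)
    show "0 < \<bar>real_of_int r * pi / real (n + 1)\<bar>" using r by simp
    have "\<bar>real_of_int r\<bar> \<le> 2 * real n" using r(3) by linarith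
    then have "\<bar>real_of_int r\<bar> * pi < (2 * real (n + 1)) * pi" by (intro mult_strict_right_mono) auto
    then show "\<bar>real_of_int r * pi / real (n + 1)\<bar> < 2 * pi"
      by (simp add: abs_mult pos_divide_less_eq algebra_simps)
    obtain m where m: "r = 2 * m" using r(2) by blast
    show "cis (real N * (real_of_int r * pi / real (n + 1))) = 1"
    proof (cases "N = n + 1")
      case True
      then have "real N * (real_of_int r * pi / real (n + 1)) = 2 * pi * of_int m" by (simp add: m)
      then show ?thesis by (simp only: cis_multiple_2pi Ints_of_int)
    next
      case False
      then have N2: "real N = 2 * real (n + 1)" using N by auto
      have "(2 * M) * (R * pi / M) = 2 * pi * R" if "M \<noteq> 0" for M R :: real using that by simp
      then have "real N * (real_of_int r * pi / real (n + 1)) = 2 * pi * of_int r"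
        unfolding N2 by (metis of_nat_eq_0_iff add_is_0 one_neq_zero)
      then show ?thesis by (simp only: cis_multiple_2pi Ints_of_int)
    qed
  qed
  then show ?thesis by (simp add: mult_ac)
qed

theorem proposition4p4:
  fixes \<mu> :: real and n l :: nat and \<xi> :: "nat \<Rightarrow> real"
    and f :: "real^3 \<Rightarrow> real" and x :: "real^3"
  assumes "\<mu> \<ge> 0" and "l \<le> n"
    and "\<And>\<nu>. \<nu> \<le> 2 * n + 1 \<Longrightarrow> \<xi> \<nu> = real \<nu> * pi / real (n + 1)"
    and "f \<in> ball_L2 \<mu>" and "x \<in> cball 0 1"
  shows "ball_proj \<mu> l f x =
           1 / real (n + 1) * (\<Sum>\<nu> = 0..n.
             LINT w:{-1<..<1}|lebesgue.
               (LINT t:{-1<..<1}|lebesgue.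
                  radon \<mu> f (\<xi> \<nu>) t w * G_kernel \<mu> l (\<xi> \<nu>) t w x) * sqrt (1 - w\<^sup>2))
       \<and> ball_proj \<mu> l f x =
           1 / real (2 * n + 2) * (\<Sum>\<nu> = 0..2 * n + 1.
             LINT w:{-1<..<1}|lebesgue.
               (LINT t:{-1<..<1}|lebesgue.
                  radon \<mu> f (\<xi> \<nu>) t w * G_kernel \<mu> l (\<xi> \<nu>) t w x) * sqrt (1 - w\<^sup>2))"
proof -
  have main: "ball_proj \<mu> l f x = 1 / real N * (\<Sum>\<nu><N.
      LINT w:{-1<..<1}|lebesgue. (LINT t:{-1<..<1}|lebesgue.
        radon \<mu> f (\<xi> \<nu>) t w * G_kernel \<mu> l (\<xi> \<nu>) t w x) * sqrt (1 - w\<^sup>2))"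
    if N: "N = n + 1 \<or> N = 2 * n + 2" for N
  proof (rule projection_formula[OF assms(1) _ assms(4)])
    show "N > 0" using N by auto
    fix k i i' assume k: "k \<le> l" "2 * i \<le> k" "2 * i' \<le> k"
    show "good_nodes N \<xi> (k - 2 * i) (k - 2 * i')"
    proof (rule good_nodes_half_circle)
      show "N > 0" using N by auto
      show "k \<le> n" using k assms(2) by simp
      fix r :: int assume r: "r \<noteq> 0" "even r" "\<bar>r\<bar> \<le> 2 * int n"
      \<comment> \<open>\<open>\<xi>\<close> is prescribed for indices up to
        \<open>2 * n + 1\<close>, and \<open>\<nu> < N\<close> stays in this range for both values
        of \<open>N\<close>.\<close>
      have "(\<Sum>\<nu><N. cis (real_of_int r * \<xi> \<nu>)) = (\<Sum>\<nu><N. cis (real_of_int r * (real \<nu> * pi / real (n + 1))))"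
        by (rule sum.cong[OF refl]) (use assms(3) N in auto)
      also have "\<dots> = 0" by (rule equidistant_cis_sum[OF r N])
      finally show "(\<Sum>\<nu><N. cis (real_of_int r * \<xi> \<nu>)) = 0" .
    qed (use k in auto)
  qed
  have "{0..n} = {..<n + 1}" "{0..2 * n + 1} = {..<2 * n + 2}" by auto
  then show ?thesis using main[of "n + 1"] main[of "2 * n + 2"] by simp
qed

end
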